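(* Linearizable systems of two second-order ODEs reducible to the linear form $$Y''=-\beta(x)Z,\qquad Z''=\beta(x)Y$$ via invertible complex point transformations have $6$, $7$ or $15$-dimensional Lie point symmetry algebras.
   Context: $x$ is a real independent variable, prime denotes differentiation with respect to $x$, $Y,Z$ are real dependent variables, and $\beta$ is a real function of $x$ (possibly zero, constant or non-constant). A system $y''=\omega_1(x,y,z,y',z')$, $z''=\omega_2(x,y,z,y',z')$ is reducible to the linear form via invertible complex point transformations if it is the system of real and imaginary parts, under $u=y+iz$, of a scalar complex second-order ODE $u''=\omega(x,u,u')$ (with $\omega=\omega_1+i\omega_2$ complex analytic in $u,u'$, and $x$ real), and an invertible transformation of the form $(x,u)\mapsto(\chi(x),U(x,u))$, with $\chi$ real-valued and $U$ complex analytic in $u$, maps this scalar equation to one whose real and imaginary parts, with $U=Y+iZ$ and the new independent variable $\chi$ again denoted $x$, form the linear system above, i.e. to $U''=i\beta(x)U$. The Lie point symmetry algebra of a system of two ODEs is the real Lie algebra of vector fields $\xi(x,y,z)\partial_x+\eta_1(x,y,z)\partial_y+\eta_2(x,y,z)\partial_z$ that generate (local) point symmetries of the system. *)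

theory Defs
  imports "HOL-Analysis.Analysis" "HOL-Complex_Analysis.Complex_Analysis" "HOL-Library.Function_Algebras"
begin

text \<open>
  A system of two second-order ODEs \<open>y'' = w1 (x,y,z,y',z')\<close>, \<open>z'' = w2 (x,y,z,y',z')\<close> is given by
  two functions on an open set \<open>D\<close> of first-order jets \<open>(x,y,z,y',z')\<close>.
\<close>

type_synonym point = "real \<times> real \<times> real"
type_synonym jet = "real \<times> real \<times> real \<times> real \<times> real"
type_synonym cpoint = "real \<times> complex"
type_synonym cjet = "real \<times> complex \<times> complex"

text \<open>Only used for open \<open>S\<close>.\<close>

primrec C_k_on :: "nat \<Rightarrow> 'a::real_normed_vector set \<Rightarrow> ('a \<Rightarrow> 'b::real_normed_vector) \<Rightarrow> bool" where
  "C_k_on 0 S f \<longleftrightarrow> continuous_on S f"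
| "C_k_on (Suc k) S f \<longleftrightarrow>
     f differentiable_on S \<and> (\<forall>v. C_k_on k S (\<lambda>x. frechet_derivative f (at x) v))"

definition smooth_on :: "'a::real_normed_vector set \<Rightarrow> ('a \<Rightarrow> 'b::real_normed_vector) \<Rightarrow> bool" where
  "smooth_on S f \<longleftrightarrow> (\<forall>k. C_k_on k S f)"

definition open_interval :: "real set \<Rightarrow> bool" where
  "open_interval J \<longleftrightarrow> open J \<and> is_interval J \<and> J \<noteq> {}"

definition graph :: "real set \<Rightarrow> (real \<Rightarrow> 'a) \<Rightarrow> (real \<times> 'a) set" where
  "graph J f = (\<lambda>x. (x, f x)) ` J"


section \<open>Real systems and their point symmetries\<close>

definition base :: "jet set \<Rightarrow> point set" where
  "base D = {(x, y, z). \<exists>p q. (x, y, z, p, q) \<in> D}"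

definition solution_on ::
  "jet set \<Rightarrow> (jet \<Rightarrow> real) \<Rightarrow> (jet \<Rightarrow> real) \<Rightarrow> real set \<Rightarrow> (real \<Rightarrow> real) \<Rightarrow> (real \<Rightarrow> real) \<Rightarrow> bool" where
  "solution_on D w1 w2 J y z \<longleftrightarrow>
     (\<exists>y' z'. \<forall>x\<in>J.
        (x, y x, z x, y' x, z' x) \<in> D \<and>
        (y has_real_derivative y' x) (at x) \<and>
        (z has_real_derivative z' x) (at x) \<and>
        (y' has_real_derivative w1 (x, y x, z x, y' x, z' x)) (at x) \<and>
        (z' has_real_derivative w2 (x, y x, z x, y' x, z' x)) (at x))"

definition local_flow ::
  "point set \<Rightarrow> (point \<Rightarrow> point) \<Rightarrow> real \<Rightarrow> point set \<Rightarrow> (real \<Rightarrow> point \<Rightarrow> point) \<Rightarrow> bool" where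
  "local_flow M X \<epsilon> N \<phi> \<longleftrightarrow>
     0 < \<epsilon> \<and> open N \<and> N \<subseteq> M \<and>
     smooth_on ({-\<epsilon><..<\<epsilon>} \<times> N) (\<lambda>(t, q). \<phi> t q) \<and>
     (\<forall>q\<in>N. \<phi> 0 q = q \<and>
        (\<forall>t\<in>{-\<epsilon><..<\<epsilon>}. \<phi> t q \<in> M \<and> ((\<lambda>s. \<phi> s q) has_vector_derivative X (\<phi> t q)) (at t)))"

text \<open>
  The flow of \<open>X\<close> maps solutions to solutions. For a given solution this is required for small times
  and near a given point of its graph: how far one can go before the moved curve ceases to be the graph
  of a function, or its jets leave \<open>D\<close>, depends on the solution.
\<close>

definition generates_point_symmetries ::
  "jet set \<Rightarrow> (jet \<Rightarrow> real) \<Rightarrow> (jet \<Rightarrow> real) \<Rightarrow> (point \<Rightarrow> point) \<Rightarrow> bool" where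
  "generates_point_symmetries D w1 w2 X \<longleftrightarrow>
     (\<forall>p\<in>base D. \<exists>\<epsilon> N \<phi>. p \<in> N \<and> local_flow (base D) X \<epsilon> N \<phi> \<and>
        (\<forall>J y z x0. open_interval J \<and> solution_on D w1 w2 J y z \<and>
             graph J (\<lambda>x. (y x, z x)) \<subseteq> N \<and> x0 \<in> J \<longrightarrow>
           (\<exists>\<delta> J0. 0 < \<delta> \<and> \<delta> \<le> \<epsilon> \<and> open_interval J0 \<and> x0 \<in> J0 \<and> J0 \<subseteq> J \<and>
              (\<forall>t\<in>{-\<delta><..<\<delta>}. \<exists>K yt zt. open_interval K \<and> solution_on D w1 w2 K yt zt \<and>
                 \<phi> t ` graph J0 (\<lambda>x. (y x, z x)) = graph K (\<lambda>x. (yt x, zt x))))))"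

text \<open>
  A vector field \<open>\<xi> \<partial>\<^sub>x + \<eta>1 \<partial>\<^sub>y + \<eta>2 \<partial>\<^sub>z\<close> is the map \<open>p \<mapsto> (\<xi> p, \<eta>1 p, \<eta>2 p)\<close>. Setting it to zero
  outside the base makes equality of functions coincide with equality of vector fields on the base.
\<close>

definition lie_point_symmetries ::
  "jet set \<Rightarrow> (jet \<Rightarrow> real) \<Rightarrow> (jet \<Rightarrow> real) \<Rightarrow> (point \<Rightarrow> point) set" where
  "lie_point_symmetries D w1 w2 =
     {X. smooth_on (base D) X \<and> (\<forall>p. p \<notin> base D \<longrightarrow> X p = 0) \<and> generates_point_symmetries D w1 w2 X}"

definition vf_scale :: "real \<Rightarrow> (point \<Rightarrow> point) \<Rightarrow> point \<Rightarrow> point" where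
  "vf_scale c X = (\<lambda>p. c *\<^sub>R X p)"

lemma vector_space_vf_scale: "vector_space vf_scale"
  by unfold_locales (auto simp: vf_scale_def fun_eq_iff algebra_simps)


section \<open>Scalar complex equations and complex point transformations\<close>

text \<open>Passing from \<open>(y,z)\<close> to \<open>u = y + i z\<close>; the independent variable stays real.\<close>

definition real_jet :: "cjet \<Rightarrow> jet" where
  "real_jet = (\<lambda>(x, u, v). (x, Re u, Im u, Re v, Im v))"

definition scalar_rhs :: "(jet \<Rightarrow> real) \<Rightarrow> (jet \<Rightarrow> real) \<Rightarrow> cjet \<Rightarrow> complex" where
  "scalar_rhs w1 w2 j = Complex (w1 (real_jet j)) (w2 (real_jet j))"

definition cbase :: "cjet set \<Rightarrow> cpoint set" where
  "cbase D = {(x, u). \<exists>v. (x, u, v) \<in> D}"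

definition scalar_admissible_on :: "cjet set \<Rightarrow> real set \<Rightarrow> (real \<Rightarrow> complex) \<Rightarrow> bool" where
  "scalar_admissible_on D J u \<longleftrightarrow>
     (\<exists>u'. \<forall>x\<in>J. (x, u x, u' x) \<in> D \<and> (u has_vector_derivative u' x) (at x))"

definition scalar_solution_on ::
  "cjet set \<Rightarrow> (cjet \<Rightarrow> complex) \<Rightarrow> real set \<Rightarrow> (real \<Rightarrow> complex) \<Rightarrow> bool" where
  "scalar_solution_on D \<omega> J u \<longleftrightarrow>
     (\<exists>u'. \<forall>x\<in>J. (x, u x, u' x) \<in> D \<and>
        (u has_vector_derivative u' x) (at x) \<and>
        (u' has_vector_derivative \<omega> (x, u x, u' x)) (at x))"

text \<open>
  Together with joint smoothness, analyticity in each of the two complex variables separately is the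
  same as joint analyticity in both.
\<close>

definition complex_analytic_rhs :: "cjet set \<Rightarrow> (cjet \<Rightarrow> complex) \<Rightarrow> bool" where
  "complex_analytic_rhs D \<omega> \<longleftrightarrow>
     smooth_on D \<omega> \<and>
     (\<forall>x v. (\<lambda>u. \<omega> (x, u, v)) holomorphic_on {u. (x, u, v) \<in> D}) \<and>
     (\<forall>x u. (\<lambda>v. \<omega> (x, u, v)) holomorphic_on {v. (x, u, v) \<in> D})"

definition point_map :: "(real \<Rightarrow> real) \<Rightarrow> (cpoint \<Rightarrow> complex) \<Rightarrow> cpoint \<Rightarrow> cpoint" where
  "point_map \<tau> U = (\<lambda>(x, u). (\<tau> x, U (x, u)))"

definition invertible_complex_point_transformation ::
  "cpoint set \<Rightarrow> (real \<Rightarrow> real) \<Rightarrow> (cpoint \<Rightarrow> complex) \<Rightarrow> bool" where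
  "invertible_complex_point_transformation M \<tau> U \<longleftrightarrow>
     smooth_on (fst ` M) \<tau> \<and> smooth_on M U \<and>
     (\<forall>x. (\<lambda>u. U (x, u)) holomorphic_on {u. (x, u) \<in> M}) \<and>
     (\<forall>x\<in>fst ` M. deriv \<tau> x \<noteq> 0) \<and>
     (\<forall>(x, u)\<in>M. deriv (\<lambda>w. U (x, w)) u \<noteq> 0) \<and>
     inj_on (point_map \<tau> U) M"

text \<open>
  The transformation maps the equation \<open>u'' = \<omega>(x,u,u')\<close> on \<open>D\<close> to the equation with right-hand side
  \<open>\<Omega>\<close>: a curve in the domain solves the former iff its image solves the latter.
\<close>

definition maps_scalar_equation ::
  "cjet set \<Rightarrow> (cjet \<Rightarrow> complex) \<Rightarrow> (real \<Rightarrow> real) \<Rightarrow> (cpoint \<Rightarrow> complex) \<Rightarrow> (cjet \<Rightarrow> complex) \<Rightarrow> bool" where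
  "maps_scalar_equation D \<omega> \<tau> U \<Omega> \<longleftrightarrow>
     (\<forall>J u. open_interval J \<and> scalar_admissible_on D J u \<longrightarrow>
        (scalar_solution_on D \<omega> J u \<longleftrightarrow>
         (\<exists>V. point_map \<tau> U ` graph J u = graph (\<tau> ` J) V \<and>
              scalar_solution_on UNIV \<Omega> (\<tau> ` J) V)))"

definition linear_form_1 :: "(real \<Rightarrow> real) \<Rightarrow> jet \<Rightarrow> real" where
  "linear_form_1 \<beta> = (\<lambda>(x, Y, Z, Y', Z'). - \<beta> x * Z)"

definition linear_form_2 :: "(real \<Rightarrow> real) \<Rightarrow> jet \<Rightarrow> real" where
  "linear_form_2 \<beta> = (\<lambda>(x, Y, Z, Y', Z'). \<beta> x * Y)"

definition reducible_to_linear_form ::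
  "jet set \<Rightarrow> (jet \<Rightarrow> real) \<Rightarrow> (jet \<Rightarrow> real) \<Rightarrow> (real \<Rightarrow> real) \<Rightarrow> bool" where
  "reducible_to_linear_form D w1 w2 \<beta> \<longleftrightarrow>
     (let Dc = real_jet -` D; \<omega> = scalar_rhs w1 w2 in
        complex_analytic_rhs Dc \<omega> \<and>
        (\<exists>\<tau> U. invertible_complex_point_transformation (cbase Dc) \<tau> U \<and>
           smooth_on (\<tau> ` fst ` cbase Dc) \<beta> \<and>
           maps_scalar_equation Dc \<omega> \<tau> U (scalar_rhs (linear_form_1 \<beta>) (linear_form_2 \<beta>))))"

end

theory Submission
  imports Defs
begin

text \<open>
  A complex point transformation of the given kind is a fibre-preserving diffeomorphism between open
  subsets of \<open>\<real> \<times> \<complex>\<close>, and it exchanges the solutions of the system with the solutions of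
  \<open>U'' = \<i> \<beta> U\<close>. Pulling back vector fields is therefore a linear bijection between the two symmetry
  algebras (\<open>symmetry_fields_pull_back\<close>, \<open>linear_pull_back\<close>, \<open>pull_back_injective\<close>), and it suffices
  to find the symmetry fields \<open>X = \<xi> \<partial>\<^sub>x + \<eta> \<partial>\<^sub>U\<close> of the linear equation on a connected open set \<open>M\<close> of
  points \<open>(x, U)\<close>, together with their dimension (\<open>symmetry_basis\<close>).

  \<^emph>\<open>There are no other symmetries.\<close> Let \<open>V\<close> be a solution. The flow of \<open>X\<close> moves \<open>V\<close> through solutions
  \<open>A(t) f1 + B(t) f2\<close>, where \<open>f1, f2\<close> is a fundamental pair. One differentiation in \<open>t\<close> shows that the
  characteristic \<open>\<eta>(x, V) - \<xi>(x, V) V'\<close> is again a solution (\<open>characteristic_solves\<close>). Written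
  out, this is a polynomial of degree three in the real and imaginary parts of \<open>V'\<close>. These range over an
  open set, so all ten coefficients vanish (\<open>determining_equations\<close>). The terms of degree three and two make
  \<open>\<xi>\<close> affine and \<open>\<eta>\<close> quadratic in \<open>U\<close>; differentiating the terms of degree one once more shows that
  the \<open>U\<close>-derivatives of \<open>\<xi>\<close> vanish wherever \<open>\<beta>\<close> does not (\<open>mixed_third\<close>). This leaves two cases.

    \<^item> If \<open>\<beta>\<close> vanishes identically, all second derivatives are determined by constants, and \<open>X\<close> is one of the
      projective vector fields of \<open>\<real>\<^sup>3\<close>, which depend on 15 real parameters (\<open>flat_symmetry_form\<close>).

    \<^item> Otherwise \<open>\<xi> = q(x)\<close> is a quadratic polynomial with \<open>q \<beta>' + 2 q' \<beta> = 0\<close>, and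
      \<open>\<eta> = (q'/2 + c) U + d(x)\<close> with a complex constant \<open>c\<close> and a solution \<open>d\<close>
      (\<open>curved_symmetry_form\<close>). The pairs \<open>(c, d)\<close> contribute dimension 6. The equation for \<open>q\<close> says that
      \<open>q\<^sup>2 \<beta>\<close> is constant, so \<open>q\<close> is determined by its value at one point where \<open>\<beta>\<close> does not vanish
      (\<open>compatible_line\<close>): the total is 6 or 7.

  The constants of integration are functions on \<open>M\<close> with zero derivative. Connectedness of \<open>M\<close> makes them
  global, also when \<open>\<beta>\<close> vanishes on a part of its domain only, or when the fibres of \<open>M\<close> are disconnected.

  \<^emph>\<open>All of these are symmetries.\<close> Their flows are explicit. In the first case they are projective maps, induced
  by a linear flow on \<open>\<real> \<times> \<complex> \<times> \<real>\<close>, and carry lines to lines (\<open>projective_symmetry\<close>). In the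
  second case they consist of a fractional linear map of \<open>x\<close>, a rescaling of \<open>U\<close> and a translation by a solution that
  moves in a plane (\<open>quadratic_symmetry\<close>).

  The solutions of the linear equation and all these flows come from one existence theorem for linear equations on an
  open interval (\<open>linear_ode_solution\<close>).
\<close>

section \<open>Calculus of continuously differentiable functions\<close>

lemma has_derivative_frechet_on:
  assumes "open S" "f differentiable_on S" "x \<in> S"
  shows "(f has_derivative frechet_derivative f (at x)) (at x)"
  using assms by (metis at_within_open differentiable_on_def frechet_derivative_works)

lemma C_k_on_cong:
  assumes "open S" "\<And>x. x \<in> S \<Longrightarrow> f x = g x" "C_k_on k S f"
  shows "C_k_on k S g"
  using assms(2,3)
proof (induction k arbitrary: f g)
  case 0
  then show ?case by (auto cong: continuous_on_cong)
next
  case (Suc k)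
  have der: "(g has_derivative frechet_derivative f (at x)) (at x)" if "x \<in> S" for x
    using has_derivative_transform_within_open[OF has_derivative_frechet_on[OF assms(1)]] Suc.prems assms(1) that
    by (metis C_k_on.simps(2))
  then have "g differentiable_on S"
    unfolding differentiable_on_def differentiable_def using has_derivative_at_withinI by blast
  moreover have "C_k_on k S (\<lambda>x. frechet_derivative g (at x) v)" for v
    by (rule Suc.IH[of "\<lambda>x. frechet_derivative f (at x) v"])
       (use Suc.prems der frechet_derivative_at in \<open>fastforce+\<close>)
  ultimately show ?case by simp
qed

lemma C_k_on_Suc_iff:
  assumes "open S" "\<And>x. x \<in> S \<Longrightarrow> (f has_derivative f' x) (at x)"
  shows "C_k_on (Suc k) S f \<longleftrightarrow> (\<forall>v. C_k_on k S (\<lambda>x. f' x v))"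
proof -
  have "f differentiable_on S"
    unfolding differentiable_on_def differentiable_def using assms(2) has_derivative_at_withinI by blast
  moreover have "f' x v = frechet_derivative f (at x) v" if "x \<in> S" for x v
    using assms(2)[OF that] frechet_derivative_at by metis
  ultimately show ?thesis
    using C_k_on_cong[OF assms(1), of "\<lambda>x. f' x _" "\<lambda>x. frechet_derivative f (at x) _"]
      C_k_on_cong[OF assms(1), of "\<lambda>x. frechet_derivative f (at x) _" "\<lambda>x. f' x _"]
    by (metis C_k_on.simps(2))
qed

lemma C_k_on_subset:
  assumes "C_k_on k S f" "open S" "open T" "T \<subseteq> S"
  shows "C_k_on k T f"
  using assms(1)
proof (induction k arbitrary: f)
  case 0
  then show ?case using assms continuous_on_subset by auto
next
  case (Suc k)
  then show ?case using assms differentiable_on_subset by auto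
qed

lemma C_k_on_SucD:
  assumes "C_k_on (Suc k) S f"
  shows "C_k_on k S f"
  using assms
proof (induction k arbitrary: f)
  case 0
  then show ?case by (auto simp: differentiable_imp_continuous_on)
qed auto

lemma C_k_on_continuous: "C_k_on k S f \<Longrightarrow> continuous_on S f"
  by (induction k) (auto dest: differentiable_imp_continuous_on)

lemma C_k_on_const: "open S \<Longrightarrow> C_k_on k S (\<lambda>x. c)"
  by (induction k arbitrary: c) (auto simp: C_k_on_Suc_iff[where f' = "\<lambda>_ _. 0"] simp del: C_k_on.simps(2))

lemma C_k_on_linear:
  assumes "bounded_linear L" "open S"
  shows "C_k_on k S L"
proof (cases k)
  case 0
  then show ?thesis using assms by (auto intro: linear_continuous_on)
next
  case (Suc n)
  then show ?thesis
    using C_k_on_Suc_iff[OF assms(2) bounded_linear.has_derivative[OF assms(1) has_derivative_ident]]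
    by (auto intro: C_k_on_const assms(2))
qed

lemma C_k_on_linear_compose:
  assumes L: "bounded_linear L" and "open S" "C_k_on k S f"
  shows "C_k_on k S (\<lambda>x. L (f x))"
  using assms(3)
proof (induction k arbitrary: f)
  case 0
  then show ?case by (auto intro: bounded_linear.continuous_on[OF L])
next
  case (Suc k)
  show ?case
    apply (subst C_k_on_Suc_iff[OF \<open>open S\<close> bounded_linear.has_derivative[OF L has_derivative_frechet_on[OF \<open>open S\<close>]]])
    using Suc by auto
qed

lemma C_k_on_add:
  assumes "open S" "C_k_on k S f" "C_k_on k S g"
  shows "C_k_on k S (\<lambda>x. f x + g x)"
  using assms(2,3)
proof (induction k arbitrary: f g)
  case 0
  then show ?case by (auto intro: continuous_intros)
next
  case (Suc k)
  show ?case
    apply (subst C_k_on_Suc_iff[OF \<open>open S\<close> has_derivative_add[OF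
       has_derivative_frechet_on[OF \<open>open S\<close>] has_derivative_frechet_on[OF \<open>open S\<close>]]])
    using Suc by auto
qed

lemma C_k_on_sum:
  assumes "open S" "\<And>i. i \<in> I \<Longrightarrow> C_k_on k S (f i)"
  shows "C_k_on k S (\<lambda>x. \<Sum>i\<in>I. f i x)"
  using assms(2)
proof (induction I rule: infinite_finite_induct)
  case (insert i I)
  then show ?case by (auto intro!: C_k_on_add assms(1))
qed (auto intro: C_k_on_const assms(1))

lemma C_k_on_bilinear:
  assumes B: "bounded_bilinear B" and "open S" "C_k_on k S f" "C_k_on k S g"
  shows "C_k_on k S (\<lambda>x. B (f x) (g x))"
  using assms(3,4)
proof (induction k arbitrary: f g)
  case 0
  then show ?case by (auto intro: bounded_bilinear.continuous_on[OF B])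
next
  case (Suc k)
  show ?case
    apply (subst C_k_on_Suc_iff[OF \<open>open S\<close> bounded_bilinear.FDERIV[OF B
       has_derivative_frechet_on[OF \<open>open S\<close>] has_derivative_frechet_on[OF \<open>open S\<close>]]])
    using Suc C_k_on_SucD[OF Suc.prems(1)] C_k_on_SucD[OF Suc.prems(2)] by (auto intro!: C_k_on_add \<open>open S\<close>)
qed

text \<open>
  The derivative of \<open>g\<close> at the moving point \<open>f x\<close> is applied to a moving vector. Expanding that
  vector in a basis of the intermediate space reduces this to the directional derivatives that
  the definition controls.
\<close>

lemma C_k_on_compose:
  fixes f :: "'a::real_normed_vector \<Rightarrow> 'b::euclidean_space"
  assumes "open S" "open T" "f ` S \<subseteq> T" "C_k_on k S f" "C_k_on k T g"
  shows "C_k_on k S (\<lambda>x. g (f x))"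
  using assms(4,5)
proof (induction k arbitrary: g)
  case 0
  then show ?case using assms(3) by (auto intro: continuous_on_compose2)
next
  case (Suc k)
  have f: "(f has_derivative frechet_derivative f (at x)) (at x)" if "x \<in> S" for x
    by (rule has_derivative_frechet_on[OF assms(1) _ that]) (use Suc.prems in auto)
  have g: "(g has_derivative frechet_derivative g (at y)) (at y)" if "y \<in> T" for y
    by (rule has_derivative_frechet_on[OF assms(2) _ that]) (use Suc.prems in auto)
  have eq: "frechet_derivative g (at (f x)) (frechet_derivative f (at x) v) =
     (\<Sum>b\<in>Basis. (frechet_derivative f (at x) v \<bullet> b) *\<^sub>R frechet_derivative g (at (f x)) b)"
    if "x \<in> S" for x v
  proof -
    have lin: "linear (frechet_derivative g (at (f x)))"
      using g[of "f x"] that assms(3) has_derivative_linear by blast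
    have "frechet_derivative g (at (f x)) (frechet_derivative f (at x) v) =
      frechet_derivative g (at (f x)) (\<Sum>b\<in>Basis. (frechet_derivative f (at x) v \<bullet> b) *\<^sub>R b)"
      by (simp add: euclidean_representation)
    also have "\<dots> = (\<Sum>b\<in>Basis. (frechet_derivative f (at x) v \<bullet> b) *\<^sub>R frechet_derivative g (at (f x)) b)"
      by (simp add: linear_sum[OF lin] linear_cmul[OF lin])
    finally show ?thesis .
  qed
  have der: "((\<lambda>x. g (f x)) has_derivative
      (\<lambda>v. frechet_derivative g (at (f x)) (frechet_derivative f (at x) v))) (at x)" if "x \<in> S" for x
    by (rule has_derivative_compose[OF f[OF that] g]) (use that assms(3) in auto)
  have 1: "C_k_on k S (\<lambda>x. \<Sum>b\<in>Basis. (frechet_derivative f (at x) v \<bullet> b) *\<^sub>R frechet_derivative g (at (f x)) b)"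
    for v
  proof (intro C_k_on_sum C_k_on_bilinear[OF bounded_bilinear_scaleR] assms(1))
    fix b :: 'b
    show "C_k_on k S (\<lambda>x. frechet_derivative f (at x) v \<bullet> b)"
      by (rule C_k_on_linear_compose[OF bounded_linear_inner_left assms(1)]) (use Suc.prems in simp)
    show "C_k_on k S (\<lambda>x. frechet_derivative g (at (f x)) b)"
      by (rule Suc.IH[OF C_k_on_SucD[OF Suc.prems(1)]]) (use Suc.prems in simp)
  qed
  show ?case
  proof (subst C_k_on_Suc_iff[OF assms(1) der], assumption, intro allI)
    fix v
    show "C_k_on k S (\<lambda>x. frechet_derivative g (at (f x)) (frechet_derivative f (at x) v))"
      by (rule C_k_on_cong[OF assms(1) eq[symmetric] 1])
  qed
qed

lemma C_k_on_inverse: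
  fixes f :: "'a::real_normed_vector \<Rightarrow> 'b::real_normed_field"
  assumes "open S" "C_k_on k S f" "\<And>x. x \<in> S \<Longrightarrow> f x \<noteq> 0"
  shows "C_k_on k S (\<lambda>x. inverse (f x))"
  using assms(2)
proof (induction k)
  case 0
  then show ?case using assms(3) by (auto intro!: continuous_intros)
next
  case (Suc k)
  have der: "((\<lambda>x. inverse (f x)) has_derivative
      (\<lambda>h. - (inverse (f x) * frechet_derivative f (at x) h * inverse (f x)))) (at x)" if "x \<in> S" for x
    by (rule Deriv.has_derivative_inverse[of f, OF assms(3)[OF that]])
       (use Suc.prems in \<open>auto intro!: has_derivative_frechet_on[OF assms(1) _ that]\<close>)
  have "C_k_on k S (\<lambda>x. - (inverse (f x) * frechet_derivative f (at x) v * inverse (f x)))" for v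
    by (intro C_k_on_linear_compose[where L = uminus] C_k_on_bilinear[OF bounded_bilinear_mult] bounded_linear_minus
       bounded_linear_ident assms(1) Suc.IH C_k_on_SucD[OF Suc.prems]) (use Suc.prems in simp)
  then show ?case
    by (subst C_k_on_Suc_iff[OF assms(1) der]) auto
qed

lemma smooth_on_cong: "open S \<Longrightarrow> (\<And>x. x \<in> S \<Longrightarrow> f x = g x) \<Longrightarrow> smooth_on S f \<Longrightarrow> smooth_on S g"
  unfolding smooth_on_def using C_k_on_cong by blast

lemma smooth_on_subset: "smooth_on S f \<Longrightarrow> open S \<Longrightarrow> open T \<Longrightarrow> T \<subseteq> S \<Longrightarrow> smooth_on T f"
  unfolding smooth_on_def using C_k_on_subset by blast

lemma smooth_on_const: "open S \<Longrightarrow> smooth_on S (\<lambda>x. c)"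
  unfolding smooth_on_def using C_k_on_const by blast

lemma smooth_on_linear: "bounded_linear L \<Longrightarrow> open S \<Longrightarrow> smooth_on S L"
  unfolding smooth_on_def using C_k_on_linear by blast

lemma smooth_on_linear_compose:
  "bounded_linear L \<Longrightarrow> open S \<Longrightarrow> smooth_on S f \<Longrightarrow> smooth_on S (\<lambda>x. L (f x))"
  unfolding smooth_on_def using C_k_on_linear_compose by blast

lemma smooth_on_add: "open S \<Longrightarrow> smooth_on S f \<Longrightarrow> smooth_on S g \<Longrightarrow> smooth_on S (\<lambda>x. f x + g x)"
  unfolding smooth_on_def using C_k_on_add by blast

lemma smooth_on_bilinear:
  "bounded_bilinear B \<Longrightarrow> open S \<Longrightarrow> smooth_on S f \<Longrightarrow> smooth_on S g \<Longrightarrow> smooth_on S (\<lambda>x. B (f x) (g x))"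
  unfolding smooth_on_def using C_k_on_bilinear by blast

lemmas smooth_on_mult = smooth_on_bilinear[OF bounded_bilinear_mult]
lemmas smooth_on_scaleR = smooth_on_bilinear[OF bounded_bilinear_scaleR]

lemma smooth_on_diff:
  assumes "open S" "smooth_on S f" "smooth_on S g"
  shows "smooth_on S (\<lambda>x. f x - g x)"
  using smooth_on_add[OF assms(1,2) smooth_on_linear_compose[OF bounded_linear_minus[OF bounded_linear_ident] assms(1,3)]]
  by simp

lemma smooth_on_Pair:
  assumes "open S" "smooth_on S f" "smooth_on S g"
  shows "smooth_on S (\<lambda>x. (f x, g x))"
proof -
  have "smooth_on S (\<lambda>x. (f x, 0) + (0, g x))"
    using assms
    by (intro smooth_on_add smooth_on_linear_compose[where L = "\<lambda>a. (a, 0)"]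
       smooth_on_linear_compose[where L = "\<lambda>a. (0, a)"] bounded_linear_intros)
  then show ?thesis by simp
qed

lemma smooth_on_compose:
  fixes f :: "'a::real_normed_vector \<Rightarrow> 'b::euclidean_space"
  shows "open S \<Longrightarrow> open T \<Longrightarrow> f ` S \<subseteq> T \<Longrightarrow> smooth_on S f \<Longrightarrow> smooth_on T g \<Longrightarrow> smooth_on S (\<lambda>x. g (f x))"
  unfolding smooth_on_def using C_k_on_compose by blast

lemma smooth_on_inverse:
  fixes f :: "'a::real_normed_vector \<Rightarrow> 'b::real_normed_field"
  shows "open S \<Longrightarrow> smooth_on S f \<Longrightarrow> (\<And>x. x \<in> S \<Longrightarrow> f x \<noteq> 0) \<Longrightarrow> smooth_on S (\<lambda>x. inverse (f x))"
  unfolding smooth_on_def using C_k_on_inverse by blast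

lemma smooth_on_divide:
  fixes f g :: "'a::real_normed_vector \<Rightarrow> 'b::real_normed_field"
  assumes "open S" "smooth_on S f" "smooth_on S g" "\<And>x. x \<in> S \<Longrightarrow> g x \<noteq> 0"
  shows "smooth_on S (\<lambda>x. f x / g x)"
  unfolding divide_inverse using assms by (intro smooth_on_mult smooth_on_inverse)

lemma smooth_on_fst: "open S \<Longrightarrow> smooth_on S f \<Longrightarrow> smooth_on S (\<lambda>x. fst (f x))"
  by (rule smooth_on_linear_compose[OF bounded_linear_fst])
lemma smooth_on_snd: "open S \<Longrightarrow> smooth_on S f \<Longrightarrow> smooth_on S (\<lambda>x. snd (f x))"
  by (rule smooth_on_linear_compose[OF bounded_linear_snd])
lemma smooth_on_ident: "open S \<Longrightarrow> smooth_on S (\<lambda>x. x)"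
  by (rule smooth_on_linear[OF bounded_linear_ident])
lemma smooth_on_of_real:
  "open S \<Longrightarrow> smooth_on S f \<Longrightarrow> smooth_on S (\<lambda>x. of_real (f x) :: 'b::{real_normed_algebra_1})"
  by (rule smooth_on_linear_compose[OF bounded_linear_of_real])

lemmas smooth_intros = smooth_on_const smooth_on_ident smooth_on_add smooth_on_diff smooth_on_mult smooth_on_scaleR
  smooth_on_Pair smooth_on_divide smooth_on_inverse smooth_on_fst smooth_on_snd smooth_on_of_real

lemma smooth_on_has_derivative:
  assumes "open S" "smooth_on S f" "x \<in> S"
  shows "(f has_derivative frechet_derivative f (at x)) (at x)"
  using assms has_derivative_frechet_on unfolding smooth_on_def by (metis C_k_on.simps(2))

lemma smooth_on_frechet_derivative: "smooth_on S f \<Longrightarrow> smooth_on S (\<lambda>x. frechet_derivative f (at x) v)"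
  unfolding smooth_on_def by (metis C_k_on.simps(2))

lemma smooth_on_continuous: "smooth_on S f \<Longrightarrow> continuous_on S f"
  unfolding smooth_on_def using C_k_on_continuous by blast

text \<open>
  A function whose derivative is a smooth expression in the function itself is smooth: each order of
  differentiability of \<open>f\<close> gives one more.
\<close>

lemma smooth_on_bootstrap:
  assumes "open S" "continuous_on S f"
    and "\<And>x. x \<in> S \<Longrightarrow> (f has_derivative f' x) (at x)"
    and "\<And>k v. C_k_on k S f \<Longrightarrow> C_k_on k S (\<lambda>x. f' x v)"
  shows "smooth_on S f"
proof -
  have "C_k_on k S f" for k
  proof (induction k)
    case (Suc k)
    then show ?case using C_k_on_Suc_iff[OF assms(1,3)] assms(4) by blast
  qed (use assms(2) in auto)
  then show ?thesis by (simp add: smooth_on_def)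
qed

section \<open>Symmetry of second derivatives\<close>

text \<open>
  The second difference of \<open>f\<close> over a parallelogram does not depend on the order of its sides. Two
  applications of the mean value theorem express it by either mixed derivative at an interior point, and these
  points converge to \<open>p\<close> as the parallelogram shrinks.
\<close>

lemma second_difference_mvt:
  fixes f :: "'a::real_normed_vector \<Rightarrow> real"
  assumes "open S" "smooth_on S f" "0 < h"
    and box: "\<And>s t. 0 \<le> s \<Longrightarrow> s \<le> h \<Longrightarrow> 0 \<le> t \<Longrightarrow> t \<le> h \<Longrightarrow> p + s *\<^sub>R v + t *\<^sub>R w \<in> S"
  shows "\<exists>s t. 0 < s \<and> s < h \<and> 0 < t \<and> t < h \<and>
    f (p + h *\<^sub>R v + h *\<^sub>R w) - f (p + h *\<^sub>R v) - f (p + h *\<^sub>R w) + f p =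
      h * h * frechet_derivative (\<lambda>q. frechet_derivative f (at q) v) (at (p + s *\<^sub>R v + t *\<^sub>R w)) w"
proof -
  define F where "F = (\<lambda>q. frechet_derivative f (at q) v)"
  have smF: "smooth_on S F" unfolding F_def by (rule smooth_on_frechet_derivative[OF assms(2)])
  define G where "G = (\<lambda>s. f (p + s *\<^sub>R v + h *\<^sub>R w) - f (p + s *\<^sub>R v + 0 *\<^sub>R w))"
  have d1: "((\<lambda>s. f (p + s *\<^sub>R v + c *\<^sub>R w)) has_real_derivative F (p + s *\<^sub>R v + c *\<^sub>R w)) (at s)"
    if "0 \<le> s" "s \<le> h" "0 \<le> c" "c \<le> h" for s c
  proof -
    have lin: "((\<lambda>s. p + s *\<^sub>R v + c *\<^sub>R w) has_derivative (\<lambda>d. d *\<^sub>R v)) (at s)"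
      by (auto intro!: derivative_eq_intros)
    have D: "(f has_derivative frechet_derivative f (at (p + s *\<^sub>R v + c *\<^sub>R w))) (at (p + s *\<^sub>R v + c *\<^sub>R w))"
      using smooth_on_has_derivative[OF assms(1,2)] box that by blast
    from has_derivative_compose[OF lin D] show ?thesis
      unfolding has_field_derivative_def F_def
      using linear_cmul[OF has_derivative_linear[OF D]] by (simp add: mult_commute_abs)
  qed
  have d2: "((\<lambda>t. F (p + s *\<^sub>R v + t *\<^sub>R w)) has_real_derivative
      frechet_derivative F (at (p + s *\<^sub>R v + t *\<^sub>R w)) w) (at t)"
    if "0 \<le> s" "s \<le> h" "0 \<le> t" "t \<le> h" for s t
  proof -
    have lin: "((\<lambda>t. p + s *\<^sub>R v + t *\<^sub>R w) has_derivative (\<lambda>d. d *\<^sub>R w)) (at t)"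
      by (auto intro!: derivative_eq_intros)
    have D: "(F has_derivative frechet_derivative F (at (p + s *\<^sub>R v + t *\<^sub>R w))) (at (p + s *\<^sub>R v + t *\<^sub>R w))"
      using smooth_on_has_derivative[OF assms(1) smF] box that by blast
    from has_derivative_compose[OF lin D] show ?thesis
      unfolding has_field_derivative_def
      using linear_cmul[OF has_derivative_linear[OF D]] by (simp add: mult_commute_abs)
  qed
  have "\<exists>s>0. s < h \<and> G h - G 0 = (h - 0) * (F (p + s *\<^sub>R v + h *\<^sub>R w) - F (p + s *\<^sub>R v + 0 *\<^sub>R w))"
    by (rule MVT2) (use assms(3) in \<open>auto simp: G_def simp del: scaleR_zero_left intro!: DERIV_diff d1\<close>)
  then obtain s where s: "0 < s" "s < h" "G h - G 0 = h * (F (p + s *\<^sub>R v + h *\<^sub>R w) - F (p + s *\<^sub>R v + 0 *\<^sub>R w))"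
    by auto
  have "\<exists>t>0. t < h \<and> F (p + s *\<^sub>R v + h *\<^sub>R w) - F (p + s *\<^sub>R v + 0 *\<^sub>R w) =
      (h - 0) * frechet_derivative F (at (p + s *\<^sub>R v + t *\<^sub>R w)) w"
    by (rule MVT2) (use assms(3) s in \<open>auto intro!: d2\<close>)
  then obtain t where t: "0 < t" "t < h" "F (p + s *\<^sub>R v + h *\<^sub>R w) - F (p + s *\<^sub>R v + 0 *\<^sub>R w) =
      h * frechet_derivative F (at (p + s *\<^sub>R v + t *\<^sub>R w)) w"
    by auto
  have "f (p + h *\<^sub>R v + h *\<^sub>R w) - f (p + h *\<^sub>R v) - f (p + h *\<^sub>R w) + f p = G h - G 0"
    by (simp add: G_def)
  then show ?thesis using s t unfolding F_def[symmetric] by (metis mult.assoc)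
qed

lemma symmetric_second_derivative_real:
  fixes f :: "'a::real_normed_vector \<Rightarrow> real"
  assumes "open S" "smooth_on S f" "p \<in> S"
  shows "frechet_derivative (\<lambda>q. frechet_derivative f (at q) v) (at p) w =
         frechet_derivative (\<lambda>q. frechet_derivative f (at q) w) (at p) v" (is "?A p = ?B p")
proof (rule ccontr)
  assume neq: "?A p \<noteq> ?B p"
  define e where "e = \<bar>?A p - ?B p\<bar> / 2"
  have "e > 0" using neq by (simp add: e_def)
  have cA: "continuous_on S ?A" and cB: "continuous_on S ?B"
    by (intro smooth_on_continuous smooth_on_frechet_derivative assms(2))+
  obtain r where r: "r > 0" "ball p r \<subseteq> S" using assms by (meson openE)
  obtain r1 where r1: "r1 > 0" "\<And>q. q \<in> S \<Longrightarrow> dist q p < r1 \<Longrightarrow> \<bar>?A q - ?A p\<bar> < e"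
    using cA \<open>e > 0\<close> assms(3) unfolding continuous_on_iff dist_real_def by meson
  obtain r2 where r2: "r2 > 0" "\<And>q. q \<in> S \<Longrightarrow> dist q p < r2 \<Longrightarrow> \<bar>?B q - ?B p\<bar> < e"
    using cB \<open>e > 0\<close> assms(3) unfolding continuous_on_iff dist_real_def by meson
  define R where "R = min r (min r1 r2)"
  define h where "h = R / (2 * (norm v + norm w + 1))"
  have "R > 0" using r r1 r2 by (simp add: R_def)
  have den: "norm v + norm w + 1 > 0" by (simp add: add_nonneg_pos)
  have h: "h > 0" using \<open>R > 0\<close> den by (simp add: h_def)
  have close: "dist (p + s *\<^sub>R v + t *\<^sub>R w) p < R" if "0 \<le> s" "s \<le> h" "0 \<le> t" "t \<le> h" for s t
  proof -
    have "dist (p + s *\<^sub>R v + t *\<^sub>R w) p \<le> norm (s *\<^sub>R v) + norm (t *\<^sub>R w)"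
      unfolding dist_norm using norm_triangle_ineq[of "s *\<^sub>R v" "t *\<^sub>R w"] by (simp add: algebra_simps)
    also have "\<dots> \<le> h * norm v + h * norm w"
      using that by (auto intro!: add_mono mult_right_mono)
    also have "\<dots> \<le> h * (norm v + norm w + 1)" using h by (simp add: algebra_simps)
    also have "\<dots> = R / 2" using den unfolding h_def by (simp add: divide_simps)
    finally show ?thesis using \<open>R > 0\<close> by simp
  qed
  have inS: "p + s *\<^sub>R v + t *\<^sub>R w \<in> S" if "0 \<le> s" "s \<le> h" "0 \<le> t" "t \<le> h" for s t
  proof -
    have "dist (p + s *\<^sub>R v + t *\<^sub>R w) p < r" using close[OF that] by (simp add: R_def)
    then show ?thesis using r(2) by (metis dist_commute mem_ball subsetD)
  qed
  obtain s t where st: "0 < s" "s < h" "0 < t" "t < h"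
    "f (p + h *\<^sub>R v + h *\<^sub>R w) - f (p + h *\<^sub>R v) - f (p + h *\<^sub>R w) + f p = h * h * ?A (p + s *\<^sub>R v + t *\<^sub>R w)"
    using second_difference_mvt[OF assms(1,2) h inS] by auto
  have inS': "p + s *\<^sub>R w + t *\<^sub>R v \<in> S" if "0 \<le> s" "s \<le> h" "0 \<le> t" "t \<le> h" for s t
    using inS[OF that(3,4,1,2)] by (simp add: add_ac)
  obtain s' t' where st': "0 < s'" "s' < h" "0 < t'" "t' < h"
    "f (p + h *\<^sub>R w + h *\<^sub>R v) - f (p + h *\<^sub>R w) - f (p + h *\<^sub>R v) + f p = h * h * ?B (p + s' *\<^sub>R w + t' *\<^sub>R v)"
    using second_difference_mvt[OF assms(1,2) h inS'] by auto
  have "h * h * ?A (p + s *\<^sub>R v + t *\<^sub>R w) = h * h * ?B (p + t' *\<^sub>R v + s' *\<^sub>R w)"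
  proof -
    have "p + h *\<^sub>R w + h *\<^sub>R v = p + h *\<^sub>R v + h *\<^sub>R w" "p + s' *\<^sub>R w + t' *\<^sub>R v = p + t' *\<^sub>R v + s' *\<^sub>R w"
      by (simp_all add: add_ac)
    then show ?thesis using st(5) st'(5) by (simp only:)
  qed
  then have eq: "?A (p + s *\<^sub>R v + t *\<^sub>R w) = ?B (p + t' *\<^sub>R v + s' *\<^sub>R w)"
    using h by simp
  have "dist (p + s *\<^sub>R v + t *\<^sub>R w) p < r1" "dist (p + t' *\<^sub>R v + s' *\<^sub>R w) p < r2"
    using close[of s t] close[of t' s'] st st' by (auto simp: R_def)
  then have "\<bar>?A (p + s *\<^sub>R v + t *\<^sub>R w) - ?A p\<bar> < e" "\<bar>?B (p + t' *\<^sub>R v + s' *\<^sub>R w) - ?B p\<bar> < e"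
    using r1(2) r2(2) inS st st' by auto
  then have "\<bar>?A p - ?B p\<bar> < 2 * e" using eq by linarith
  then show False by (simp add: e_def)
qed

lemma frechet_derivative_linear_compose:
  assumes "bounded_linear L" "(f has_derivative f') (at x)"
  shows "frechet_derivative (\<lambda>x. L (f x)) (at x) = (\<lambda>h. L (f' h))"
  using frechet_derivative_at[OF bounded_linear.has_derivative[OF assms]] by simp

lemma symmetric_second_derivative:
  fixes f :: "'a::real_normed_vector \<Rightarrow> 'b::euclidean_space"
  assumes "open S" "smooth_on S f" "p \<in> S"
  shows "frechet_derivative (\<lambda>q. frechet_derivative f (at q) v) (at p) w =
         frechet_derivative (\<lambda>q. frechet_derivative f (at q) w) (at p) v"
proof (rule euclidean_eqI)
  fix b :: 'b
  let ?L = "\<lambda>x::'b. x \<bullet> b"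
  have L: "bounded_linear ?L" by (rule bounded_linear_inner_left)
  have 1: "frechet_derivative (\<lambda>q. f q \<bullet> b) (at q) v = frechet_derivative f (at q) v \<bullet> b" if "q \<in> S" for q v
    using frechet_derivative_linear_compose[OF L smooth_on_has_derivative[OF assms(1,2) that]] by simp
  have 2: "frechet_derivative (\<lambda>q. frechet_derivative (\<lambda>q. f q \<bullet> b) (at q) v) (at p) w =
     frechet_derivative (\<lambda>q. frechet_derivative f (at q) v) (at p) w \<bullet> b" for v w
  proof -
    have D: "((\<lambda>q. frechet_derivative f (at q) v \<bullet> b) has_derivative
      (\<lambda>w. frechet_derivative (\<lambda>q. frechet_derivative f (at q) v) (at p) w \<bullet> b)) (at p)"
      by (rule bounded_linear.has_derivative[OF L smooth_on_has_derivative[OF assms(1) _ assms(3)]])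
         (rule smooth_on_frechet_derivative[OF assms(2)])
    have "((\<lambda>q. frechet_derivative (\<lambda>q. f q \<bullet> b) (at q) v) has_derivative
      (\<lambda>w. frechet_derivative (\<lambda>q. frechet_derivative f (at q) v) (at p) w \<bullet> b)) (at p)"
      by (rule has_derivative_transform_within_open[OF D assms(1,3)]) (use 1 in auto)
    then show ?thesis using frechet_derivative_at by metis
  qed
  show "frechet_derivative (\<lambda>q. frechet_derivative f (at q) v) (at p) w \<bullet> b =
      frechet_derivative (\<lambda>q. frechet_derivative f (at q) w) (at p) v \<bullet> b"
    using symmetric_second_derivative_real[OF assms(1) smooth_on_linear_compose[OF L assms(1,2)] assms(3), of v w]
    unfolding 2 .
qed

section \<open>Linear ordinary differential equations\<close>

text \<open>
  Two points of an open interval lie in the interior of one compact subinterval, on which continuous functions are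
  integrable and bounded.
\<close>

lemma open_interval_pad:
  assumes "open_interval J" "x \<in> J" "y \<in> J"
  obtains a b where "a < x" "a < y" "x < b" "y < b" "{a..b} \<subseteq> J"
proof -
  have op: "open J" and iv: "is_interval J" using assms by (auto simp: open_interval_def)
  have "min x y \<in> J" "max x y \<in> J" using assms by (auto simp: min_def max_def)
  then obtain d e where d: "d > 0" "ball (min x y) d \<subseteq> J" and e: "e > 0" "ball (max x y) e \<subseteq> J"
    using op by (meson openE)
  define a b where "a = min x y - d / 2" and "b = max x y + e / 2"
  have "a \<in> J" "b \<in> J" using d e by (auto simp: a_def b_def dist_real_def)
  then have "{a..b} \<subseteq> J"
    using iv mem_is_interval_1_I[of J a b] by auto
  moreover have "a < x" "a < y" "x < b" "y < b" using d(1) e(1) by (auto simp: a_def b_def)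
  ultimately show ?thesis using that by blast
qed

lemma antiderivative_on_open_interval:
  fixes g :: "real \<Rightarrow> 'a::banach"
  assumes J: "open_interval J" and x0: "x0 \<in> J" and g: "continuous_on J g"
  shows "\<exists>G. G x0 = 0 \<and> (\<forall>x\<in>J. (G has_vector_derivative g x) (at x))"
proof -
  define G where "G = (\<lambda>x. if x0 \<le> x then integral {x0..x} g else - integral {x..x0} g)"
  have "(G has_vector_derivative g x) (at x)" if x: "x \<in> J" for x
  proof -
    obtain a b where ab: "a < x" "a < x0" "x < b" "x0 < b" "{a..b} \<subseteq> J"
      using open_interval_pad[OF J x x0] .
    have cont: "continuous_on {a..b} g" using g ab(5) continuous_on_subset by blast
    have int: "g integrable_on {c..d}" if "a \<le> c" "d \<le> b" for c d
      by (rule integrable_continuous_real, rule continuous_on_subset[OF cont]) (use that in auto)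
    have eq: "integral {a..u} g - integral {a..x0} g = G u" if "u \<in> {a<..<b}" for u
    proof (cases "x0 \<le> u")
      case True
      have "integral {a..x0} g + integral {x0..u} g = integral {a..u} g"
        by (rule Henstock_Kurzweil_Integration.integral_combine) (use that ab True int in auto)
      then show ?thesis using True by (simp add: G_def algebra_simps)
    next
      case False
      have "integral {a..u} g + integral {u..x0} g = integral {a..x0} g"
        by (rule Henstock_Kurzweil_Integration.integral_combine) (use that ab False int in auto)
      then show ?thesis using False by (simp add: G_def algebra_simps)
    qed
    have "((\<lambda>u. integral {a..u} g) has_vector_derivative g x) (at x)"
      using integral_has_vector_derivative[OF cont, of x] ab at_within_interior[of x "{a..b}"] by simp
    then have "((\<lambda>u. integral {a..u} g - integral {a..x0} g) has_vector_derivative g x) (at x)"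
      by (auto intro!: derivative_eq_intros)
    then show ?thesis
      by (rule has_vector_derivative_transform_within_open[of _ _ _ "{a<..<b}"]) (use ab eq in auto)
  qed
  moreover have "G x0 = 0" by (simp add: G_def)
  ultimately show ?thesis by blast
qed

text \<open>
  Parametrising the segment from \<open>x0\<close> to \<open>x\<close> by the unit interval treats the two sides of \<open>x0\<close>
  alike. This is the induction step for the factorial bounds on iterated integrals.
\<close>

lemma power_growth_of_antiderivative:
  fixes F :: "real \<Rightarrow> 'a::real_normed_vector"
  assumes F: "\<And>u. u \<in> closed_segment x0 x \<Longrightarrow> (F has_vector_derivative f u) (at u)" and "F x0 = 0"
    and f: "\<And>u. u \<in> closed_segment x0 x \<Longrightarrow> norm (f u) \<le> c * \<bar>u - x0\<bar> ^ n / fact n"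
  shows "norm (F x) \<le> c * \<bar>x - x0\<bar> ^ Suc n / fact (Suc n)"
proof -
  define \<phi> where "\<phi> = (\<lambda>s::real. c * \<bar>x - x0\<bar> ^ Suc n * s ^ Suc n / fact (Suc n))"
  have seg: "x0 + s * (x - x0) \<in> closed_segment x0 x" if "0 \<le> s" "s \<le> 1" for s
    using that unfolding closed_segment_def by (auto simp: algebra_simps intro!: exI[of _ s])
  have D: "((\<lambda>s. F (x0 + s * (x - x0))) has_vector_derivative (x - x0) *\<^sub>R f (x0 + s * (x - x0))) (at s)"
    if "0 \<le> s" "s \<le> 1" for s
  proof -
    have "((\<lambda>s. x0 + s * (x - x0)) has_vector_derivative (x - x0)) (at s)"
      by (auto intro!: derivative_eq_intros)
    from vector_diff_chain_at[OF this F[OF seg[OF that]]] show ?thesis by (simp add: o_def)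
  qed
  have "norm (F (x0 + 1 * (x - x0)) - F (x0 + 0 * (x - x0))) \<le> \<phi> 1 - \<phi> 0"
  proof (rule differentiable_bound_general[where f' = "\<lambda>s. (x - x0) *\<^sub>R f (x0 + s * (x - x0))"
      and \<phi>' = "\<lambda>s. c * \<bar>x - x0\<bar> ^ Suc n * s ^ n / fact n"])
    show "continuous_on {0..1} (\<lambda>s. F (x0 + s * (x - x0)))"
      by (rule continuous_at_imp_continuous_on) (use D has_vector_derivative_continuous in fastforce)
    show "continuous_on {0..1} \<phi>" unfolding \<phi>_def by (intro continuous_intros) auto
    fix s :: real assume s: "0 < s" "s < 1"
    show "((\<lambda>s. F (x0 + s * (x - x0))) has_vector_derivative (x - x0) *\<^sub>R f (x0 + s * (x - x0))) (at s)"
      using D s by auto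
    show "(\<phi> has_vector_derivative c * \<bar>x - x0\<bar> ^ Suc n * s ^ n / fact n) (at s)"
    proof -
      have "((\<lambda>s. (c * \<bar>x - x0\<bar> ^ Suc n / fact (Suc n)) * s ^ Suc n) has_real_derivative
          (c * \<bar>x - x0\<bar> ^ Suc n / fact (Suc n)) * (of_nat (Suc n) * s ^ n)) (at s)"
        by (auto intro!: derivative_eq_intros simp del: power_Suc of_nat_Suc fact_Suc)
      moreover have "(c * \<bar>x - x0\<bar> ^ Suc n / fact (Suc n)) * (of_nat (Suc n) * s ^ n) = c * \<bar>x - x0\<bar> ^ Suc n * s ^ n / fact n"
        by (simp add: field_simps del: of_nat_Suc)
      ultimately show ?thesis
        unfolding \<phi>_def has_real_derivative_iff_has_vector_derivative by (simp add: mult.commute mult.left_commute)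
    qed
    have "norm (f (x0 + s * (x - x0))) \<le> c * \<bar>s * (x - x0)\<bar> ^ n / fact n"
      using f[OF seg[of s]] s by simp
    then have "\<bar>x - x0\<bar> * norm (f (x0 + s * (x - x0))) \<le> \<bar>x - x0\<bar> * (c * \<bar>s * (x - x0)\<bar> ^ n / fact n)"
      by (rule mult_left_mono) simp
    also have "\<dots> = c * \<bar>x - x0\<bar> ^ Suc n * s ^ n / fact n"
      using s by (simp add: abs_mult power_mult_distrib)
    finally show "norm ((x - x0) *\<^sub>R f (x0 + s * (x - x0))) \<le> c * \<bar>x - x0\<bar> ^ Suc n * s ^ n / fact n"
      by simp
  qed simp
  then show ?thesis using \<open>F x0 = 0\<close> by (simp add: \<phi>_def del: power_Suc fact_Suc)
qed

text \<open>
  Picard iteration as a series: the terms are the iterated integrals of \<open>A\<close> applied to \<open>y0\<close>. On a compact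
  subinterval they are dominated by an exponential series, so the series may be differentiated term by term. This gives
  the solution on the whole interval at once, without continuation from local solutions.
\<close>

theorem linear_ode_solution:
  fixes A :: "real \<Rightarrow> 'a::banach \<Rightarrow>\<^sub>L 'a"
  assumes J: "open_interval J" and x0: "x0 \<in> J" and A: "continuous_on J A"
  shows "\<exists>Y. Y x0 = y0 \<and> (\<forall>x\<in>J. (Y has_vector_derivative A x (Y x)) (at x))"
proof -
  define next_term where "next_term Z = (SOME G. G x0 = 0 \<and> (\<forall>x\<in>J. (G has_vector_derivative A x (Z x)) (at x)))"
    for Z
  define T where "T = rec_nat (\<lambda>_. y0) (\<lambda>_. next_term)"
  have T0: "T 0 = (\<lambda>_. y0)" and TS: "T (Suc n) = next_term (T n)" for n by (simp_all add: T_def)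
  have nt: "next_term Z x0 = 0 \<and> (\<forall>x\<in>J. (next_term Z has_vector_derivative A x (Z x)) (at x))"
    if "continuous_on J Z" for Z
  proof -
    have "continuous_on J (\<lambda>x. A x (Z x))"
      by (intro bounded_bilinear.continuous_on[OF bounded_bilinear_blinfun_apply] A that)
    from someI_ex[OF antiderivative_on_open_interval[OF J x0 this]] show ?thesis
      unfolding next_term_def .
  qed
  have cont: "continuous_on J (T n)" for n
  proof (induction n)
    case (Suc n)
    then show ?case unfolding TS
      by (intro continuous_at_imp_continuous_on ballI) (use nt has_vector_derivative_continuous in blast)
  qed (simp add: T0)
  have TSd: "(T (Suc n) has_vector_derivative A x (T n x)) (at x)" if "x \<in> J" for n x
    using nt[OF cont] that unfolding TS by blast
  \<comment> \<open>The derivative of each term is the operator applied to the previous one; the term of index zero is constant.\<close>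
  define dT where "dT = (\<lambda>n x. case n of 0 \<Rightarrow> 0 | Suc m \<Rightarrow> A x (T m x))"
  have Td: "(T n has_vector_derivative dT n x) (at x)" if "x \<in> J" for n x
    using TSd[OF that] by (cases n) (auto simp: dT_def T0)
  define Y where "Y = (\<lambda>x. suminf (\<lambda>n. T n x))"
  have main: "Y x0 = y0 \<and> (Y has_vector_derivative A x (Y x)) (at x)" if x: "x \<in> J" for x
  proof -
    obtain a b where ab: "a < x" "a < x0" "x < b" "x0 < b" "{a..b} \<subseteq> J"
      using open_interval_pad[OF J x x0] .
    have "compact (A ` {a..b})"
      by (intro compact_continuous_image continuous_on_subset[OF A]) (use ab in auto)
    then have "bounded (A ` {a..b})" by (rule compact_imp_bounded)
    then obtain M0 where M0: "\<And>u. u \<in> {a..b} \<Longrightarrow> norm (A u) \<le> M0"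
      unfolding bounded_iff by blast
    define M where "M = max M0 0"
    have M: "M \<ge> 0" "\<And>u. u \<in> {a..b} \<Longrightarrow> norm (A u) \<le> M" using M0 by (auto simp: M_def le_max_iff_disj)
    have seg: "closed_segment x0 u \<subseteq> {a..b}" if "u \<in> {a..b}" for u
      using that ab by (auto simp: closed_segment_eq_real_ivl split: if_splits)
    have TSx0: "T (Suc n) x0 = 0" for n using nt[OF cont] unfolding TS by blast
    have bound: "norm (T n u) \<le> norm y0 * M ^ n * \<bar>u - x0\<bar> ^ n / fact n" if "u \<in> {a..b}" for n u
      using that
    proof (induction n arbitrary: u)
      case (Suc n)
      show ?case
      proof (rule power_growth_of_antiderivative[where f = "\<lambda>u. A u (T n u)"])
        fix v assume "v \<in> closed_segment x0 u"
        then have v: "v \<in> {a..b}" using seg[OF Suc.prems] by blast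
        then show "(T (Suc n) has_vector_derivative A v (T n v)) (at v)" using TSd ab by blast
        have "norm (A v (T n v)) \<le> norm (A v) * norm (T n v)" by (rule norm_blinfun)
        also have "\<dots> \<le> M * (norm y0 * M ^ n * \<bar>v - x0\<bar> ^ n / fact n)"
          by (intro mult_mono M(2)[OF v] Suc.IH[OF v] M(1)) auto
        finally show "norm (A v (T n v)) \<le> norm y0 * M ^ Suc n * \<bar>v - x0\<bar> ^ n / fact n" by (simp add: mult_ac)
      qed (rule TSx0)
    qed (simp add: T0)
    define L where "L = b - a"
    define m where "m = (\<lambda>n. norm y0 * (M * L) ^ n / fact n)"
    have bound': "norm (T n u) \<le> m n" if "u \<in> {a..b}" for n u
    proof -
      have "\<bar>u - x0\<bar> ^ n \<le> L ^ n" by (rule power_mono) (use that ab in \<open>auto simp: L_def\<close>)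
      then have "norm y0 * M ^ n * \<bar>u - x0\<bar> ^ n / fact n \<le> norm y0 * M ^ n * L ^ n / fact n"
        using M(1) by (intro divide_right_mono mult_left_mono) auto
      then show ?thesis using bound[OF that, of n] by (simp add: m_def power_mult_distrib mult_ac)
    qed
    have sm: "summable m"
      unfolding m_def using summable_mult[OF summable_exp[of "M * L"], of "norm y0"] by (simp add: field_simps)
    have smT: "summable (\<lambda>n. T n u)" if "u \<in> {a..b}" for u
      by (rule summable_comparison_test'[OF sm]) (use bound' that in auto)
    define D where "D = (\<lambda>n. case n of 0 \<Rightarrow> 0 | Suc k \<Rightarrow> M * m k)"
    have smD: "summable D"
      using summable_mult[OF sm, of M] unfolding summable_Suc_iff[of D, symmetric] by (simp add: D_def)
    have dTD: "norm (dT n u) \<le> D n" if u: "u \<in> {a..b}" for n u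
    proof (cases n)
      case (Suc k)
      have "norm (A u (T k u)) \<le> norm (A u) * norm (T k u)" by (rule norm_blinfun)
      also have "\<dots> \<le> M * m k" by (intro mult_mono M(2)[OF u] bound'[OF u] M(1)) auto
      finally show ?thesis by (simp add: dT_def D_def Suc)
    qed (simp add: dT_def D_def)
    have ul: "uniform_limit {a..b} (\<lambda>n u. \<Sum>i<n. dT i u) (\<lambda>u. suminf (\<lambda>i. dT i u)) sequentially"
      by (rule Weierstrass_m_test[OF dTD smD])
    have "\<exists>g. \<forall>u\<in>{a..b}. (\<lambda>n. T n u) sums (g u) \<and> (g has_derivative (\<lambda>h. h *\<^sub>R suminf (\<lambda>i. dT i u))) (at u within {a..b})"
    proof (rule has_derivative_series[where f' = "\<lambda>n u h. h *\<^sub>R dT n u" and x = x0])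
      show "(\<lambda>n. T n x0) sums suminf (\<lambda>n. T n x0)" using smT ab by (intro summable_sums) auto
      fix n u assume "u \<in> {a..b}"
      then show "(T n has_derivative (\<lambda>h. h *\<^sub>R dT n u)) (at u within {a..b})"
        using Td ab(5) has_derivative_at_withinI unfolding has_vector_derivative_def by blast
    next
      fix e :: real assume "e > 0"
      then have "\<forall>\<^sub>F n in sequentially. \<forall>u\<in>{a..b}. dist (\<Sum>i<n. dT i u) (suminf (\<lambda>i. dT i u)) < e"
        using ul uniform_limitD by blast
      then show "\<forall>\<^sub>F n in sequentially. \<forall>u\<in>{a..b}. \<forall>h. norm ((\<Sum>i<n. h *\<^sub>R dT i u) - h *\<^sub>R suminf (\<lambda>i. dT i u)) \<le> e * norm h"
      proof (eventually_elim, intro ballI allI)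
        fix n u and h :: real
        assume H: "\<forall>u\<in>{a..b}. dist (\<Sum>i<n. dT i u) (suminf (\<lambda>i. dT i u)) < e" "u \<in> {a..b}"
        have "norm ((\<Sum>i<n. h *\<^sub>R dT i u) - h *\<^sub>R suminf (\<lambda>i. dT i u)) =
            \<bar>h\<bar> * norm ((\<Sum>i<n. dT i u) - suminf (\<lambda>i. dT i u))"
          unfolding scaleR_sum_right[symmetric] scaleR_diff_right[symmetric] by simp
        also have "\<dots> \<le> \<bar>h\<bar> * e"
          using H by (intro mult_left_mono) (auto simp: dist_norm intro: less_imp_le)
        finally show "norm ((\<Sum>i<n. h *\<^sub>R dT i u) - h *\<^sub>R suminf (\<lambda>i. dT i u)) \<le> e * norm h" by (simp add: mult.commute)
      qed
    qed (use ab in auto)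
    then obtain g where g: "\<And>u. u \<in> {a..b} \<Longrightarrow> (\<lambda>n. T n u) sums (g u)"
      "\<And>u. u \<in> {a..b} \<Longrightarrow> (g has_derivative (\<lambda>h. h *\<^sub>R suminf (\<lambda>i. dT i u))) (at u within {a..b})" by blast
    have gY: "g u = Y u" if "u \<in> {a..b}" for u using g(1)[OF that] by (simp add: Y_def sums_iff)
    have "(\<lambda>n. A x (T n x)) sums A x (Y x)"
      using bounded_linear.sums[OF blinfun.bounded_linear_right, OF g(1)[of x]] gY ab by auto
    then have "(\<lambda>n. dT (Suc n) x) sums A x (Y x)" by (simp add: dT_def)
    then have "(\<lambda>n. dT n x) sums A x (Y x)" by (subst (asm) sums_Suc_iff) (simp add: dT_def)
    then have "suminf (\<lambda>i. dT i x) = A x (Y x)" by (simp add: sums_iff)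
    moreover have "(g has_derivative (\<lambda>h. h *\<^sub>R suminf (\<lambda>i. dT i x))) (at x)"
      using g(2)[of x] ab at_within_interior[of x "{a..b}"] by simp
    ultimately have "(g has_vector_derivative A x (Y x)) (at x)" by (simp add: has_vector_derivative_def)
    then have "(Y has_vector_derivative A x (Y x)) (at x)"
      by (rule has_vector_derivative_transform_within_open[of _ _ _ "{a<..<b}"]) (use ab gY in auto)
    moreover have "Y x0 = y0"
    proof -
      have "(\<lambda>n. T (Suc n) x0) sums 0" by (simp add: TSx0)
      then have "(\<lambda>n. T n x0) sums (0 + T 0 x0)"
        using sums_Suc_iff[of "\<lambda>n. T n x0" 0] by simp
      then show ?thesis by (simp add: Y_def sums_iff T0)
    qed
    ultimately show ?thesis by blast
  qed
  then show ?thesis using x0 by blast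
qed

text \<open>
  The exponential \<open>E t = exp (t A)\<close>, as the solution of \<open>E' = A E\<close> in the Banach space of operators.
\<close>

lemma linear_flow_exists:
  fixes A :: "'a::banach \<Rightarrow>\<^sub>L 'a"
  shows "\<exists>E. E 0 = id_blinfun \<and> smooth_on UNIV E \<and> (\<forall>t. (E has_vector_derivative A o\<^sub>L E t) (at t))"
proof -
  let ?L = "\<lambda>E::'a \<Rightarrow>\<^sub>L 'a. A o\<^sub>L E"
  have L: "bounded_linear ?L" by (rule bounded_bilinear.bounded_linear_right[OF bounded_bilinear_blinfun_compose])
  obtain E where E: "E 0 = id_blinfun" "\<And>t. (E has_vector_derivative A o\<^sub>L E t) (at t)"
    using linear_ode_solution[of UNIV 0 "\<lambda>_. Blinfun ?L" id_blinfun]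
    by (auto simp: open_interval_def is_interval_univ bounded_linear_Blinfun_apply[OF L])
  have "smooth_on UNIV E"
  proof (rule smooth_on_bootstrap)
    show "continuous_on UNIV E"
      by (intro continuous_at_imp_continuous_on ballI) (use E(2) has_vector_derivative_continuous in blast)
    show "(E has_derivative (\<lambda>h. h *\<^sub>R (A o\<^sub>L E t))) (at t)" for t
      using E(2) by (simp add: has_vector_derivative_def)
    show "C_k_on k UNIV (\<lambda>t. v *\<^sub>R (A o\<^sub>L E t))" if "C_k_on k UNIV E" for k v
      by (intro C_k_on_linear_compose[OF bounded_linear_scaleR_right] C_k_on_linear_compose[OF L] that) auto
  qed auto
  then show ?thesis using E by blast
qed

section \<open>Vector fields whose flows preserve a family of curves\<close>

text \<open>
  The notions of a local flow and of a generator of point symmetries, for curves with values in an arbitrary fibre \<open>'e\<close> and with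
  the family \<open>S\<close> of solution curves as a parameter. In this form they apply both to the real system,
  where \<open>'e\<close> is \<open>\<real>\<^sup>2\<close>, and to the complex linear equation.
\<close>

definition flow_near ::
  "(real \<times> 'e::real_normed_vector) set \<Rightarrow> (real \<times> 'e \<Rightarrow> real \<times> 'e) \<Rightarrow> real \<Rightarrow> (real \<times> 'e) set \<Rightarrow>
     (real \<Rightarrow> real \<times> 'e \<Rightarrow> real \<times> 'e) \<Rightarrow> bool" where
  "flow_near M X \<epsilon> N \<phi> \<longleftrightarrow>
     0 < \<epsilon> \<and> open N \<and> N \<subseteq> M \<and>
     smooth_on ({-\<epsilon><..<\<epsilon>} \<times> N) (\<lambda>(t, q). \<phi> t q) \<and>
     (\<forall>q\<in>N. \<phi> 0 q = q \<and>
        (\<forall>t\<in>{-\<epsilon><..<\<epsilon>}. \<phi> t q \<in> M \<and> ((\<lambda>s. \<phi> s q) has_vector_derivative X (\<phi> t q)) (at t)))"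

lemma flow_nearD:
  assumes "flow_near M X \<epsilon> N \<phi>"
  shows "0 < \<epsilon>" "open N" "N \<subseteq> M" "smooth_on ({-\<epsilon><..<\<epsilon>} \<times> N) (\<lambda>(t, q). \<phi> t q)"
    and "\<And>q. q \<in> N \<Longrightarrow> \<phi> 0 q = q"
    and "\<And>t q. q \<in> N \<Longrightarrow> t \<in> {-\<epsilon><..<\<epsilon>} \<Longrightarrow> \<phi> t q \<in> M"
    and "\<And>t q. q \<in> N \<Longrightarrow> t \<in> {-\<epsilon><..<\<epsilon>} \<Longrightarrow> ((\<lambda>s. \<phi> s q) has_vector_derivative X (\<phi> t q)) (at t)"
  using assms unfolding flow_near_def by blast+

definition moves_solution ::
  "(real set \<Rightarrow> (real \<Rightarrow> 'e) \<Rightarrow> bool) \<Rightarrow> real \<Rightarrow> (real \<Rightarrow> real \<times> 'e \<Rightarrow> real \<times> 'e) \<Rightarrow>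
     real set \<Rightarrow> (real \<Rightarrow> 'e) \<Rightarrow> real \<Rightarrow> bool" where
  "moves_solution S \<epsilon> \<phi> J f x0 \<longleftrightarrow>
     (\<exists>\<delta> J0. 0 < \<delta> \<and> \<delta> \<le> \<epsilon> \<and> open_interval J0 \<and> x0 \<in> J0 \<and> J0 \<subseteq> J \<and>
        (\<forall>t\<in>{-\<delta><..<\<delta>}. \<exists>K g. open_interval K \<and> S K g \<and> \<phi> t ` graph J0 f = graph K g))"

lemma moves_solutionE:
  assumes "moves_solution S \<epsilon> \<phi> J f x0"
  obtains \<delta> J0 where "0 < \<delta>" "\<delta> \<le> \<epsilon>" "open_interval J0" "x0 \<in> J0" "J0 \<subseteq> J"
    "\<And>t. t \<in> {-\<delta><..<\<delta>} \<Longrightarrow> \<exists>K g. open_interval K \<and> S K g \<and> \<phi> t ` graph J0 f = graph K g"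
  using assms unfolding moves_solution_def by blast

definition curve_symmetry ::
  "(real \<times> 'e::real_normed_vector) set \<Rightarrow> (real set \<Rightarrow> (real \<Rightarrow> 'e) \<Rightarrow> bool) \<Rightarrow> (real \<times> 'e \<Rightarrow> real \<times> 'e) \<Rightarrow> bool" where
  "curve_symmetry M S X \<longleftrightarrow>
     (\<forall>p\<in>M. \<exists>\<epsilon> N \<phi>. p \<in> N \<and> flow_near M X \<epsilon> N \<phi> \<and>
        (\<forall>J f x0. open_interval J \<and> S J f \<and> graph J f \<subseteq> N \<and> x0 \<in> J \<longrightarrow> moves_solution S \<epsilon> \<phi> J f x0))"

definition symmetry_fields ::
  "(real \<times> 'e::real_normed_vector) set \<Rightarrow> (real set \<Rightarrow> (real \<Rightarrow> 'e) \<Rightarrow> bool) \<Rightarrow> (real \<times> 'e \<Rightarrow> real \<times> 'e) set" where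
  "symmetry_fields M S = {X. smooth_on M X \<and> (\<forall>p. p \<notin> M \<longrightarrow> X p = 0) \<and> curve_symmetry M S X}"

lemma curve_chain:
  assumes "(g has_derivative g') (at (x, f x))" "(f has_vector_derivative v) (at x)"
  shows "((\<lambda>x. g (x, f x)) has_vector_derivative g' (1, v)) (at x)"
proof -
  have "((\<lambda>x. (x, f x)) has_derivative (\<lambda>h. h *\<^sub>R (1, v))) (at x)"
    using has_vector_derivative_Pair[OF has_vector_derivative_id assms(2)]
    by (simp add: has_vector_derivative_def)
  from has_derivative_compose[OF this assms(1)] show ?thesis
    unfolding has_vector_derivative_def
    by (simp only: linear_cmul[OF has_derivative_linear[OF assms(1)]])
qed

lemma open_interval_around:
  assumes "open S" "x \<in> S"
  obtains J where "open_interval J" "x \<in> J" "J \<subseteq> S"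
proof -
  obtain e where "e > 0" "ball x e \<subseteq> S" using assms by (meson openE)
  then show ?thesis
    using that[of "ball x e"] by (auto simp: open_interval_def is_interval_ball_real)
qed

text \<open>
  The derivative is carried along as a second function, so that the initial values of a solution can be named.
\<close>

definition solves :: "(real \<Rightarrow> real) \<Rightarrow> real set \<Rightarrow> (real \<Rightarrow> complex) \<Rightarrow> (real \<Rightarrow> complex) \<Rightarrow> bool" where
  "solves \<beta> J f f' \<longleftrightarrow> (\<forall>x\<in>J. (f has_vector_derivative f' x) (at x) \<and>
      (f' has_vector_derivative \<i> * \<beta> x * f x) (at x))"

lemma solvesD:
  assumes "solves \<beta> J f f'" "x \<in> J"
  shows "(f has_vector_derivative f' x) (at x)" "(f' has_vector_derivative \<i> * \<beta> x * f x) (at x)"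
  using assms by (auto simp: solves_def)

lemma solves_subset: "solves \<beta> J f f' \<Longrightarrow> K \<subseteq> J \<Longrightarrow> solves \<beta> K f f'"
  by (auto simp: solves_def)

lemma solves_continuous:
  assumes "solves \<beta> J f f'"
  shows "continuous_on J f" "continuous_on J f'"
  by (intro continuous_at_imp_continuous_on ballI; rule has_vector_derivative_continuous; rule solvesD[OF assms]; assumption)+

lemma solves_combination:
  assumes "solves \<beta> J f f'" "solves \<beta> J g g'"
  shows "solves \<beta> J (\<lambda>x. a * f x + b * g x) (\<lambda>x. a * f' x + b * g' x)"
  unfolding solves_def
  by (intro ballI conjI; rule has_vector_derivative_eq_rhs, 
     (rule derivative_intros solvesD[OF assms(1)] solvesD[OF assms(2)] | assumption)+)
     (auto simp: algebra_simps)

lemma solves_exists: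
  assumes "open_interval J" "x0 \<in> J" "continuous_on J \<beta>"
  shows "\<exists>f f'. f x0 = a \<and> f' x0 = b \<and> solves \<beta> J f f'"
proof -
  let ?P = "\<lambda>z::complex \<times> complex. (snd z, 0::complex)"
  let ?Q = "\<lambda>z::complex \<times> complex. (0::complex, \<i> * fst z)"
  have P: "bounded_linear ?P" and Q: "bounded_linear ?Q"
    by (intro bounded_linear_intros)+
  have "continuous_on J (\<lambda>x. Blinfun ?P + \<beta> x *\<^sub>R Blinfun ?Q)"
    by (intro continuous_intros assms(3))
  then obtain Y where Y: "Y x0 = (a, b)"
    "\<And>x. x \<in> J \<Longrightarrow> (Y has_vector_derivative (Blinfun ?P + \<beta> x *\<^sub>R Blinfun ?Q) (Y x)) (at x)"
    using linear_ode_solution[OF assms(1,2), of _ "(a, b)"] by blast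
  have Y': "(Y has_vector_derivative (snd (Y x), \<i> * \<beta> x * fst (Y x))) (at x)" if "x \<in> J" for x
    using Y(2)[OF that]
    by (simp add: blinfun.add_left blinfun.scaleR_left bounded_linear_Blinfun_apply[OF P] bounded_linear_Blinfun_apply[OF Q]
         scaleR_conv_of_real mult_ac)
  have "solves \<beta> J (\<lambda>x. fst (Y x)) (\<lambda>x. snd (Y x))"
    unfolding solves_def
    using bounded_linear.has_vector_derivative[OF bounded_linear_fst Y']
      bounded_linear.has_vector_derivative[OF bounded_linear_snd Y'] by auto
  then show ?thesis using Y(1) by (intro exI[of _ "\<lambda>x. fst (Y x)"] exI[of _ "\<lambda>x. snd (Y x)"]) auto
qed

lemma solves_wronskian_constant:
  assumes J: "open_interval J" and f: "solves \<beta> J f f'" and g: "solves \<beta> J g g'"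
  shows "\<exists>c. \<forall>x\<in>J. f x * g' x - f' x * g x = c"
proof -
  have D: "((\<lambda>x. f x * g' x - f' x * g x) has_vector_derivative 0) (at x within J)" if x: "x \<in> J" for x
  proof -
    have "((\<lambda>x. f x * g' x - f' x * g x) has_vector_derivative
        (f x * (\<i> * \<beta> x * g x) + f' x * g' x) - (f' x * g' x + (\<i> * \<beta> x * f x) * g x)) (at x)"
      by (intro has_vector_derivative_diff has_vector_derivative_mult solvesD[OF f x] solvesD[OF g x])
    moreover have "(f x * (\<i> * \<beta> x * g x) + f' x * g' x) - (f' x * g' x + (\<i> * \<beta> x * f x) * g x) = 0"
      by (simp add: algebra_simps)
    ultimately show ?thesis using has_vector_derivative_at_within by metis
  qed
  have "convex J" using J by (simp add: open_interval_def is_interval_convex)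
  from has_vector_derivative_zero_constant[OF this D] obtain c
    where "\<And>x. x \<in> J \<Longrightarrow> f x * g' x - f' x * g x = c" by auto
  then show ?thesis by auto
qed

text \<open>Variation of constants with constants that do not vary: the coefficients are Wronskians.\<close>

lemma solves_by_fundamental_pair:
  assumes K: "open_interval K" and f: "solves \<beta> K f f'" and f1: "solves \<beta> K f1 f1'" and f2: "solves \<beta> K f2 f2'"
    and W: "\<And>x. x \<in> K \<Longrightarrow> f1 x * f2' x - f1' x * f2 x = 1"
  shows "\<exists>A B. \<forall>x\<in>K. f x = A * f1 x + B * f2 x"
proof -
  obtain A where A: "\<And>x. x \<in> K \<Longrightarrow> f x * f2' x - f' x * f2 x = A"
    using solves_wronskian_constant[OF K f f2] by blast
  obtain B where B: "\<And>x. x \<in> K \<Longrightarrow> f1 x * f' x - f1' x * f x = B"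
    using solves_wronskian_constant[OF K f1 f] by blast
  have "f x = A * f1 x + B * f2 x" if "x \<in> K" for x
  proof -
    have "A * f1 x + B * f2 x = f x * (f1 x * f2' x - f1' x * f2 x)"
      unfolding A[OF that, symmetric] B[OF that, symmetric] by (simp add: algebra_simps)
    then show ?thesis using W[OF that] by simp
  qed
  then show ?thesis by blast
qed

lemma fundamental_pair_exists:
  assumes J: "open_interval J" and x0: "x0 \<in> J" and b: "continuous_on J \<beta>"
  obtains f1 f1' f2 f2' where "solves \<beta> J f1 f1'" "solves \<beta> J f2 f2'"
    "f1 x0 = 1" "f1' x0 = 0" "f2 x0 = 0" "f2' x0 = 1"
    "\<And>x. x \<in> J \<Longrightarrow> f1 x * f2' x - f1' x * f2 x = 1"
proof -
  obtain f1 f1' where f1: "f1 x0 = 1" "f1' x0 = 0" "solves \<beta> J f1 f1'"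
    using solves_exists[OF assms] by blast
  obtain f2 f2' where f2: "f2 x0 = 0" "f2' x0 = 1" "solves \<beta> J f2 f2'"
    using solves_exists[OF assms] by blast
  have "\<And>x. x \<in> J \<Longrightarrow> f1 x * f2' x - f1' x * f2 x = 1"
    using solves_wronskian_constant[OF J f1(3) f2(3)] x0 f1 f2 by (metis diff_zero mult_1 mult_zero_left)
  then show ?thesis using that f1 f2 by blast
qed

lemma solves_smooth:
  assumes "open J" "solves \<beta> J f f'" "smooth_on J \<beta>"
  shows "smooth_on J f" "smooth_on J f'"
proof -
  let ?z = "\<lambda>x. (f x, f' x)"
  have D: "(?z has_derivative (\<lambda>h. h *\<^sub>R (f' x, \<i> * \<beta> x * f x))) (at x)" if "x \<in> J" for x
    using has_vector_derivative_Pair[OF solvesD[OF assms(2) that]] by (simp add: has_vector_derivative_def)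
  have "smooth_on J ?z"
  proof (rule smooth_on_bootstrap[OF assms(1) _ D])
    show "continuous_on J ?z"
      by (intro continuous_at_imp_continuous_on ballI) (use D has_derivative_continuous in blast)
    fix k and v :: real assume z: "C_k_on k J ?z"
    let ?N = "\<lambda>z::complex \<times> complex. (snd z, 0::complex)"
    let ?U = "\<lambda>w. (0::complex, \<i> * w)"
    have "C_k_on k J (\<lambda>x. v *\<^sub>R (?N (?z x) + ?U (\<beta> x *\<^sub>R fst (?z x))))"
      by (intro C_k_on_linear_compose[OF bounded_linear_scaleR_right] C_k_on_add assms(1)
          C_k_on_linear_compose[where L = ?N] C_k_on_linear_compose[where L = ?U] z
          C_k_on_bilinear[OF bounded_bilinear_scaleR] C_k_on_linear_compose[OF bounded_linear_fst] bounded_linear_intros)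
         (use assms(3) smooth_on_def in blast)
    then show "C_k_on k J (\<lambda>x. v *\<^sub>R (f' x, \<i> * \<beta> x * f x))"
      by (simp add: scaleR_conv_of_real mult_ac)
  qed
  then show "smooth_on J f" "smooth_on J f'"
    using smooth_on_fst[OF assms(1), of ?z] smooth_on_snd[OF assms(1), of ?z] by auto
qed

section \<open>Characteristics of symmetries of the linear equation\<close>

lemma open_cbase:
  assumes open_G: "open G"
  shows "open (cbase G)"
proof -
  have "cbase G = (\<lambda>j. (fst j, fst (snd j))) ` G" by (force simp: cbase_def)
  also have "\<dots> = (\<Union>v. {p. (fst p, snd p, v) \<in> G})" by force
  also have "open \<dots>"
  proof (intro open_UN ballI)
    fix v
    have "{p. (fst p, snd p, v) \<in> G} = (\<lambda>p. (fst p, snd p, v)) -` G" by auto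
    moreover have "open ((\<lambda>p::real \<times> complex. (fst p, snd p, v)) -` G)"
      by (intro open_vimage open_G continuous_intros)
    ultimately show "open {p. (fst p, snd p, v) \<in> G}" by simp
  qed
  finally show ?thesis .
qed

text \<open>
  The set \<open>G\<close> of admissible jets need not be a product: it is the image of the jet domain of the original
  system. Only curves with jets in \<open>G\<close> count as solutions.
\<close>

locale linear_equation =
  fixes G :: "cjet set" and \<beta> :: "real \<Rightarrow> real"
  assumes open_G: "open G" and nonempty_G: "G \<noteq> {}" and connected_M: "connected (cbase G)"
    and smooth_beta: "smooth_on (fst ` cbase G) \<beta>"
begin

abbreviation "M \<equiv> cbase G"
abbreviation "I \<equiv> fst ` cbase G"
abbreviation "S \<equiv> scalar_solution_on G (\<lambda>(x, u, v). \<i> * \<beta> x * u)"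

lemma open_M: "open M" by (rule open_cbase[OF open_G])

lemma open_interval_I: "open_interval I"
proof -
  have "open I" by (rule open_image_fst[OF open_M])
  moreover have "connected I" by (intro connected_continuous_image continuous_intros connected_M)
  then have "is_interval I" by (simp add: is_interval_connected_1)
  moreover have "I \<noteq> {}" using nonempty_G by (force simp: cbase_def)
  ultimately show ?thesis by (simp add: open_interval_def)
qed

lemma open_I: "open I" using open_interval_I by (simp add: open_interval_def)

lemma continuous_beta: "continuous_on I \<beta>" by (rule smooth_on_continuous[OF smooth_beta])

lemma S_iff: "S J f \<longleftrightarrow> (\<exists>f'. (\<forall>x\<in>J. (x, f x, f' x) \<in> G) \<and> solves \<beta> J f f')"
  by (auto simp: scalar_solution_on_def solves_def)

lemma G_base: "(x, u, v) \<in> G \<Longrightarrow> (x, u) \<in> M" by (auto simp: cbase_def)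
lemma G_I: "(x, u, v) \<in> G \<Longrightarrow> x \<in> I" by (force simp: cbase_def)

lemma solution_through:
  assumes "(x0, u0, v0) \<in> G"
  obtains J f f' where "open_interval J" "x0 \<in> J" "J \<subseteq> I" "f x0 = u0" "f' x0 = v0" "solves \<beta> J f f'"
    "\<And>x. x \<in> J \<Longrightarrow> (x, f x, f' x) \<in> G"
proof -
  have x0: "x0 \<in> I" using assms G_I by blast
  obtain f f' where f: "f x0 = u0" "f' x0 = v0" "solves \<beta> I f f'"
    using solves_exists[OF open_interval_I x0 continuous_beta] by blast
  have "continuous_on I (\<lambda>x. (x, f x, f' x))"
    by (intro continuous_intros solves_continuous[OF f(3)])
  then have "open (I \<inter> (\<lambda>x. (x, f x, f' x)) -` G)"
    using continuous_open_preimage open_I open_G by blast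
  moreover have "x0 \<in> I \<inter> (\<lambda>x. (x, f x, f' x)) -` G" using x0 assms f by auto
  ultimately obtain J where "open_interval J" "x0 \<in> J" "J \<subseteq> I \<inter> (\<lambda>x. (x, f x, f' x)) -` G"
    by (rule open_interval_around)
  then show ?thesis using that[of J f f'] f solves_subset[OF f(3), of J] by auto
qed

text \<open>
  The flow carries \<open>f\<close> to solutions \<open>A t * f1 + B t * f2\<close>. Evaluating at two points of the
  curve shows that \<open>A\<close> and \<open>B\<close> are differentiable at \<open>0\<close>, and differentiating the identity in
  \<open>t\<close> exhibits the characteristic as the solution \<open>A' * f1 + B' * f2\<close>.
\<close>

lemma characteristic_solves:
  assumes X: "curve_symmetry M S X" and J: "open_interval J" and f: "solves \<beta> J f f'"
    and jets: "\<And>x. x \<in> J \<Longrightarrow> (x, f x, f' x) \<in> G" and x0: "x0 \<in> J"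
  shows "\<exists>J0 Q'. open_interval J0 \<and> x0 \<in> J0 \<and> J0 \<subseteq> J \<and>
     solves \<beta> J0 (\<lambda>x. snd (X (x, f x)) - fst (X (x, f x)) *\<^sub>R f' x) Q'"
proof -
  have JI: "J \<subseteq> I" using jets G_I by blast
  have "(x0, f x0) \<in> M" using jets[OF x0] G_base by blast
  from bspec[OF X[unfolded curve_symmetry_def] this] obtain \<epsilon> N \<phi>
    where N: "(x0, f x0) \<in> N" "flow_near M X \<epsilon> N \<phi>"
    and mv: "\<And>J f x0. open_interval J \<Longrightarrow> S J f \<Longrightarrow> graph J f \<subseteq> N \<Longrightarrow> x0 \<in> J \<Longrightarrow> moves_solution S \<epsilon> \<phi> J f x0"
    by (elim exE conjE) (rule_tac that, auto)
  have openN: "open N" and eps: "0 < \<epsilon>" by (rule flow_nearD[OF N(2)])+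
  have flow0: "\<phi> 0 q = q" "((\<lambda>s. \<phi> s q) has_vector_derivative X q) (at 0)" if "q \<in> N" for q
  proof -
    show 1: "\<phi> 0 q = q" by (rule flow_nearD(5)[OF N(2) that])
    have "0 \<in> {-\<epsilon><..<\<epsilon>}" using eps by simp
    from flow_nearD(7)[OF N(2) that this] show "((\<lambda>s. \<phi> s q) has_vector_derivative X q) (at 0)"
      unfolding 1 .
  qed
  have "continuous_on J (\<lambda>x. (x, f x))"
    by (intro continuous_intros solves_continuous[OF f])
  then have "open (J \<inter> (\<lambda>x. (x, f x)) -` N)"
    using J openN continuous_open_preimage unfolding open_interval_def by blast
  moreover have "x0 \<in> J \<inter> (\<lambda>x. (x, f x)) -` N" using x0 N by auto
  ultimately obtain J1 where J1: "open_interval J1" "x0 \<in> J1" "J1 \<subseteq> J \<inter> (\<lambda>x. (x, f x)) -` N"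
    by (rule open_interval_around)
  have SJ1: "S J1 f"
    unfolding S_iff by (rule exI[of _ f']) (use J1(3) jets solves_subset[OF f, of J1] in auto)
  have gJ1: "graph J1 f \<subseteq> N" using J1 by (auto simp: graph_def)
  obtain \<delta> J0 where del: "0 < \<delta>" "\<delta> \<le> \<epsilon>" and J0: "open_interval J0" "x0 \<in> J0" "J0 \<subseteq> J1"
    and mv': "\<And>t. t \<in> {-\<delta><..<\<delta>} \<Longrightarrow> \<exists>K g. open_interval K \<and> S K g \<and> \<phi> t ` graph J0 f = graph K g"
    by (rule moves_solutionE[OF mv[OF J1(1) SJ1 gJ1 J1(2)]]) (rule that; assumption)
  have J0N: "(x, f x) \<in> N" if "x \<in> J0" for x using J0 J1 that by blast
  have J0I: "J0 \<subseteq> I" using J0 J1 JI by blast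
  obtain f1 f1' f2 f2' where F: "solves \<beta> I f1 f1'" "solves \<beta> I f2 f2'"
    "f1 x0 = 1" "f1' x0 = 0" "f2 x0 = 0" "f2' x0 = 1"
    and W: "\<And>x. x \<in> I \<Longrightarrow> f1 x * f2' x - f1' x * f2 x = 1"
    using fundamental_pair_exists[OF open_interval_I _ continuous_beta, of x0] J0I J0(2) by blast
  define a b where "a = (\<lambda>x t. fst (\<phi> t (x, f x)))" and "b = (\<lambda>x t. snd (\<phi> t (x, f x)))"
  have "\<exists>A B. \<forall>x\<in>J0. b x t = A * f1 (a x t) + B * f2 (a x t)" if t: "t \<in> {-\<delta><..<\<delta>}" for t
  proof -
    obtain K g where K: "open_interval K" "S K g" "\<phi> t ` graph J0 f = graph K g" using mv'[OF t] by blast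
    obtain g' where g': "\<And>x. x \<in> K \<Longrightarrow> (x, g x, g' x) \<in> G" "solves \<beta> K g g'" using K(2) unfolding S_iff by blast
    have KI: "K \<subseteq> I" using g'(1) G_I by blast
    obtain A B where AB: "\<And>x. x \<in> K \<Longrightarrow> g x = A * f1 x + B * f2 x"
      using solves_by_fundamental_pair[OF K(1) g'(2) solves_subset[OF F(1) KI] solves_subset[OF F(2) KI]] W KI by blast
    have "b x t = A * f1 (a x t) + B * f2 (a x t)" if "x \<in> J0" for x
    proof -
      have "\<phi> t (x, f x) \<in> graph K g" using K(3) that by (auto simp: graph_def)
      then obtain s where "s \<in> K" "\<phi> t (x, f x) = (s, g s)" by (auto simp: graph_def)
      then show ?thesis using AB by (simp add: a_def b_def)
    qed
    then show ?thesis by blast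
  qed
  then obtain A B where AB: "\<And>t x. t \<in> {-\<delta><..<\<delta>} \<Longrightarrow> x \<in> J0 \<Longrightarrow> b x t = A t * f1 (a x t) + B t * f2 (a x t)"
    by metis
  have a0: "a x 0 = x" "b x 0 = f x" if "x \<in> J0" for x using flow0(1)[OF J0N[OF that]] by (auto simp: a_def b_def)
  define \<xi> \<eta> where "\<xi> = (\<lambda>x. fst (X (x, f x)))" and "\<eta> = (\<lambda>x. snd (X (x, f x)))"
  have ad: "(a x has_vector_derivative \<xi> x) (at 0)" "(b x has_vector_derivative \<eta> x) (at 0)" if "x \<in> J0" for x
    using bounded_linear.has_vector_derivative[OF bounded_linear_fst flow0(2)[OF J0N[OF that]]]
      bounded_linear.has_vector_derivative[OF bounded_linear_snd flow0(2)[OF J0N[OF that]]]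
    by (auto simp: a_def[abs_def] b_def[abs_def] \<xi>_def \<eta>_def)
  have fa: "((\<lambda>t. g (a x t)) has_vector_derivative \<xi> x *\<^sub>R g' x) (at 0)" if "solves \<beta> I g g'" "x \<in> J0" for g g' x
  proof -
    have "(g has_vector_derivative g' x) (at (a x 0))"
      using solvesD(1)[OF that(1) subsetD[OF J0I that(2)]] a0(1)[OF that(2)] by simp
    from vector_diff_chain_at[OF ad(1)[OF that(2)] this] show ?thesis by (simp add: o_def)
  qed
  \<comment> \<open>At \<open>x0\<close> and \<open>x2\<close> the fundamental pair has a nonzero determinant \<open>\<Delta> 0\<close>, and so it does at the moved points for small times.\<close>
  have "\<exists>x2\<in>J0. f2 x2 \<noteq> 0"
  proof (rule ccontr)
    assume "\<not> ?thesis"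
    then have z: "\<And>x. x \<in> J0 \<Longrightarrow> 0 = f2 x" by auto
    have "(f2 has_vector_derivative 0) (at x0)"
      by (rule has_vector_derivative_transform_within_open[OF has_vector_derivative_const _ J0(2) z])
         (use J0(1) in \<open>auto simp: open_interval_def\<close>)
    then show False
      using vector_derivative_unique_at solvesD(1)[OF F(2), of x0] J0I J0(2) F(6) by (metis in_mono zero_neq_one)
  qed
  then obtain x2 where x2: "x2 \<in> J0" "f2 x2 \<noteq> 0" by blast
  define \<Delta> where "\<Delta> = (\<lambda>t. f1 (a x0 t) * f2 (a x2 t) - f1 (a x2 t) * f2 (a x0 t))"
  define A0 where "A0 = (\<lambda>t. (b x0 t * f2 (a x2 t) - b x2 t * f2 (a x0 t)) / \<Delta> t)"
  define B0 where "B0 = (\<lambda>t. (f1 (a x0 t) * b x2 t - f1 (a x2 t) * b x0 t) / \<Delta> t)"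
  have \<Delta>0: "\<Delta> 0 \<noteq> 0" using a0 J0(2) x2 F by (simp add: \<Delta>_def)
  have dd: "(\<lambda>t. f1 (a x t)) differentiable (at 0)" "(\<lambda>t. f2 (a x t)) differentiable (at 0)"
    "b x differentiable (at 0)" if "x \<in> J0" for x
    using fa[OF F(1) that] fa[OF F(2) that] ad[OF that] by (auto intro: differentiableI_vector)
  have \<Delta>d: "\<Delta> differentiable (at 0)"
    unfolding \<Delta>_def by (intro derivative_intros dd J0 x2)
  have "A0 differentiable (at 0)" "B0 differentiable (at 0)"
    unfolding A0_def B0_def by (intro derivative_intros dd J0 x2 \<Delta>d \<Delta>0)+
  then obtain A' B' where A': "(A0 has_vector_derivative A') (at 0)" and B': "(B0 has_vector_derivative B') (at 0)"
    using vector_derivative_works by blast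
  have "isCont \<Delta> 0" using \<Delta>d differentiable_imp_continuous_within by blast
  then obtain d where d: "d > 0" "\<And>t. dist t 0 < d \<Longrightarrow> \<Delta> t \<noteq> 0"
    using continuous_at_avoid[of 0 \<Delta> 0] \<Delta>0 by (auto simp: dist_commute)
  define d' where "d' = min d \<delta>"
  have d': "d' > 0" using d del by (simp add: d'_def)
  have AB0: "A t = A0 t" "B t = B0 t" if "dist t 0 < d'" for t
  proof -
    have t: "t \<in> {-\<delta><..<\<delta>}" and nz: "\<Delta> t \<noteq> 0" using that d by (auto simp: d'_def)
    have "A t * \<Delta> t = b x0 t * f2 (a x2 t) - b x2 t * f2 (a x0 t)"
      "B t * \<Delta> t = f1 (a x0 t) * b x2 t - f1 (a x2 t) * b x0 t"
      unfolding \<Delta>_def using AB[OF t J0(2)] AB[OF t x2(1)] by (simp_all add: algebra_simps)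
    then show "A t = A0 t" "B t = B0 t" using nz by (auto simp: A0_def B0_def field_simps)
  qed
  have fx: "f x = A0 0 * f1 x + B0 0 * f2 x" if "x \<in> J0" for x
    using AB[of 0 x] AB0[of 0] that d' del a0 by simp
  have f'x: "f' x = A0 0 * f1' x + B0 0 * f2' x" if "x \<in> J0" for x
  proof -
    have "((\<lambda>x. A0 0 * f1 x + B0 0 * f2 x) has_vector_derivative A0 0 * f1' x + B0 0 * f2' x) (at x)"
      by (intro derivative_intros solvesD[OF F(1)] solvesD[OF F(2)]) (use that J0I in auto)
    then have "(f has_vector_derivative A0 0 * f1' x + B0 0 * f2' x) (at x)"
      by (rule has_vector_derivative_transform_within_open[of _ _ _ J0]) (use that J0(1) fx in \<open>auto simp: open_interval_def\<close>)
    moreover have "(f has_vector_derivative f' x) (at x)" using solvesD(1)[OF f] that J0 J1 by blast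
    ultimately show ?thesis using vector_derivative_unique_at by blast
  qed
  have Q: "\<eta> x - \<xi> x *\<^sub>R f' x = A' * f1 x + B' * f2 x" if x: "x \<in> J0" for x
  proof -
    have "((\<lambda>t. A0 t * f1 (a x t) + B0 t * f2 (a x t)) has_vector_derivative
       (A0 0 * (\<xi> x *\<^sub>R f1' x) + A' * f1 (a x 0)) + (B0 0 * (\<xi> x *\<^sub>R f2' x) + B' * f2 (a x 0))) (at 0)"
      by (intro derivative_intros fa A' B' F x)
    then have "(b x has_vector_derivative
       (A0 0 * (\<xi> x *\<^sub>R f1' x) + A' * f1 (a x 0)) + (B0 0 * (\<xi> x *\<^sub>R f2' x) + B' * f2 (a x 0))) (at 0)"
    proof (rule has_vector_derivative_transform_within[OF _ d'])
      fix t :: real assume t: "dist t 0 < d'"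
      then have "t \<in> {-\<delta><..<\<delta>}" by (auto simp: d'_def)
      then show "A0 t * f1 (a x t) + B0 t * f2 (a x t) = b x t"
        using AB[OF _ x] AB0[OF t] by simp
    qed simp
    then have "\<eta> x = (A0 0 * (\<xi> x *\<^sub>R f1' x) + A' * f1 (a x 0)) + (B0 0 * (\<xi> x *\<^sub>R f2' x) + B' * f2 (a x 0))"
      using ad(2)[OF x] vector_derivative_unique_at by blast
    then show ?thesis using f'x[OF x] a0[OF x] by (simp add: algebra_simps)
  qed
  have "solves \<beta> J0 (\<lambda>x. \<eta> x - \<xi> x *\<^sub>R f' x) (\<lambda>x. A' * f1' x + B' * f2' x)"
  proof -
    have *: "solves \<beta> J0 (\<lambda>x. A' * f1 x + B' * f2 x) (\<lambda>x. A' * f1' x + B' * f2' x)"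
      by (rule solves_combination; rule solves_subset[OF _ J0I]; rule F)
    show ?thesis
      unfolding solves_def
    proof (intro ballI conjI)
      fix x assume x: "x \<in> J0"
      show "((\<lambda>x. \<eta> x - \<xi> x *\<^sub>R f' x) has_vector_derivative A' * f1' x + B' * f2' x) (at x)"
        by (rule has_vector_derivative_transform_within_open[OF solvesD(1)[OF * x] _ x])
           (use J0(1) Q in \<open>auto simp: open_interval_def\<close>)
      show "((\<lambda>x. A' * f1' x + B' * f2' x) has_vector_derivative \<i> * \<beta> x * (\<eta> x - \<xi> x *\<^sub>R f' x)) (at x)"
        using solvesD(2)[OF * x] Q[OF x] by simp
    qed
  qed
  moreover have "J0 \<subseteq> J" using J0 J1 by blast
  ultimately show ?thesis using J0 unfolding \<xi>_def \<eta>_def by blast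
qed

end

section \<open>Cubic polynomials vanishing on an open set\<close>

lemma cubic_vanishing_real:
  fixes a0 a1 a2 a3 :: complex and e p0 :: real
  assumes "e > 0" "\<And>p::real. \<bar>p - p0\<bar> < e \<Longrightarrow> a0 + a1 * p + a2 * p ^ 2 + a3 * p ^ 3 = 0"
  shows "a0 = 0 \<and> a1 = 0 \<and> a2 = 0 \<and> a3 = 0"
proof -
  let ?P = "[:a0, a1, a2, a3:]"
  have "complex_of_real ` ball p0 e \<subseteq> {z. poly ?P z = 0}"
    using assms(2) by (auto simp: dist_real_def abs_minus_commute algebra_simps power2_eq_square power3_eq_cube)
  moreover have "infinite (complex_of_real ` ball p0 e)"
  proof -
    have "infinite (ball p0 e)" using uncountable_ball[OF assms(1), of p0] countable_finite by blast
    then show ?thesis by (meson finite_imageD inj_on_subset inj_of_real subset_UNIV)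
  qed
  ultimately have "infinite {z. poly ?P z = 0}" using finite_subset by blast
  then have "?P = 0" using poly_roots_finite by blast
  then show ?thesis by simp
qed

text \<open>
  The variables will be the real and imaginary parts of a derivative, and the coefficients the left-hand sides of the
  determining equations.
\<close>

lemma cubic_vanishing_real2:
  fixes c00 c10 c01 c20 c11 c02 c30 c21 c12 c03 :: complex and e p0 q0 :: real
  assumes "e > 0"
    and "\<And>p q::real. \<bar>p - p0\<bar> < e \<Longrightarrow> \<bar>q - q0\<bar> < e \<Longrightarrow>
      c00 + c10 * p + c01 * q + c20 * p^2 + c11 * p * q + c02 * q^2
        + c30 * p^3 + c21 * p^2 * q + c12 * p * q^2 + c03 * q^3 = 0"
  shows "c00 = 0" "c10 = 0" "c01 = 0" "c20 = 0" "c11 = 0" "c02 = 0" "c30 = 0" "c21 = 0" "c12 = 0" "c03 = 0"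
proof -
  have row: "c00 + c01 * q + c02 * q^2 + c03 * q^3 = 0 \<and> c10 + c11 * q + c12 * q^2 = 0 \<and>
      c20 + c21 * q = 0 \<and> c30 = 0" if "\<bar>q - q0\<bar> < e" for q :: real
    by (rule cubic_vanishing_real[OF assms(1), of p0]) (use assms(2)[OF _ that] in \<open>simp add: algebra_simps\<close>)
  have 0: "c00 = 0 \<and> c01 = 0 \<and> c02 = 0 \<and> c03 = 0"
    by (rule cubic_vanishing_real[OF assms(1), of q0]) (use row in auto)
  have 1: "c10 = 0 \<and> c11 = 0 \<and> c12 = 0 \<and> (0::complex) = 0"
    by (rule cubic_vanishing_real[OF assms(1), of q0]) (use row in auto)
  have 2: "c20 = 0 \<and> c21 = 0 \<and> (0::complex) = 0 \<and> (0::complex) = 0"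
    by (rule cubic_vanishing_real[OF assms(1), of q0]) (use row in auto)
  have 3: "c30 = 0" using row[of q0] assms(1) by auto
  show "c00 = 0" "c10 = 0" "c01 = 0" "c20 = 0" "c11 = 0" "c02 = 0" "c30 = 0" "c21 = 0" "c12 = 0" "c03 = 0"
    using 0 1 2 3 by auto
qed

section \<open>Partial derivatives on real times complex space\<close>

definition dx :: "(cpoint \<Rightarrow> complex) \<Rightarrow> cpoint \<Rightarrow> complex" where
  "dx g p = frechet_derivative g (at p) (1, 0)"
definition dy :: "(cpoint \<Rightarrow> complex) \<Rightarrow> cpoint \<Rightarrow> complex" where
  "dy g p = frechet_derivative g (at p) (0, 1)"
definition dz :: "(cpoint \<Rightarrow> complex) \<Rightarrow> cpoint \<Rightarrow> complex" where
  "dz g p = frechet_derivative g (at p) (0, \<i>)"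

text \<open>
  The three partial derivatives as functions named in advance, so that they can be computed by rules for sums and products.
\<close>

definition partials_on ::
  "cpoint set \<Rightarrow> (cpoint \<Rightarrow> complex) \<Rightarrow> (cpoint \<Rightarrow> complex) \<Rightarrow> (cpoint \<Rightarrow> complex) \<Rightarrow> (cpoint \<Rightarrow> complex) \<Rightarrow> bool" where
  "partials_on M g gx gy gz \<longleftrightarrow> (\<forall>p\<in>M. (g has_derivative
     (\<lambda>h. fst h *\<^sub>R gx p + Re (snd h) *\<^sub>R gy p + Im (snd h) *\<^sub>R gz p)) (at p))"

lemma partials_onD:
  "partials_on M g gx gy gz \<Longrightarrow> p \<in> M \<Longrightarrow>
    (g has_derivative (\<lambda>h. fst h *\<^sub>R gx p + Re (snd h) *\<^sub>R gy p + Im (snd h) *\<^sub>R gz p)) (at p)"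
  unfolding partials_on_def by blast

lemma partials_on_unique:
  assumes "partials_on M g gx gy gz" "p \<in> M"
  shows "dx g p = gx p" "dy g p = gy p" "dz g p = gz p"
  unfolding dx_def dy_def dz_def frechet_derivative_at[OF partials_onD[OF assms], symmetric] by simp_all

lemma smooth_partials:
  assumes "open M" "smooth_on M g"
  shows "partials_on M g (dx g) (dy g) (dz g)"
  unfolding partials_on_def
proof
  fix p assume p: "p \<in> M"
  have D: "(g has_derivative frechet_derivative g (at p)) (at p)" by (rule smooth_on_has_derivative[OF assms p])
  have lin: "linear (frechet_derivative g (at p))" using D by (rule has_derivative_linear)
  have "frechet_derivative g (at p) h = fst h *\<^sub>R dx g p + Re (snd h) *\<^sub>R dy g p + Im (snd h) *\<^sub>R dz g p" for h
  proof -
    have "h = fst h *\<^sub>R (1, 0) + Re (snd h) *\<^sub>R (0, 1) + Im (snd h) *\<^sub>R (0, \<i>)"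
      by (simp add: prod_eq_iff complex_eq_iff)
    then have "frechet_derivative g (at p) h =
        frechet_derivative g (at p) (fst h *\<^sub>R (1, 0) + Re (snd h) *\<^sub>R (0, 1) + Im (snd h) *\<^sub>R (0, \<i>))"
      by (rule arg_cong)
    then show ?thesis unfolding dx_def dy_def dz_def
      by (simp only: linear_add[OF lin] linear_cmul[OF lin])
  qed
  then have "frechet_derivative g (at p) = (\<lambda>h. fst h *\<^sub>R dx g p + Re (snd h) *\<^sub>R dy g p + Im (snd h) *\<^sub>R dz g p)" by auto
  with D show "(g has_derivative (\<lambda>h. fst h *\<^sub>R dx g p + Re (snd h) *\<^sub>R dy g p + Im (snd h) *\<^sub>R dz g p)) (at p)" by simp
qed

lemma smooth_dx: "smooth_on M g \<Longrightarrow> smooth_on M (dx g)"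
  unfolding dx_def[abs_def] by (rule smooth_on_frechet_derivative)
lemma smooth_dy: "smooth_on M g \<Longrightarrow> smooth_on M (dy g)"
  unfolding dy_def[abs_def] by (rule smooth_on_frechet_derivative)
lemma smooth_dz: "smooth_on M g \<Longrightarrow> smooth_on M (dz g)"
  unfolding dz_def[abs_def] by (rule smooth_on_frechet_derivative)

lemma partials_commute:
  assumes "open M" "smooth_on M g" "p \<in> M"
  shows "dx (dy g) p = dy (dx g) p" "dx (dz g) p = dz (dx g) p" "dy (dz g) p = dz (dy g) p"
  unfolding dx_def[abs_def] dy_def[abs_def] dz_def[abs_def]
  by (rule symmetric_second_derivative[OF assms])+

lemma partials_on_cong:
  assumes "open M" "partials_on M g gx gy gz" "\<And>p. p \<in> M \<Longrightarrow> h p = g p"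
  shows "partials_on M h gx gy gz"
  unfolding partials_on_def
proof
  fix p assume p: "p \<in> M"
  show "(h has_derivative (\<lambda>v. fst v *\<^sub>R gx p + Re (snd v) *\<^sub>R gy p + Im (snd v) *\<^sub>R gz p)) (at p)"
    by (rule has_derivative_transform_within_open[OF partials_onD[OF assms(2) p] assms(1) p]) (simp add: assms(3))
qed

lemma partials_on_eqD:
  assumes "open M" "partials_on M g gx gy gz" "partials_on M h hx hy hz" "\<And>p. p \<in> M \<Longrightarrow> g p = h p" "p \<in> M"
  shows "gx p = hx p" "gy p = hy p" "gz p = hz p"
  using partials_on_unique[OF partials_on_cong[OF assms(1,3,4)] assms(5)] partials_on_unique[OF assms(2,5)] by simp_all

lemma partials_on_constant:
  assumes "open M" "connected M" "partials_on M g gx gy gz"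
    "\<And>p. p \<in> M \<Longrightarrow> gx p = 0" "\<And>p. p \<in> M \<Longrightarrow> gy p = 0" "\<And>p. p \<in> M \<Longrightarrow> gz p = 0"
  obtains c where "\<And>p. p \<in> M \<Longrightarrow> g p = c"
proof -
  have "(g has_derivative (\<lambda>_. 0)) (at p)" if "p \<in> M" for p
    using partials_onD[OF assms(3) that] assms(4-6)[OF that] by simp
  then have "g p = g (SOME q. q \<in> M)" if "p \<in> M" for p
    by (rule has_derivative_zero_unique_connected[OF assms(1,2)]) (use that in \<open>auto intro: someI\<close>)
  then show ?thesis by (rule that)
qed

lemma partials_const: "partials_on M (\<lambda>p. c) (\<lambda>p. 0) (\<lambda>p. 0) (\<lambda>p. 0)"
  unfolding partials_on_def by (auto intro!: derivative_eq_intros)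

lemma partials_add:
  "partials_on M g gx gy gz \<Longrightarrow> partials_on M h hx hy hz \<Longrightarrow>
   partials_on M (\<lambda>p. g p + h p) (\<lambda>p. gx p + hx p) (\<lambda>p. gy p + hy p) (\<lambda>p. gz p + hz p)"
  unfolding partials_on_def
  by (intro ballI, rule has_derivative_eq_rhs, rule has_derivative_add, erule (1) bspec, erule (1) bspec)
     (simp add: fun_eq_iff algebra_simps)

lemma partials_diff:
  "partials_on M g gx gy gz \<Longrightarrow> partials_on M h hx hy hz \<Longrightarrow>
   partials_on M (\<lambda>p. g p - h p) (\<lambda>p. gx p - hx p) (\<lambda>p. gy p - hy p) (\<lambda>p. gz p - hz p)"
  unfolding partials_on_def
  by (intro ballI, rule has_derivative_eq_rhs, rule has_derivative_diff, erule (1) bspec, erule (1) bspec)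
     (simp add: fun_eq_iff algebra_simps)

lemma partials_mult:
  "partials_on M g gx gy gz \<Longrightarrow> partials_on M h hx hy hz \<Longrightarrow>
   partials_on M (\<lambda>p. g p * h p) (\<lambda>p. g p * hx p + gx p * h p) (\<lambda>p. g p * hy p + gy p * h p) (\<lambda>p. g p * hz p + gz p * h p)"
  unfolding partials_on_def
  by (intro ballI, rule has_derivative_eq_rhs, rule has_derivative_mult, erule (1) bspec, erule (1) bspec)
     (simp add: fun_eq_iff algebra_simps)

lemma partials_u: "partials_on M (\<lambda>p. snd p) (\<lambda>p. 0) (\<lambda>p. 1) (\<lambda>p. \<i>)"
proof -
  have "(\<lambda>h. Re (snd h) *\<^sub>R 1 + Im (snd h) *\<^sub>R \<i>) = (snd :: cpoint \<Rightarrow> complex)"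
    by (auto simp: complex_eq_iff)
  then show ?thesis
    unfolding partials_on_def by (simp add: bounded_linear_imp_has_derivative bounded_linear_snd)
qed

lemma partials_re: "partials_on M (\<lambda>p. complex_of_real (Re (snd p))) (\<lambda>p. 0) (\<lambda>p. 1) (\<lambda>p. 0)"
proof -
  have "bounded_linear (\<lambda>p::cpoint. complex_of_real (Re (snd p)))"
    by (intro bounded_linear_compose[OF bounded_linear_of_real] bounded_linear_compose[OF bounded_linear_Re] bounded_linear_snd)
  from bounded_linear_imp_has_derivative[OF this] show ?thesis
    unfolding partials_on_def by (simp add: scaleR_conv_of_real)
qed

lemma partials_im: "partials_on M (\<lambda>p. complex_of_real (Im (snd p))) (\<lambda>p. 0) (\<lambda>p. 0) (\<lambda>p. 1)"
proof -
  have "bounded_linear (\<lambda>p::cpoint. complex_of_real (Im (snd p)))"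
    by (intro bounded_linear_compose[OF bounded_linear_of_real] bounded_linear_compose[OF bounded_linear_Im] bounded_linear_snd)
  from bounded_linear_imp_has_derivative[OF this] show ?thesis
    unfolding partials_on_def by (simp add: scaleR_conv_of_real)
qed

lemma partials_of_x:
  assumes "\<And>x. x \<in> fst ` M \<Longrightarrow> (f has_vector_derivative f' x) (at x)"
  shows "partials_on M (\<lambda>p. f (fst p)) (\<lambda>p. f' (fst p)) (\<lambda>p. 0) (\<lambda>p. 0)"
  unfolding partials_on_def
proof
  fix p assume "p \<in> M"
  then have "(f has_derivative (\<lambda>h. h *\<^sub>R f' (fst p))) (at (fst p))"
    using assms[of "fst p"] by (simp add: has_vector_derivative_def)
  from has_derivative_compose[OF has_derivative_fst[OF has_derivative_ident] this]
  show "((\<lambda>p. f (fst p)) has_derivative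
      (\<lambda>h. fst h *\<^sub>R f' (fst p) + Re (snd h) *\<^sub>R 0 + Im (snd h) *\<^sub>R 0)) (at p)" by simp
qed

lemma partials_x: "partials_on M (\<lambda>p. complex_of_real (fst p)) (\<lambda>p. 1) (\<lambda>p. 0) (\<lambda>p. 0)"
  using partials_of_x[of M complex_of_real "\<lambda>_. 1"] by (simp add: has_vector_derivative_of_real[where D = 1, simplified])

lemmas partials_intros = partials_const partials_add partials_diff partials_mult partials_u partials_re partials_im partials_x

lemma partials_curve:
  assumes "partials_on M g gx gy gz" "(x, f x) \<in> M" "(f has_vector_derivative v) (at x)"
  shows "((\<lambda>x. g (x, f x)) has_vector_derivative
     (gx (x, f x) + of_real (Re v) * gy (x, f x) + of_real (Im v) * gz (x, f x))) (at x)"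
  using curve_chain[OF partials_onD[OF assms(1,2)] assms(3)] by (simp add: scaleR_conv_of_real)

section \<open>The determining equations\<close>

context linear_equation
begin

definition beta' :: "real \<Rightarrow> real" where "beta' x = frechet_derivative \<beta> (at x) 1"

lemma beta_derivative: "x \<in> I \<Longrightarrow> (\<beta> has_real_derivative beta' x) (at x)"
proof -
  assume x: "x \<in> I"
  have D: "(\<beta> has_derivative frechet_derivative \<beta> (at x)) (at x)"
    by (rule smooth_on_has_derivative[OF open_I smooth_beta x])
  have "frechet_derivative \<beta> (at x) h = h * beta' x" for h
    using linear_cmul[OF has_derivative_linear[OF D], of h 1] by (simp add: beta'_def)
  then have "frechet_derivative \<beta> (at x) = (*) (beta' x)" by (auto simp: mult.commute)
  with D show ?thesis by (simp add: has_field_derivative_def)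
qed

lemma beta_vector_derivative: "x \<in> I \<Longrightarrow> ((\<lambda>x. complex_of_real (\<beta> x)) has_vector_derivative complex_of_real (beta' x)) (at x)"
  by (rule has_vector_derivative_of_real[OF beta_derivative])

text \<open>
  Both sides are the second derivative of the characteristic at \<open>x\<close>: the right-hand side because it is a solution, the
  left-hand side by the chain rule along a solution with the prescribed jet, whose second derivative is replaced by
  \<open>\<i> \<beta> u\<close>. Here \<open>p\<close> and \<open>q\<close> are the components of the first derivative, and \<open>a1\<close> and \<open>a2\<close> those of the
  second.
\<close>

lemma second_derivative_along_solution:
  assumes X: "curve_symmetry M S X"
    and \<xi>: "\<And>p. \<xi> p = complex_of_real (fst (X p))" and \<eta>: "\<And>p. \<eta> p = snd (X p)"
    and sm: "smooth_on M \<xi>" "smooth_on M \<eta>" and j: "(x, u, v) \<in> G"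
    and ab: "b = complex_of_real (\<beta> x)" "b' = complex_of_real (beta' x)"
      "a1 = complex_of_real (Re (\<i> * b * u))" "a2 = complex_of_real (Im (\<i> * b * u))"
    and pq: "p = complex_of_real (Re v)" "q = complex_of_real (Im v)" and P: "P = (x, u)"
  shows "(dx (dx \<eta>) P + p * dy (dx \<eta>) P + q * dz (dx \<eta>) P)
       + (p * (dx (dy \<eta>) P + p * dy (dy \<eta>) P + q * dz (dy \<eta>) P) + a1 * dy \<eta> P)
       + (q * (dx (dz \<eta>) P + p * dy (dz \<eta>) P + q * dz (dz \<eta>) P) + a2 * dz \<eta> P)
       - (\<xi> P * (\<i> * b * v + \<i> * b' * u) + (dx \<xi> P + p * dy \<xi> P + q * dz \<xi> P) * (\<i> * b * u)
          + ((dx \<xi> P + p * dy \<xi> P + q * dz \<xi> P) * (\<i> * b * u)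
             + ((dx (dx \<xi>) P + p * dy (dx \<xi>) P + q * dz (dx \<xi>) P)
               + (p * (dx (dy \<xi>) P + p * dy (dy \<xi>) P + q * dz (dy \<xi>) P) + a1 * dy \<xi> P)
               + (q * (dx (dz \<xi>) P + p * dy (dz \<xi>) P + q * dz (dz \<xi>) P) + a2 * dz \<xi> P)) * v))
       = \<i> * b * (\<eta> P - \<xi> P * v)"
proof -
  obtain J f f' where J: "open_interval J" "x \<in> J" "J \<subseteq> I" and f0: "f x = u" "f' x = v" and f: "solves \<beta> J f f'"
    and jets: "\<And>x. x \<in> J \<Longrightarrow> (x, f x, f' x) \<in> G"
    using solution_through[OF j] by blast
  obtain J0 Q' where J0: "open_interval J0" "x \<in> J0" "J0 \<subseteq> J"
    and Q': "solves \<beta> J0 (\<lambda>x. snd (X (x, f x)) - fst (X (x, f x)) *\<^sub>R f' x) Q'"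
    using characteristic_solves[OF X J(1) f jets J(2)] by blast
  have Qeq: "(\<lambda>x. snd (X (x, f x)) - fst (X (x, f x)) *\<^sub>R f' x) = (\<lambda>x. \<eta> (x, f x) - \<xi> (x, f x) * f' x)"
    by (simp add: \<xi> \<eta> scaleR_conv_of_real)
  note Q = Q'[unfolded Qeq]
  have inM: "(s, f s) \<in> M" if "s \<in> J" for s using jets[OF that] G_base by blast
  note part = partials_curve[OF smooth_partials[OF open_M]]
  define re im where "re = (\<lambda>s. complex_of_real (Re (f' s)))" and "im = (\<lambda>s. complex_of_real (Im (f' s)))"
  define along where "along g s = dx g (s, f s) + re s * dy g (s, f s) + im s * dz g (s, f s)" for g s
  have along: "((\<lambda>s. g (s, f s)) has_vector_derivative along g s) (at s)" if "smooth_on M g" "s \<in> J" for g s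
    using part[OF that(1) inM[OF that(2)] solvesD(1)[OF f that(2)]] by (simp add: along_def re_def im_def)
  let ?b = "\<lambda>s. complex_of_real (\<beta> s)"
  define Q1 where "Q1 s = along \<eta> s - (\<xi> (s, f s) * (\<i> * ?b s * f s) + along \<xi> s * f' s)" for s
  have d1: "((\<lambda>x. \<eta> (x, f x) - \<xi> (x, f x) * f' x) has_vector_derivative Q1 s) (at s)" if "s \<in> J" for s
    unfolding Q1_def
    by (intro has_vector_derivative_diff has_vector_derivative_mult along sm that solvesD[OF f])
  have Q1: "Q' s = Q1 s" if "s \<in> J0" for s
    using vector_derivative_unique_at[OF solvesD(1)[OF Q that] d1] J0 that by blast
  have d2: "(Q1 has_vector_derivative \<i> * ?b x * (\<eta> (x, f x) - \<xi> (x, f x) * f' x)) (at x)"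
    by (rule has_vector_derivative_transform_within_open[OF solvesD(2)[OF Q J0(2)] _ J0(2) Q1])
       (use J0(1) in \<open>auto simp: open_interval_def\<close>)
  have re: "(re has_vector_derivative a1) (at x)" and im: "(im has_vector_derivative a2) (at x)"
    unfolding re_def im_def ab(3,4) ab(1)
    using bounded_linear.has_vector_derivative[OF bounded_linear_compose[OF bounded_linear_of_real bounded_linear_Re] solvesD(2)[OF f J(2)]]
      bounded_linear.has_vector_derivative[OF bounded_linear_compose[OF bounded_linear_of_real bounded_linear_Im] solvesD(2)[OF f J(2)]]
    by (simp_all add: f0)
  have d_along: "((\<lambda>s. along g s) has_vector_derivative (along (dx g) x + (re x * along (dy g) x + a1 * dy g (x, f x))
      + (im x * along (dz g) x + a2 * dz g (x, f x)))) (at x)" if "smooth_on M g" for g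
    unfolding along_def[of g]
    by (intro has_vector_derivative_add has_vector_derivative_mult re im along smooth_dx smooth_dy smooth_dz that J(2))
  have db: "((\<lambda>s. \<i> * ?b s * f s) has_vector_derivative (\<i> * ?b x * f' x + \<i> * complex_of_real (beta' x) * f x)) (at x)"
    by (intro has_vector_derivative_mult has_vector_derivative_mult_right beta_vector_derivative solvesD[OF f]) (use J in auto)
  have d2': "(Q1 has_vector_derivative
      (along (dx \<eta>) x + (re x * along (dy \<eta>) x + a1 * dy \<eta> (x, f x)) + (im x * along (dz \<eta>) x + a2 * dz \<eta> (x, f x)))
      - ((\<xi> (x, f x) * (\<i> * ?b x * f' x + \<i> * complex_of_real (beta' x) * f x) + along \<xi> x * (\<i> * ?b x * f x))
        + (along \<xi> x * (\<i> * ?b x * f x)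
          + (along (dx \<xi>) x + (re x * along (dy \<xi>) x + a1 * dy \<xi> (x, f x)) + (im x * along (dz \<xi>) x + a2 * dz \<xi> (x, f x))) * f' x))) (at x)"
    unfolding Q1_def[abs_def]
    by (intro has_vector_derivative_diff has_vector_derivative_add has_vector_derivative_mult d_along along db sm solvesD[OF f] J(2))
  show ?thesis
    using vector_derivative_unique_at[OF d2' d2]
    unfolding along_def re_def im_def f0 ab(1,2) pq P by (simp add: add.assoc)
qed

text \<open>
  Sorting the preceding identity by powers of \<open>p\<close> and \<open>q\<close>. The jets over a fixed point fill an open set of
  \<open>(p, q)\<close>, so every coefficient is zero. The equations come in the order of degree three, two, one, zero.
\<close>

lemma determining_equations:
  assumes X: "curve_symmetry M S X"
    and \<xi>: "\<And>p. \<xi> p = complex_of_real (fst (X p))" and \<eta>: "\<And>p. \<eta> p = snd (X p)"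
    and sm: "smooth_on M \<xi>" "smooth_on M \<eta>" and P: "P \<in> M"
    and ab: "u = snd P" "b = complex_of_real (\<beta> (fst P))" "b' = complex_of_real (beta' (fst P))"
      "a1 = - (b * complex_of_real (Im u))" "a2 = b * complex_of_real (Re u)"
  shows "dy (dy \<xi>) P = 0" "dz (dy \<xi>) P = 0" "dz (dz \<xi>) P = 0"
    "dy (dy \<eta>) P = 2 * dy (dx \<xi>) P" "dz (dy \<eta>) P = dz (dx \<xi>) P + \<i> * dy (dx \<xi>) P" "dz (dz \<eta>) P = 2 * \<i> * dz (dx \<xi>) P"
    "2 * dy (dx \<eta>) P = 2 * \<i> * b * u * dy \<xi> P + (dx (dx \<xi>) P + a1 * dy \<xi> P + a2 * dz \<xi> P)"
    "2 * dz (dx \<eta>) P = 2 * \<i> * b * u * dz \<xi> P + \<i> * (dx (dx \<xi>) P + a1 * dy \<xi> P + a2 * dz \<xi> P)"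
    "dx (dx \<eta>) P + a1 * dy \<eta> P + a2 * dz \<eta> P - \<i> * b' * u * \<xi> P - 2 * \<i> * b * u * dx \<xi> P - \<i> * b * \<eta> P = 0"
proof -
  define x where "x = fst P"
  have Pxu: "P = (x, u)" by (simp add: x_def ab(1))
  obtain v0 where v0: "(x, u, v0) \<in> G" using P by (auto simp: Pxu cbase_def)
  obtain e where e: "e > 0" "ball (x, u, v0) e \<subseteq> G" using v0 open_G by (meson openE)
  have inG: "(x, u, Complex p q) \<in> G" if "\<bar>p - Re v0\<bar> < e / 2" "\<bar>q - Im v0\<bar> < e / 2" for p q
  proof -
    have "dist (x, u, v0) (x, u, Complex p q) = norm (v0 - Complex p q)" by (simp add: dist_Pair_Pair dist_norm)
    also have "\<dots> \<le> \<bar>Re (v0 - Complex p q)\<bar> + \<bar>Im (v0 - Complex p q)\<bar>" by (rule cmod_le)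
    also have "\<dots> < e" using that by (simp add: abs_minus_commute)
    finally show ?thesis using e(2) by auto
  qed
  have comm: "dx (dy \<xi>) P = dy (dx \<xi>) P" "dx (dz \<xi>) P = dz (dx \<xi>) P" "dy (dz \<xi>) P = dz (dy \<xi>) P"
    "dx (dy \<eta>) P = dy (dx \<eta>) P" "dx (dz \<eta>) P = dz (dx \<eta>) P" "dy (dz \<eta>) P = dz (dy \<eta>) P"
    using partials_commute[OF open_M sm(1) P] partials_commute[OF open_M sm(2) P] by auto
  have a12: "a1 = complex_of_real (Re (\<i> * b * u))" "a2 = complex_of_real (Im (\<i> * b * u))"
    by (simp_all add: ab(2,4,5))
  have poly: "(dx (dx \<eta>) P + a1 * dy \<eta> P + a2 * dz \<eta> P - \<i> * b' * u * \<xi> P - 2 * \<i> * b * u * dx \<xi> P - \<i> * b * \<eta> P)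
     + (2 * dy (dx \<eta>) P - (2 * \<i> * b * u * dy \<xi> P + (dx (dx \<xi>) P + a1 * dy \<xi> P + a2 * dz \<xi> P))) * p
     + (2 * dz (dx \<eta>) P - (2 * \<i> * b * u * dz \<xi> P + \<i> * (dx (dx \<xi>) P + a1 * dy \<xi> P + a2 * dz \<xi> P))) * q
     + (dy (dy \<eta>) P - 2 * dy (dx \<xi>) P) * p^2
     + (2 * dz (dy \<eta>) P - 2 * (dz (dx \<xi>) P + \<i> * dy (dx \<xi>) P)) * p * q
     + (dz (dz \<eta>) P - 2 * \<i> * dz (dx \<xi>) P) * q^2
     + (- dy (dy \<xi>) P) * p^3
     + (- 2 * dz (dy \<xi>) P - \<i> * dy (dy \<xi>) P) * p^2 * q
     + (- dz (dz \<xi>) P - 2 * \<i> * dz (dy \<xi>) P) * p * q^2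
     + (- \<i> * dz (dz \<xi>) P) * q^3 = 0"
    if "\<bar>p - Re v0\<bar> < e / 2" "\<bar>q - Im v0\<bar> < e / 2" for p q :: real
  proof -
    have v: "Complex p q = complex_of_real p + \<i> * complex_of_real q" by (simp add: complex_eq_iff)
    show ?thesis
      using second_derivative_along_solution[OF X \<xi> \<eta> sm inG[OF that] ab(2)[folded x_def] ab(3)[folded x_def] a12 refl refl Pxu]
      unfolding comm v by (simp add: algebra_simps power2_eq_square power3_eq_cube)
  qed
  have "e / 2 > 0" using e by simp
  note z = cubic_vanishing_real2[of "e / 2" "Re v0" "Im v0", OF this poly]
  show "dx (dx \<eta>) P + a1 * dy \<eta> P + a2 * dz \<eta> P - \<i> * b' * u * \<xi> P - 2 * \<i> * b * u * dx \<xi> P - \<i> * b * \<eta> P = 0"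
    by (rule z(1))
  show "2 * dy (dx \<eta>) P = 2 * \<i> * b * u * dy \<xi> P + (dx (dx \<xi>) P + a1 * dy \<xi> P + a2 * dz \<xi> P)"
    using z(2) by simp
  show "2 * dz (dx \<eta>) P = 2 * \<i> * b * u * dz \<xi> P + \<i> * (dx (dx \<xi>) P + a1 * dy \<xi> P + a2 * dz \<xi> P)"
    using z(3) by simp
  show "dy (dy \<eta>) P = 2 * dy (dx \<xi>) P" using z(4) by simp
  show "dz (dy \<eta>) P = dz (dx \<xi>) P + \<i> * dy (dx \<xi>) P"
  proof -
    have "2 * (dz (dy \<eta>) P - (dz (dx \<xi>) P + \<i> * dy (dx \<xi>) P)) = 0"
      using z(5) by (simp only: right_diff_distrib)
    from this[unfolded mult_eq_0_iff] show ?thesis by simp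
  qed
  show "dz (dz \<eta>) P = 2 * \<i> * dz (dx \<xi>) P" using z(6) by simp
  show yy: "dy (dy \<xi>) P = 0" using z(7) by simp
  show "dz (dy \<xi>) P = 0" using z(8) yy by simp
  show "dz (dz \<xi>) P = 0" using z(10) by simp
qed

end

section \<open>The form of the symmetries\<close>

lemma partials_cong_unique:
  assumes "open M" "smooth_on M f" "\<And>p. p \<in> M \<Longrightarrow> f p = g p" "p \<in> M"
  shows "dx f p = dx g p" "dy f p = dy g p" "dz f p = dz g p"
  using partials_on_unique[OF partials_on_cong[OF assms(1) smooth_partials[OF assms(1,2)] assms(3)[symmetric]] assms(4)]
  by simp_all

text \<open>
  Third derivatives brought into the order in which \<open>dx\<close> is applied last, the normal form for the
  computations below.
\<close>

lemma third_partials: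
  assumes "open M" "smooth_on M g" "p \<in> M"
  shows "dy (dx (dx g)) p = dx (dy (dx g)) p" "dz (dx (dx g)) p = dx (dz (dx g)) p"
    "dy (dy (dx g)) p = dx (dy (dy g)) p" "dz (dz (dx g)) p = dx (dz (dz g)) p"
    "dz (dy (dx g)) p = dx (dz (dy g)) p" "dy (dz (dx g)) p = dx (dz (dy g)) p"
proof -
  note sm = assms(2) smooth_dx[OF assms(2)] smooth_dy[OF assms(2)] smooth_dz[OF assms(2)]
  note c = partials_commute[OF assms(1)]
  note cc = partials_cong_unique[OF assms(1)]
  show "dy (dx (dx g)) p = dx (dy (dx g)) p" "dz (dx (dx g)) p = dx (dz (dx g)) p"
    using c[OF sm(2) assms(3)] by simp_all
  have 1: "dy (dy (dx g)) p = dy (dx (dy g)) p"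
    by (rule cc(2)[OF smooth_dy[OF sm(2)] _ assms(3)]) (rule c(1)[OF assms(2), symmetric])
  then show "dy (dy (dx g)) p = dx (dy (dy g)) p" using c(1)[OF sm(3) assms(3)] by simp
  have 2: "dz (dz (dx g)) p = dz (dx (dz g)) p"
    by (rule cc(3)[OF smooth_dz[OF sm(2)] _ assms(3)]) (rule c(2)[OF assms(2), symmetric])
  then show "dz (dz (dx g)) p = dx (dz (dz g)) p" using c(2)[OF sm(4) assms(3)] by simp
  have 3: "dz (dy (dx g)) p = dz (dx (dy g)) p"
    by (rule cc(3)[OF smooth_dy[OF sm(2)] _ assms(3)]) (rule c(1)[OF assms(2), symmetric])
  then show 4: "dz (dy (dx g)) p = dx (dz (dy g)) p" using c(2)[OF sm(3) assms(3)] by simp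
  show "dy (dz (dx g)) p = dx (dz (dy g)) p" using c(3)[OF sm(2) assms(3)] 4 by simp
qed

text \<open>
  The field component \<open>\<xi>\<close> is real but is treated as a complex-valued function. The equations separate into real and imaginary
  parts because its derivatives are real.
\<close>

lemma partials_real:
  assumes "open M" "smooth_on M g" "\<And>p. p \<in> M \<Longrightarrow> Im (g p) = 0" "p \<in> M"
  shows "Im (dx g p) = 0" "Im (dy g p) = 0" "Im (dz g p) = 0"
proof -
  have "((\<lambda>p. Im (g p)) has_derivative (\<lambda>h. Im (fst h *\<^sub>R dx g p + Re (snd h) *\<^sub>R dy g p + Im (snd h) *\<^sub>R dz g p))) (at p)"
    by (rule bounded_linear.has_derivative[OF bounded_linear_Im partials_onD[OF smooth_partials[OF assms(1,2)] assms(4)]])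
  moreover have "((\<lambda>p. Im (g p)) has_derivative (\<lambda>h. 0)) (at p)"
    by (rule has_derivative_transform_within_open[OF has_derivative_const assms(1,4)]) (simp add: assms(3))
  ultimately have eq: "(\<lambda>h. Im (fst h *\<^sub>R dx g p + Re (snd h) *\<^sub>R dy g p + Im (snd h) *\<^sub>R dz g p)) = (\<lambda>h. 0)"
    by (rule has_derivative_unique)
  show "Im (dx g p) = 0" "Im (dy g p) = 0" "Im (dz g p) = 0"
    using fun_cong[OF eq, of "(1, 0)"] fun_cong[OF eq, of "(0, 1)"] fun_cong[OF eq, of "(0, \<i>)"] by simp_all
qed

lemma partials_match:
  assumes "open M" "connected M" "partials_on M g gx gy gz" "partials_on M h hx hy hz"
    "\<And>p. p \<in> M \<Longrightarrow> gx p = hx p \<and> gy p = hy p \<and> gz p = hz p"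
  obtains c where "\<And>p. p \<in> M \<Longrightarrow> g p = h p + c"
proof -
  obtain c where "\<And>p. p \<in> M \<Longrightarrow> g p - h p = c"
    by (rule partials_on_constant[OF assms(1,2) partials_diff[OF assms(3,4)]]) (use assms(5) in auto)
  then show ?thesis using that by (metis add.commute diff_add_cancel)
qed

lemma partials_on_eq_rhs:
  assumes "partials_on M g gx gy gz" "\<And>p. p \<in> M \<Longrightarrow> gx p = hx p" "\<And>p. p \<in> M \<Longrightarrow> gy p = hy p" "\<And>p. p \<in> M \<Longrightarrow> gz p = hz p"
  shows "partials_on M g hx hy hz"
  using assms unfolding partials_on_def by simp

text \<open>
  In homogeneous coordinates \<open>(X, U, T)\<close> on \<open>\<real> \<times> \<complex> \<times> \<real>\<close>, with \<open>x = X/T\<close> and \<open>u = U/T\<close>, these are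
  the linear vector fields. Of their 16 parameters one is redundant, because multiples of the identity act trivially.
\<close>

definition projective_field ::
  "real \<times> real \<times> real \<times> complex \<times> complex \<times> complex \<times> complex \<times> complex \<times> complex \<Rightarrow> cpoint \<Rightarrow> cpoint" where
  "projective_field = (\<lambda>(k0, k1, k2, \<mu>, \<nu>, c1, c2, d0, d1) (x, u).
     (k0 + k1 * x + k2 * x\<^sup>2 + (\<mu> + x *\<^sub>R \<nu>) \<bullet> u,
      (k2 * x + \<nu> \<bullet> u) *\<^sub>R u + Re u *\<^sub>R c1 + Im u *\<^sub>R c2 + d0 + x *\<^sub>R d1))"

context linear_equation
begin

lemma smooth_beta': "smooth_on I beta'"
  unfolding beta'_def[abs_def] by (rule smooth_on_frechet_derivative[OF smooth_beta])

lemma smooth_beta'_vertical: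
  assumes "p \<in> M"
  shows "dy (\<lambda>p. complex_of_real (beta' (fst p))) p = 0" "dz (\<lambda>p. complex_of_real (beta' (fst p))) p = 0"
proof -
  have D: "((\<lambda>x. complex_of_real (beta' x)) has_vector_derivative
      frechet_derivative (\<lambda>x. complex_of_real (beta' x)) (at x) 1) (at x)" if "x \<in> I" for x
  proof -
    have F: "((\<lambda>x. complex_of_real (beta' x)) has_derivative frechet_derivative (\<lambda>x. complex_of_real (beta' x)) (at x)) (at x)"
      by (rule smooth_on_has_derivative[OF open_I smooth_on_of_real[OF open_I smooth_beta'] that])
    have "frechet_derivative (\<lambda>x. complex_of_real (beta' x)) (at x) =
        (\<lambda>h. h *\<^sub>R frechet_derivative (\<lambda>x. complex_of_real (beta' x)) (at x) 1)"
    proof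
      fix h
      show "frechet_derivative (\<lambda>x. complex_of_real (beta' x)) (at x) h =
          h *\<^sub>R frechet_derivative (\<lambda>x. complex_of_real (beta' x)) (at x) 1"
        using linear_cmul[OF has_derivative_linear[OF F], of h 1] by simp
    qed
    with F show ?thesis unfolding has_vector_derivative_def by simp
  qed
  show "dy (\<lambda>p. complex_of_real (beta' (fst p))) p = 0" "dz (\<lambda>p. complex_of_real (beta' (fst p))) p = 0"
    by (rule partials_on_unique[OF partials_of_x[OF D] assms]; assumption)+
qed

context
  fixes X :: "cpoint \<Rightarrow> cpoint" and \<xi> \<eta> :: "cpoint \<Rightarrow> complex"
  assumes X: "curve_symmetry M S X" and smooth_X: "smooth_on M X"
  defines "\<xi> \<equiv> \<lambda>p. complex_of_real (fst (X p))" and "\<eta> \<equiv> \<lambda>p. snd (X p)"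
begin

lemma smooth_xi: "smooth_on M \<xi>"
  unfolding \<xi>_def by (intro smooth_on_of_real smooth_on_fst smooth_X open_M)

lemma smooth_eta: "smooth_on M \<eta>"
  unfolding \<eta>_def by (intro smooth_on_snd smooth_X open_M)

lemmas smooth_all = smooth_xi smooth_eta smooth_dx smooth_dy smooth_dz

lemmas partials_all = smooth_partials[OF open_M smooth_xi] smooth_partials[OF open_M smooth_eta]
  smooth_partials[OF open_M smooth_dx[OF smooth_xi]] smooth_partials[OF open_M smooth_dx[OF smooth_eta]]
  smooth_partials[OF open_M smooth_dy[OF smooth_xi]] smooth_partials[OF open_M smooth_dy[OF smooth_eta]]
  smooth_partials[OF open_M smooth_dz[OF smooth_xi]] smooth_partials[OF open_M smooth_dz[OF smooth_eta]]
  smooth_partials[OF open_M smooth_dx[OF smooth_dx[OF smooth_xi]]] smooth_partials[OF open_M smooth_dx[OF smooth_dx[OF smooth_eta]]]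
  smooth_partials[OF open_M smooth_dy[OF smooth_dx[OF smooth_xi]]] smooth_partials[OF open_M smooth_dy[OF smooth_dx[OF smooth_eta]]]
  smooth_partials[OF open_M smooth_dz[OF smooth_dx[OF smooth_xi]]] smooth_partials[OF open_M smooth_dz[OF smooth_dx[OF smooth_eta]]]

lemma xi_real: "Im (\<xi> p) = 0" by (simp add: \<xi>_def)

lemma xi_partials_real:
  assumes "p \<in> M"
  shows "Im (dx \<xi> p) = 0" "Im (dy \<xi> p) = 0" "Im (dz \<xi> p) = 0"
    "Im (dx (dx \<xi>) p) = 0" "Im (dy (dx \<xi>) p) = 0" "Im (dz (dx \<xi>) p) = 0"
    "Im (dx (dx (dx \<xi>)) p) = 0" "Im (dx (dy (dx \<xi>)) p) = 0" "Im (dx (dz (dx \<xi>)) p) = 0"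
proof -
  note r = partials_real[OF open_M]
  have 1: "Im (dx \<xi> q) = 0" "Im (dy \<xi> q) = 0" "Im (dz \<xi> q) = 0" if "q \<in> M" for q
    by (rule r[OF smooth_xi xi_real that])+
  have 2: "Im (dx (dx \<xi>) q) = 0" "Im (dy (dx \<xi>) q) = 0" "Im (dz (dx \<xi>) q) = 0" if "q \<in> M" for q
    by (rule r[OF smooth_dx[OF smooth_xi] 1(1) that]; assumption)+
  have 3: "Im (dx (dx (dx \<xi>)) q) = 0" "Im (dx (dy (dx \<xi>)) q) = 0" "Im (dx (dz (dx \<xi>)) q) = 0" if "q \<in> M" for q
    by (rule r(1)[OF smooth_dx[OF smooth_dx[OF smooth_xi]] 2(1) that] r(1)[OF smooth_dy[OF smooth_dx[OF smooth_xi]] 2(2) that]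
        r(1)[OF smooth_dz[OF smooth_dx[OF smooth_xi]] 2(3) that]; assumption)+
  show "Im (dx \<xi> p) = 0" "Im (dy \<xi> p) = 0" "Im (dz \<xi> p) = 0"
    "Im (dx (dx \<xi>) p) = 0" "Im (dy (dx \<xi>) p) = 0" "Im (dz (dx \<xi>) p) = 0"
    "Im (dx (dx (dx \<xi>)) p) = 0" "Im (dx (dy (dx \<xi>)) p) = 0" "Im (dx (dz (dx \<xi>)) p) = 0"
    using 1[OF assms] 2[OF assms] 3[OF assms] by simp_all
qed

lemma determining:
  assumes "p \<in> M"
  shows "dy (dy \<xi>) p = 0" "dz (dy \<xi>) p = 0" "dz (dz \<xi>) p = 0"
    "dy (dy \<eta>) p = 2 * dy (dx \<xi>) p" "dz (dy \<eta>) p = dz (dx \<xi>) p + \<i> * dy (dx \<xi>) p" "dz (dz \<eta>) p = 2 * \<i> * dz (dx \<xi>) p"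
    "2 * dy (dx \<eta>) p = 2 * \<i> * \<beta> (fst p) * snd p * dy \<xi> p
       + (dx (dx \<xi>) p - complex_of_real (\<beta> (fst p)) * complex_of_real (Im (snd p)) * dy \<xi> p + complex_of_real (\<beta> (fst p)) * complex_of_real (Re (snd p)) * dz \<xi> p)"
    "2 * dz (dx \<eta>) p = 2 * \<i> * \<beta> (fst p) * snd p * dz \<xi> p
       + \<i> * (dx (dx \<xi>) p - complex_of_real (\<beta> (fst p)) * complex_of_real (Im (snd p)) * dy \<xi> p + complex_of_real (\<beta> (fst p)) * complex_of_real (Re (snd p)) * dz \<xi> p)"
    "dx (dx \<eta>) p - complex_of_real (\<beta> (fst p)) * complex_of_real (Im (snd p)) * dy \<eta> p + complex_of_real (\<beta> (fst p)) * complex_of_real (Re (snd p)) * dz \<eta> p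
       - \<i> * beta' (fst p) * snd p * \<xi> p - 2 * \<i> * \<beta> (fst p) * snd p * dx \<xi> p - \<i> * \<beta> (fst p) * \<eta> p = 0"
  using determining_equations[OF X _ _ smooth_xi smooth_eta assms refl refl refl refl refl]
  by (simp_all add: \<xi>_def \<eta>_def)

lemma partials_beta: "partials_on M (\<lambda>p. complex_of_real (\<beta> (fst p))) (\<lambda>p. complex_of_real (beta' (fst p))) (\<lambda>p. 0) (\<lambda>p. 0)"
  by (rule partials_of_x) (rule beta_vector_derivative)

text \<open>
  Differentiate the two equations of degree one with respect to \<open>y\<close> and \<open>z\<close> respectively, and eliminate the third
  derivatives of \<open>\<eta>\<close> by means of the equations of degree two. What remains involves \<open>\<xi>\<close> alone, and taking
  real and imaginary parts separates the terms with \<open>\<beta>\<close> from the others.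
\<close>

lemma mixed_third:
  assumes p: "p \<in> M"
  shows "complex_of_real (\<beta> (fst p)) * dy \<xi> p = 0" "complex_of_real (\<beta> (fst p)) * dz \<xi> p = 0"
    "dx (dy (dx \<xi>)) p = 0" "dx (dz (dx \<xi>)) p = 0"
proof -
  define m n where "m = dx (dy (dx \<xi>)) p" and "n = dx (dz (dx \<xi>)) p"
  let ?b = "complex_of_real (\<beta> (fst p))"
  have l1: "dy (dy (dx \<eta>)) p = 2 * m"
  proof -
    have "dx (dy (dy \<eta>)) p = dx (\<lambda>p. 2 * dy (dx \<xi>) p) p"
      by (rule partials_cong_unique(1)[OF open_M _ determining(4) p]) (intro smooth_all)
    also have "\<dots> = 2 * m"
      by (rule trans, rule partials_on_unique(1)[OF _ p], (rule partials_intros partials_all)+) (simp add: m_def)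
    finally show ?thesis using third_partials(3)[OF open_M smooth_eta p] by simp
  qed
  have l2: "dz (dz (dx \<eta>)) p = 2 * \<i> * n"
  proof -
    have "dx (dz (dz \<eta>)) p = dx (\<lambda>p. 2 * \<i> * dz (dx \<xi>) p) p"
      by (rule partials_cong_unique(1)[OF open_M _ determining(6) p]) (intro smooth_all)
    also have "\<dots> = 2 * \<i> * n"
      by (rule trans, rule partials_on_unique(1)[OF _ p], (rule partials_intros partials_all)+) (simp add: n_def)
    finally show ?thesis using third_partials(4)[OF open_M smooth_eta p] by simp
  qed
  have s2: "smooth_on M (\<lambda>p. 2 * g p)" if "smooth_on M g" for g :: "cpoint \<Rightarrow> complex"
    by (intro smooth_on_mult smooth_on_const open_M that)
  have A: "dy (\<lambda>p. 2 * dy (dx \<eta>) p) p = dy (\<lambda>p. 2 * \<i> * \<beta> (fst p) * snd p * dy \<xi> p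
       + (dx (dx \<xi>) p - complex_of_real (\<beta> (fst p)) * complex_of_real (Im (snd p)) * dy \<xi> p + complex_of_real (\<beta> (fst p)) * complex_of_real (Re (snd p)) * dz \<xi> p)) p"
    by (rule partials_cong_unique(2)[OF open_M s2 determining(7) p]) (intro smooth_all)
  have B: "dy (\<lambda>p. 2 * dy (dx \<eta>) p) p = 4 * m"
    by (rule trans, rule partials_on_unique(2)[OF _ p], (rule partials_intros partials_all)+) (simp add: l1)
  have C: "dy (\<lambda>p. 2 * \<i> * \<beta> (fst p) * snd p * dy \<xi> p
       + (dx (dx \<xi>) p - complex_of_real (\<beta> (fst p)) * complex_of_real (Im (snd p)) * dy \<xi> p + complex_of_real (\<beta> (fst p)) * complex_of_real (Re (snd p)) * dz \<xi> p)) p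
     = 2 * \<i> * ?b * dy \<xi> p + m + ?b * dz \<xi> p"
    by (rule trans, rule partials_on_unique(2)[OF _ p], (rule partials_intros partials_all partials_beta)+)
       (simp add: determining[OF p] partials_commute(3)[OF open_M smooth_xi p] third_partials[OF open_M smooth_xi p] m_def)
  have e1: "3 * m = ?b * dz \<xi> p + \<i> * (2 * ?b * dy \<xi> p)"
    using trans[OF trans[OF B[symmetric] A] C] by (simp add: algebra_simps)
  have A': "dz (\<lambda>p. 2 * dz (dx \<eta>) p) p = dz (\<lambda>p. 2 * \<i> * \<beta> (fst p) * snd p * dz \<xi> p
       + \<i> * (dx (dx \<xi>) p - complex_of_real (\<beta> (fst p)) * complex_of_real (Im (snd p)) * dy \<xi> p + complex_of_real (\<beta> (fst p)) * complex_of_real (Re (snd p)) * dz \<xi> p)) p"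
    by (rule partials_cong_unique(3)[OF open_M s2 determining(8) p]) (intro smooth_all)
  have B': "dz (\<lambda>p. 2 * dz (dx \<eta>) p) p = 4 * \<i> * n"
    by (rule trans, rule partials_on_unique(3)[OF _ p], (rule partials_intros partials_all)+) (simp add: l2)
  have C': "dz (\<lambda>p. 2 * \<i> * \<beta> (fst p) * snd p * dz \<xi> p
       + \<i> * (dx (dx \<xi>) p - complex_of_real (\<beta> (fst p)) * complex_of_real (Im (snd p)) * dy \<xi> p + complex_of_real (\<beta> (fst p)) * complex_of_real (Re (snd p)) * dz \<xi> p)) p
     = - 2 * ?b * dz \<xi> p + \<i> * (n - ?b * dy \<xi> p)"
    by (rule trans, rule partials_on_unique(3)[OF _ p], (rule partials_intros partials_all partials_beta)+)
       (simp add: determining[OF p] third_partials[OF open_M smooth_xi p] n_def algebra_simps)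
  have e2: "\<i> * (3 * n) = - 2 * ?b * dz \<xi> p - \<i> * (?b * dy \<xi> p)"
    using trans[OF trans[OF B'[symmetric] A'] C'] by (simp add: algebra_simps eq_neg_iff_add_eq_0)
  note re = xi_partials_real[OF p, folded m_def n_def]
  have y: "\<beta> (fst p) * Re (dy \<xi> p) = 0" using arg_cong[OF e1, of Im] re by simp
  have z: "\<beta> (fst p) * Re (dz \<xi> p) = 0" using arg_cong[OF e2, of Re] re by simp
  show Y: "?b * dy \<xi> p = 0" using y re by (auto simp: complex_eq_iff)
  show Z: "?b * dz \<xi> p = 0" using z re by (auto simp: complex_eq_iff)
  show "dx (dy (dx \<xi>)) p = 0" using e1 Y Z unfolding m_def by (simp add: mult.assoc)
  show "dx (dz (dx \<xi>)) p = 0" using e2 Y Z unfolding n_def by (simp add: mult.assoc)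
qed

text \<open>
  By the equations of degree three and \<open>mixed_third\<close> the functions \<open>dy (dx \<xi>)\<close> and \<open>dz (dx \<xi>)\<close> have zero
  derivative, and the remaining integrations are trivial.
\<close>

lemma vertical_derivatives_of_xi:
  obtains m n s t :: real where
    "\<And>p. p \<in> M \<Longrightarrow> dy (dx \<xi>) p = m" "\<And>p. p \<in> M \<Longrightarrow> dz (dx \<xi>) p = n"
    "\<And>p. p \<in> M \<Longrightarrow> dy \<xi> p = s + m * fst p" "\<And>p. p \<in> M \<Longrightarrow> dz \<xi> p = t + n * fst p"
proof -
  obtain p0 where p0: "p0 \<in> M" using nonempty_G by (auto simp: cbase_def)
  have z: "dx (dy (dy \<xi>)) p = 0" "dx (dz (dy \<xi>)) p = 0" "dx (dz (dz \<xi>)) p = 0" if "p \<in> M" for p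
  proof -
    have z0: "dx (\<lambda>_. 0) p = 0" by (rule partials_on_unique(1)[OF partials_const that])
    show "dx (dy (dy \<xi>)) p = 0" "dx (dz (dy \<xi>)) p = 0" "dx (dz (dz \<xi>)) p = 0"
      using partials_cong_unique(1)[OF open_M smooth_dy[OF smooth_dy[OF smooth_xi]] determining(1) that]
        partials_cong_unique(1)[OF open_M smooth_dz[OF smooth_dy[OF smooth_xi]] determining(2) that]
        partials_cong_unique(1)[OF open_M smooth_dz[OF smooth_dz[OF smooth_xi]] determining(3) that] z0 by simp_all
  qed
  obtain m where m: "\<And>p. p \<in> M \<Longrightarrow> dy (dx \<xi>) p = m"
    by (rule partials_on_constant[OF open_M connected_M smooth_partials[OF open_M smooth_dy[OF smooth_dx[OF smooth_xi]]]])
       (auto simp: mixed_third third_partials[OF open_M smooth_xi] z)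
  obtain n where n: "\<And>p. p \<in> M \<Longrightarrow> dz (dx \<xi>) p = n"
    by (rule partials_on_constant[OF open_M connected_M smooth_partials[OF open_M smooth_dz[OF smooth_dx[OF smooth_xi]]]])
       (auto simp: mixed_third third_partials[OF open_M smooth_xi] z)
  have mn: "m = complex_of_real (Re m)" "n = complex_of_real (Re n)"
    using xi_partials_real(5,6)[OF p0] m[OF p0] n[OF p0] by (simp_all add: complex_eq_iff)
  have px: "partials_on M (\<lambda>p. c * complex_of_real (fst p)) (\<lambda>p. c) (\<lambda>p. 0) (\<lambda>p. 0)" for c
    using partials_mult[OF partials_const[of _ c] partials_x] by simp
  obtain s where s: "\<And>p. p \<in> M \<Longrightarrow> dy \<xi> p = m * complex_of_real (fst p) + s"
    by (rule partials_match[OF open_M connected_M smooth_partials[OF open_M smooth_dy[OF smooth_xi]] px[of m]])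
       (auto simp: partials_commute[OF open_M smooth_xi] m determining)
  obtain t where t: "\<And>p. p \<in> M \<Longrightarrow> dz \<xi> p = n * complex_of_real (fst p) + t"
    by (rule partials_match[OF open_M connected_M smooth_partials[OF open_M smooth_dz[OF smooth_xi]] px[of n]])
       (auto simp: partials_commute[OF open_M smooth_xi] n determining)
  have st: "s = complex_of_real (Re s)" "t = complex_of_real (Re t)"
    using xi_partials_real(2,3)[OF p0] s[OF p0] t[OF p0] mn by (simp_all add: complex_eq_iff)
  show ?thesis
    by (rule that[of "Re m" "Re n" "Re s" "Re t"])
       (simp_all add: m n s t mn[symmetric] st[symmetric])
qed

lemma point_in_M: "\<exists>p0. p0 \<in> M"
  using nonempty_G by (auto simp: cbase_def)

text \<open>
  The device for each integration below: guess a primitive, and compare.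
\<close>

lemma match:
  assumes "smooth_on M g" "partials_on M h hx hy hz"
    "\<And>p. p \<in> M \<Longrightarrow> dx g p = hx p \<and> dy g p = hy p \<and> dz g p = hz p"
  obtains c where "\<And>p. p \<in> M \<Longrightarrow> g p = h p + c"
  by (rule partials_match[OF open_M connected_M smooth_partials[OF open_M assms(1)] assms(2)], rule assms(3), assumption, rule that)

text \<open>
  Without \<open>\<beta>\<close> the determining equations express every second derivative of \<open>\<xi>\<close> and \<open>\<eta>\<close> by
  \<open>\<xi>\<^sub>x\<^sub>x\<close>, \<open>\<xi>\<^sub>x\<^sub>y\<close> and \<open>\<xi>\<^sub>x\<^sub>z\<close>, and these are constant. Integrating twice
  gives quadratic polynomials.
\<close>

lemma flat_symmetry_form:
  assumes flat: "\<And>x. x \<in> I \<Longrightarrow> \<beta> x = 0"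
  obtains k0 k1 k2 :: real and \<mu> \<nu> c1 c2 d0 d1 :: complex where
    "\<And>p. p \<in> M \<Longrightarrow> X p = projective_field (k0, k1, k2, \<mu>, \<nu>, c1, c2, d0, d1) p"
proof -
  obtain m n s t :: real where mn: "\<And>p. p \<in> M \<Longrightarrow> dy (dx \<xi>) p = m" "\<And>p. p \<in> M \<Longrightarrow> dz (dx \<xi>) p = n"
    and st: "\<And>p. p \<in> M \<Longrightarrow> dy \<xi> p = s + m * fst p" "\<And>p. p \<in> M \<Longrightarrow> dz \<xi> p = t + n * fst p"
    by (rule vertical_derivatives_of_xi) (rule that; assumption)
  obtain p0 where p0: "p0 \<in> M" using point_in_M by blast
  have b0: "\<beta> (fst p) = 0" if "p \<in> M" for p using flat that by blast
  have b'0: "beta' (fst p) = 0" if p: "p \<in> M" for p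
  proof -
    have x: "fst p \<in> I" using p by blast
    have "(\<beta> has_real_derivative 0) (at (fst p))"
      by (rule has_field_derivative_transform_within_open[OF DERIV_const[of 0] open_I x]) (simp add: flat)
    then show ?thesis using DERIV_unique[OF beta_derivative[OF x]] by blast
  qed
  have e: "2 * dy (dx \<eta>) p = dx (dx \<xi>) p" "2 * dz (dx \<eta>) p = \<i> * dx (dx \<xi>) p" "dx (dx \<eta>) p = 0" if "p \<in> M" for p
    using determining(7-9)[OF that] b0[OF that] b'0[OF that] by simp_all
  have xxx: "dx (dx (dx \<xi>)) p = 0" if p: "p \<in> M" for p
  proof -
    have "dx (dx (dx \<xi>)) p = dx (\<lambda>p. 2 * dy (dx \<eta>) p) p"
      by (rule partials_cong_unique(1)[OF open_M _ e(1)[symmetric] p]) (intro smooth_all)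
    also have "\<dots> = 2 * dx (dy (dx \<eta>)) p"
      by (rule trans, rule partials_on_unique(1)[OF _ p], (rule partials_intros partials_all)+) simp
    also have "dx (dy (dx \<eta>)) p = dy (dx (dx \<eta>)) p"
      by (rule partials_commute(1)[OF open_M smooth_dx[OF smooth_eta] p])
    also have "\<dots> = dy (\<lambda>_. 0) p"
      by (rule partials_cong_unique(2)[OF open_M _ e(3) p]) (intro smooth_all)
    also have "\<dots> = 0" by (rule partials_on_unique(2)[OF partials_const p])
    finally show ?thesis by simp
  qed
  note third = third_partials[OF open_M smooth_xi] mixed_third(3,4)
  note comm = partials_commute[OF open_M smooth_xi] partials_commute[OF open_M smooth_eta]
  note px = partials_x partials_re partials_im partials_const
  obtain k where k: "\<And>p. p \<in> M \<Longrightarrow> dx (dx \<xi>) p = 0 + k"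
    by (rule match[OF smooth_dx[OF smooth_dx[OF smooth_xi]] partials_const[of _ 0]], simp add: xxx third, rule that)
  define k2 where "k2 = Re k / 2"
  have kr: "k = 2 * complex_of_real k2" using k[OF p0] xi_partials_real(4)[OF p0] by (simp add: complex_eq_iff k2_def)
  let ?x = "\<lambda>p::cpoint. complex_of_real (fst p)" and ?y = "\<lambda>p::cpoint. complex_of_real (Re (snd p))"
    and ?z = "\<lambda>p::cpoint. complex_of_real (Im (snd p))"
  have aff: "partials_on M (\<lambda>p. a * ?x p + b * ?y p + c * ?z p) (\<lambda>p. a) (\<lambda>p. b) (\<lambda>p. c)" for a b c
    using partials_add[OF partials_add[OF partials_mult[OF partials_const[of _ a] partials_x]
       partials_mult[OF partials_const[of _ b] partials_re]] partials_mult[OF partials_const[of _ c] partials_im]] by simp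
  have quad: "partials_on M (\<lambda>p. ?x p * (a * ?x p + b * ?y p + c * ?z p) + ?y p * (d * ?y p + e * ?z p) + ?z p * (f * ?z p)
       + (a' * ?x p + b' * ?y p + c' * ?z p))
     (\<lambda>p. 2 * a * ?x p + b * ?y p + c * ?z p + a') (\<lambda>p. b * ?x p + 2 * d * ?y p + e * ?z p + b')
     (\<lambda>p. c * ?x p + e * ?y p + 2 * f * ?z p + c')" for a b c d e f a' b' c'
    by (rule partials_on_eq_rhs, (rule partials_intros)+) (simp_all add: algebra_simps)
  obtain k1 where k1: "\<And>p. p \<in> M \<Longrightarrow> dx \<xi> p = (2 * complex_of_real k2 * ?x p + m * ?y p + n * ?z p) + k1"
    by (rule match[OF smooth_dx[OF smooth_xi] aff[of "2 * complex_of_real k2" m n]], simp add: k kr mn, rule that)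
  obtain k0 where k0: "\<And>p. p \<in> M \<Longrightarrow> \<xi> p = (?x p * (k2 * ?x p + m * ?y p + n * ?z p) + ?y p * (0 * ?y p + 0 * ?z p) + ?z p * (0 * ?z p)
       + (k1 * ?x p + s * ?y p + t * ?z p)) + k0"
    by (rule match[OF smooth_xi quad[of k2 m n 0 0 0 k1 s t]], simp add: k1 st algebra_simps, rule that)
  have e': "dy (dx \<eta>) p = complex_of_real k2" "dz (dx \<eta>) p = \<i> * complex_of_real k2" if "p \<in> M" for p
    using e(1,2)[OF that] k[OF that] kr by simp_all
  obtain c1 where c1: "\<And>p. p \<in> M \<Longrightarrow> dy \<eta> p = (k2 * ?x p + 2 * (complex_of_real m) * ?y p + (complex_of_real n + \<i> * complex_of_real m) * ?z p) + c1"
    by (rule match[OF smooth_dy[OF smooth_eta] aff[of k2 "2 * (complex_of_real m)" "complex_of_real n + \<i> * complex_of_real m"]], simp add: comm determining mn e' k kr, rule that)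
  obtain c2 where c2: "\<And>p. p \<in> M \<Longrightarrow> dz \<eta> p = (\<i> * complex_of_real k2 * ?x p + (complex_of_real n + \<i> * complex_of_real m) * ?y p + (2 * \<i> * complex_of_real n) * ?z p) + c2"
    by (rule match[OF smooth_dz[OF smooth_eta] aff[of "\<i> * complex_of_real k2" "complex_of_real n + \<i> * complex_of_real m" "2 * \<i> * complex_of_real n"]], simp add: comm determining mn e' k kr, rule that)
  obtain d1 where d1: "\<And>p. p \<in> M \<Longrightarrow> dx \<eta> p = (0 * ?x p + k2 * ?y p + (\<i> * complex_of_real k2) * ?z p) + d1"
    by (rule match[OF smooth_dx[OF smooth_eta] aff[of 0 k2 "\<i> * complex_of_real k2"]], simp add: e(3) e', rule that)
  obtain d0 where d0: "\<And>p. p \<in> M \<Longrightarrow> \<eta> p = (?x p * (0 * ?x p + k2 * ?y p + (\<i> * complex_of_real k2) * ?z p) + ?y p * (m * ?y p + (complex_of_real n + \<i> * complex_of_real m) * ?z p)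
      + ?z p * ((\<i> * complex_of_real n) * ?z p) + (d1 * ?x p + c1 * ?y p + c2 * ?z p)) + d0"
    by (rule match[OF smooth_eta quad[of 0 k2 "\<i> * complex_of_real k2" m "complex_of_real n + \<i> * complex_of_real m" "\<i> * complex_of_real n" d1 c1 c2]], simp add: d1 c1 c2 algebra_simps, rule that)
  have "X p = projective_field (Re k0, Re k1, k2, Complex s t, Complex m n, c1, c2, d0, d1) p" if p: "p \<in> M" for p
  proof -
    obtain x u where [simp]: "p = (x, u)" by (cases p)
    have "fst (X p) = Re (\<xi> p)" "snd (X p) = \<eta> p" by (simp_all add: \<xi>_def \<eta>_def)
    then show ?thesis
      unfolding k0[OF p] d0[OF p]
      by (simp add: prod_eq_iff projective_field_def inner_complex_def algebra_simps power2_eq_square complex_eq_iff scaleR_conv_of_real)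
  qed
  then show ?thesis by (rule that)
qed

text \<open>
  Near \<open>x1\<close> the functions \<open>dy \<xi>\<close> and \<open>dz \<xi>\<close> vanish; being affine in \<open>x\<close>, they vanish everywhere, so \<open>\<xi>\<close> depends on
  \<open>x\<close> alone. The \<open>y\<close>- and \<open>z\<close>-derivatives of the equation of degree zero then split into three statements (step
  \<open>split\<close>): \<open>\<xi>\<close> is quadratic, it satisfies \<open>\<beta>' \<xi> + 2 \<beta> \<xi>' = 0\<close>, and \<open>\<eta>\<close> is complex
  differentiable in \<open>u\<close> where \<open>\<beta>\<close> does not vanish. The part of \<open>\<eta>\<close> that does not depend on \<open>u\<close> solves the
  equation. It is recovered from its Wronskians with \<open>f1\<close> and \<open>f2\<close>, which are constants on \<open>M\<close>, rather than
  as a function of \<open>x\<close>: the fibres of \<open>M\<close> may be disconnected.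
\<close>

lemma curved_symmetry_form:
  assumes x1: "x1 \<in> I" "\<beta> x1 \<noteq> 0"
    and f1: "solves \<beta> I f1 f1'" and f2: "solves \<beta> I f2 f2'"
    and W: "\<And>x. x \<in> I \<Longrightarrow> f1 x * f2' x - f1' x * f2 x = 1"
  obtains k0 k1 k2 :: real and c a b :: complex where
    "\<And>x. x \<in> I \<Longrightarrow> beta' x * (k0 + k1 * x + k2 * x\<^sup>2) + 2 * \<beta> x * (k1 + 2 * k2 * x) = 0"
    "\<And>x (u::complex). (x, u) \<in> M \<Longrightarrow> X (x, u) = (k0 + k1 * x + k2 * x\<^sup>2, complex_of_real (k1 / 2 + k2 * x) * u + c * u + a * f1 x + b * f2 x)"
proof -
  obtain m n s t :: real where mn: "\<And>p. p \<in> M \<Longrightarrow> dy (dx \<xi>) p = m" "\<And>p. p \<in> M \<Longrightarrow> dz (dx \<xi>) p = n"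
    and st: "\<And>p. p \<in> M \<Longrightarrow> dy \<xi> p = s + m * fst p" "\<And>p. p \<in> M \<Longrightarrow> dz \<xi> p = t + n * fst p"
    by (rule vertical_derivatives_of_xi) (rule that; assumption)
  obtain p0 where p0: "p0 \<in> M" using point_in_M by blast
  have affine_zero: "m = 0 \<and> s = 0" if z: "\<And>p. p \<in> M \<Longrightarrow> \<beta> (fst p) * (s + m * fst p) = 0" for m s :: real
  proof -
    have "open (I \<inter> \<beta> -` (- {0}))"
      by (rule continuous_open_preimage[OF continuous_beta open_I]) auto
    moreover have "x1 \<in> I \<inter> \<beta> -` (- {0})" using x1 by simp
    ultimately obtain r where r: "r > 0" "ball x1 r \<subseteq> I \<inter> \<beta> -` (- {0})" by (rule openE)
    have "s + m * x = 0" if "x \<in> ball x1 r" for x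
    proof -
      have "x \<in> I" "\<beta> x \<noteq> 0" using subsetD[OF r(2) that] by auto
      then obtain p where "p \<in> M" "x = fst p" by blast
      then show ?thesis using z[of p] \<open>\<beta> x \<noteq> 0\<close> by simp
    qed
    from this[of x1] this[of "x1 + r / 2"]
    have 1: "s + m * x1 = 0" and 2: "s + m * (x1 + r / 2) = 0" using r(1) by (simp_all add: dist_real_def)
    have "m * (r / 2) = (s + m * (x1 + r / 2)) - (s + m * x1)" by (simp only: distrib_left)
    then have "m * (r / 2) = 0" unfolding 1 2 by simp
    then show ?thesis using r(1) 1 by simp
  qed
  have ms: "m = 0 \<and> s = 0"
  proof (rule affine_zero)
    fix p assume p: "p \<in> M"
    show "\<beta> (fst p) * (s + m * fst p) = 0"
    proof -
      have "complex_of_real (\<beta> (fst p) * (s + m * fst p)) = 0"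
        using mixed_third(1)[OF p] unfolding st(1)[OF p] of_real_mult .
      then show ?thesis by (simp only: of_real_eq_0_iff)
    qed
  qed
  have nt: "n = 0 \<and> t = 0"
  proof (rule affine_zero)
    fix p assume p: "p \<in> M"
    show "\<beta> (fst p) * (t + n * fst p) = 0"
    proof -
      have "complex_of_real (\<beta> (fst p) * (t + n * fst p)) = 0"
        using mixed_third(2)[OF p] unfolding st(2)[OF p] of_real_mult .
      then show ?thesis by (simp only: of_real_eq_0_iff)
    qed
  qed
  have xi0: "dy \<xi> p = 0" "dz \<xi> p = 0" "dy (dx \<xi>) p = 0" "dz (dx \<xi>) p = 0" if "p \<in> M" for p
    using mn[OF that] st[OF that] ms nt by simp_all
  have eta0: "dy (dy \<eta>) p = 0" "dz (dy \<eta>) p = 0" "dy (dz \<eta>) p = 0" "dz (dz \<eta>) p = 0"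
    "2 * dy (dx \<eta>) p = dx (dx \<xi>) p" "2 * dz (dx \<eta>) p = \<i> * dx (dx \<xi>) p" if "p \<in> M" for p
    using determining(4-8)[OF that] xi0[OF that] partials_commute(3)[OF open_M smooth_eta that] by simp_all
  let ?b = "\<lambda>p::cpoint. complex_of_real (\<beta> (fst p))" and ?b' = "\<lambda>p::cpoint. complex_of_real (beta' (fst p))"
  have split: "dx (dx (dx \<xi>)) p = 0 \<and> ?b' p * \<xi> p + 2 * ?b p * dx \<xi> p = 0 \<and> ?b p * (dy \<eta> p + \<i> * dz \<eta> p) = 0"
    if p: "p \<in> M" for p
  proof -
    have yx: "2 * dy (dx (dx \<eta>)) p = dx (dx (dx \<xi>)) p"
    proof -
      have "dx (dx (dx \<xi>)) p = dx (\<lambda>p. 2 * dy (dx \<eta>) p) p"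
        by (rule partials_cong_unique(1)[OF open_M _ eta0(5)[symmetric] p]) (intro smooth_all)
      also have "\<dots> = 2 * dx (dy (dx \<eta>)) p"
        by (rule trans, rule partials_on_unique(1)[OF _ p], (rule partials_intros partials_all)+) simp
      also have "dx (dy (dx \<eta>)) p = dy (dx (dx \<eta>)) p"
        by (rule partials_commute(1)[OF open_M smooth_dx[OF smooth_eta] p])
      finally show ?thesis by simp
    qed
    have zx: "2 * dz (dx (dx \<eta>)) p = \<i> * dx (dx (dx \<xi>)) p"
    proof -
      have "dx (\<lambda>p. \<i> * dx (dx \<xi>) p) p = dx (\<lambda>p. 2 * dz (dx \<eta>) p) p"
        by (rule partials_cong_unique(1)[OF open_M _ eta0(6)[symmetric] p])
           (intro smooth_on_mult smooth_on_const open_M smooth_all)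
      moreover have "dx (\<lambda>p. \<i> * dx (dx \<xi>) p) p = \<i> * dx (dx (dx \<xi>)) p"
        by (rule trans, rule partials_on_unique(1)[OF _ p], (rule partials_intros partials_all)+) simp
      moreover have "dx (\<lambda>p. 2 * dz (dx \<eta>) p) p = 2 * dx (dz (dx \<eta>)) p"
        by (rule trans, rule partials_on_unique(1)[OF _ p], (rule partials_intros partials_all)+) simp
      moreover have "dx (dz (dx \<eta>)) p = dz (dx (dx \<eta>)) p"
        by (rule partials_commute(2)[OF open_M smooth_dx[OF smooth_eta] p])
      ultimately show ?thesis by simp
    qed
    let ?E = "\<lambda>p. dx (dx \<eta>) p - complex_of_real (\<beta> (fst p)) * complex_of_real (Im (snd p)) * dy \<eta> p
       + complex_of_real (\<beta> (fst p)) * complex_of_real (Re (snd p)) * dz \<eta> p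
       - \<i> * beta' (fst p) * snd p * \<xi> p - 2 * \<i> * \<beta> (fst p) * snd p * dx \<xi> p - \<i> * \<beta> (fst p) * \<eta> p"
    have pb': "partials_on M ?b' (dx ?b') (dy ?b') (dz ?b')"
      by (rule smooth_partials[OF open_M], rule smooth_on_of_real[OF open_M])
         (rule smooth_on_compose[OF open_M open_I], auto intro!: smooth_on_fst smooth_on_ident open_M smooth_beta'[unfolded comp_def])
    have vert: "dy ?b' p = 0" "dz ?b' p = 0"
      using smooth_beta'_vertical[OF p] by simp_all
    have E0: "dy (\<lambda>_. 0) p = dy ?E p"
      by (rule partials_cong_unique(2)[OF open_M smooth_on_const[OF open_M] determining(9)[symmetric] p])
    have E0': "dz (\<lambda>_. 0) p = dz ?E p"
      by (rule partials_cong_unique(3)[OF open_M smooth_on_const[OF open_M] determining(9)[symmetric] p])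
    have c0: "dy (\<lambda>_. 0) p = 0" "dz (\<lambda>_. 0) p = 0"
      by (rule partials_on_unique[OF partials_const p])+
    have Ey: "dy ?E p = dy (dx (dx \<eta>)) p + ?b p * dz \<eta> p - \<i> * (?b' p * \<xi> p + 2 * ?b p * dx \<xi> p) - \<i> * ?b p * dy \<eta> p"
      by (rule trans, rule partials_on_unique(2)[OF _ p], (rule partials_intros partials_all partials_beta pb')+)
         (simp add: eta0[OF p] xi0[OF p] vert algebra_simps)
    have Ez: "dz ?E p = dz (dx (dx \<eta>)) p - ?b p * dy \<eta> p + (?b' p * \<xi> p + 2 * ?b p * dx \<xi> p) - \<i> * ?b p * dz \<eta> p"
      by (rule trans, rule partials_on_unique(3)[OF _ p], (rule partials_intros partials_all partials_beta pb')+)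
         (simp add: eta0[OF p] xi0[OF p] vert algebra_simps)
    define T where "T = dx (dx (dx \<xi>)) p"
    define R where "R = ?b' p * \<xi> p + 2 * ?b p * dx \<xi> p"
    have y: "T + 2 * ?b p * dz \<eta> p - 2 * \<i> * R - 2 * \<i> * ?b p * dy \<eta> p = 0"
    proof -
      have "T + 2 * ?b p * dz \<eta> p - 2 * \<i> * R - 2 * \<i> * ?b p * dy \<eta> p =
          2 * (dy (dx (dx \<eta>)) p + ?b p * dz \<eta> p - \<i> * R - \<i> * ?b p * dy \<eta> p)"
        unfolding T_def yx[symmetric] by (simp only: algebra_simps)
      also have "\<dots> = 2 * 0"
        unfolding R_def by (simp only: trans[OF c0(1)[symmetric] trans[OF E0 Ey], symmetric])
      finally show ?thesis by simp
    qed
    have z: "\<i> * T - 2 * ?b p * dy \<eta> p + 2 * R - 2 * \<i> * ?b p * dz \<eta> p = 0"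
    proof -
      have "\<i> * T - 2 * ?b p * dy \<eta> p + 2 * R - 2 * \<i> * ?b p * dz \<eta> p =
          2 * (dz (dx (dx \<eta>)) p - ?b p * dy \<eta> p + R - \<i> * ?b p * dz \<eta> p)"
        unfolding T_def zx[symmetric] by (simp only: algebra_simps)
      also have "\<dots> = 2 * 0"
        unfolding R_def by (simp only: trans[OF c0(2)[symmetric] trans[OF E0' Ez], symmetric])
      finally show ?thesis by simp
    qed
    \<comment> \<open>The sum of \<open>\<i>\<close> times \<open>y\<close> and \<open>z\<close> contains only the real quantities \<open>T\<close> and \<open>R\<close>, in separate components.\<close>
    have "2 * (\<i> * T + 2 * R) = \<i> * (T + 2 * ?b p * dz \<eta> p - 2 * \<i> * R - 2 * \<i> * ?b p * dy \<eta> p)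
        + (\<i> * T - 2 * ?b p * dy \<eta> p + 2 * R - 2 * \<i> * ?b p * dz \<eta> p)"
      by (simp add: algebra_simps)
    then have "2 * (\<i> * T + 2 * R) = 0" unfolding y z by simp
    from this[unfolded mult_eq_0_iff] have "\<i> * T + 2 * R = 0" by simp
    moreover have "Im T = 0" using xi_partials_real(7)[OF p] by (simp add: T_def)
    moreover have "Im R = 0" using xi_partials_real(1)[OF p] xi_real by (simp add: R_def)
    ultimately have TR: "T = 0" "R = 0" by (auto simp: complex_eq_iff)
    have "2 * (?b p * (dy \<eta> p + \<i> * dz \<eta> p)) = \<i> * (0 + 2 * ?b p * dz \<eta> p - 2 * \<i> * 0 - 2 * \<i> * ?b p * dy \<eta> p)"
      by (simp add: algebra_simps)
    also have "\<dots> = 0" using y unfolding TR by simp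
    finally have "?b p * (dy \<eta> p + \<i> * dz \<eta> p) = 0" unfolding mult_eq_0_iff by simp
    then show ?thesis using TR unfolding T_def R_def by blast
  qed
  note third = third_partials[OF open_M smooth_xi] mixed_third(3,4)
  note comm = partials_commute[OF open_M smooth_xi] partials_commute[OF open_M smooth_eta]
  obtain k where k: "\<And>p. p \<in> M \<Longrightarrow> dx (dx \<xi>) p = 0 + k"
    by (rule match[OF smooth_dx[OF smooth_dx[OF smooth_xi]] partials_const[of _ 0]], use split in \<open>simp add: third\<close>, rule that)
  define k2 where "k2 = Re k / 2"
  have kr: "k = 2 * complex_of_real k2" using k[OF p0] xi_partials_real(4)[OF p0] by (simp add: complex_eq_iff k2_def)
  let ?x = "\<lambda>p::cpoint. complex_of_real (fst p)"
  have px: "partials_on M (\<lambda>p. a * ?x p) (\<lambda>p. a) (\<lambda>p. 0) (\<lambda>p. 0)" for a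
    using partials_mult[OF partials_const[of _ a] partials_x] by simp
  have px2: "partials_on M (\<lambda>p. ?x p * (a * ?x p) + b * ?x p) (\<lambda>p. 2 * a * ?x p + b) (\<lambda>p. 0) (\<lambda>p. 0)" for a b
    by (rule partials_on_eq_rhs, (rule partials_intros)+) (simp_all add: algebra_simps)
  obtain k1' where k1': "\<And>p. p \<in> M \<Longrightarrow> dx \<xi> p = 2 * complex_of_real k2 * ?x p + k1'"
    by (rule match[OF smooth_dx[OF smooth_xi] px[of "2 * complex_of_real k2"]], simp add: k kr xi0, rule that)
  define k1 where "k1 = Re k1'"
  have k1r: "k1' = complex_of_real k1" using k1'[OF p0] xi_partials_real(1)[OF p0] by (simp add: complex_eq_iff k1_def)
  obtain k0 where k0: "\<And>p. p \<in> M \<Longrightarrow> \<xi> p = (?x p * (k2 * ?x p) + k1 * ?x p) + k0"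
    by (rule match[OF smooth_xi px2[of k2 k1]], simp add: k1' k1r xi0, rule that)
  have k0r: "k0 = complex_of_real (Re k0)" using k0[OF p0] xi_real[of p0] by (simp add: complex_eq_iff)
  have e': "dy (dx \<eta>) p = complex_of_real k2" "dz (dx \<eta>) p = \<i> * complex_of_real k2" if "p \<in> M" for p
    using eta0(5,6)[OF that] k[OF that] kr by simp_all
  obtain c1 where c1: "\<And>p. p \<in> M \<Longrightarrow> dy \<eta> p = k2 * ?x p + c1"
    by (rule match[OF smooth_dy[OF smooth_eta] px[of k2]], simp add: comm eta0 e', rule that)
  obtain c2 where c2: "\<And>p. p \<in> M \<Longrightarrow> dz \<eta> p = \<i> * complex_of_real k2 * ?x p + c2"
    by (rule match[OF smooth_dz[OF smooth_eta] px[of "\<i> * complex_of_real k2"]], simp add: comm eta0 e', rule that)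
  have c12: "c2 = \<i> * c1"
  proof -
    obtain u1 where p: "(x1, u1) \<in> M" using x1 by force
    then have "?b (x1, u1) * (dy \<eta> (x1, u1) + \<i> * dz \<eta> (x1, u1)) = 0" using split by blast
    then have "dy \<eta> (x1, u1) + \<i> * dz \<eta> (x1, u1) = 0" using x1(2) by simp
    then have "c1 + \<i> * c2 = 0" unfolding c1[OF p] c2[OF p] by (simp add: algebra_simps)
    then have "\<i> * (c1 + \<i> * c2) = 0" by simp
    then show ?thesis by (simp add: algebra_simps)
  qed
  define h where "h = (\<lambda>p::cpoint. \<eta> p - (complex_of_real k2 * ?x p + c1) * snd p)"
  define h' where "h' = (\<lambda>p::cpoint. dx \<eta> p - complex_of_real k2 * snd p)"
  have ph: "partials_on M h h' (\<lambda>p. 0) (\<lambda>p. 0)"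
    unfolding h_def h'_def
    by (rule partials_on_eq_rhs, (rule partials_intros partials_all)+)
       (simp_all add: c1 c2 c12 algebra_simps)
  have ph': "partials_on M h' (\<lambda>p. \<i> * ?b p * h p) (\<lambda>p. 0) (\<lambda>p. 0)"
    unfolding h'_def
  proof (rule partials_on_eq_rhs, (rule partials_intros partials_all)+)
    fix p assume p: "p \<in> M"
    have u: "snd p = complex_of_real (Re (snd p)) + \<i> * complex_of_real (Im (snd p))" by (rule complex_eq)
    have "?b' p * \<xi> p + 2 * ?b p * dx \<xi> p = 0" using split[OF p] by blast
    then have "\<i> * snd p * (?b' p * \<xi> p + 2 * ?b p * dx \<xi> p) = 0" by simp
    moreover have "?b p * complex_of_real (Re (snd p)) * dz \<eta> p - ?b p * complex_of_real (Im (snd p)) * dy \<eta> p =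
        \<i> * ?b p * (k2 * ?x p + c1) * snd p"
      unfolding c1[OF p] c2[OF p] c12 by (subst (3) u) (simp add: algebra_simps)
    ultimately have "dx (dx \<eta>) p = \<i> * ?b p * h p"
      using determining(9)[OF p] unfolding h_def by (simp add: algebra_simps)
    then show "dx (dx \<eta>) p - (complex_of_real k2 * 0 + 0 * snd p) = \<i> * ?b p * h p" by simp
  next
    fix p assume p: "p \<in> M"
    show "dy (dx \<eta>) p - (complex_of_real k2 * 1 + 0 * snd p) = 0" "dz (dx \<eta>) p - (complex_of_real k2 * \<i> + 0 * snd p) = 0"
      using eta0(5,6)[OF p] k[OF p] kr by simp_all
  qed
  have pf: "partials_on M (\<lambda>p. f (fst p)) (\<lambda>p. f' (fst p)) (\<lambda>p. 0) (\<lambda>p. 0)"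
    "partials_on M (\<lambda>p. f' (fst p)) (\<lambda>p. \<i> * ?b p * f (fst p)) (\<lambda>p. 0) (\<lambda>p. 0)" if "solves \<beta> I f f'" for f f'
    using partials_of_x[of M f f'] partials_of_x[of M f' "\<lambda>x. \<i> * \<beta> x * f x"] solvesD[OF that] by simp_all
  obtain a where a: "\<And>p. p \<in> M \<Longrightarrow> h p * f2' (fst p) - h' p * f2 (fst p) = a"
    by (rule partials_on_constant[OF open_M connected_M partials_diff[OF partials_mult[OF ph pf(2)[OF f2]] partials_mult[OF ph' pf(1)[OF f2]]]])
       (simp_all add: algebra_simps)
  obtain b where b: "\<And>p. p \<in> M \<Longrightarrow> f1 (fst p) * h' p - f1' (fst p) * h p = b"
    by (rule partials_on_constant[OF open_M connected_M partials_diff[OF partials_mult[OF pf(1)[OF f1] ph'] partials_mult[OF pf(2)[OF f1] ph]]])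
       (simp_all add: algebra_simps)
  have hab: "h p = a * f1 (fst p) + b * f2 (fst p)" if p: "p \<in> M" for p
  proof -
    have "a * f1 (fst p) + b * f2 (fst p) = h p * (f1 (fst p) * f2' (fst p) - f1' (fst p) * f2 (fst p))"
      unfolding a[OF p, symmetric] b[OF p, symmetric] by (simp add: algebra_simps)
    then show ?thesis using W[of "fst p"] p by simp
  qed
  have eq1: "beta' x * (Re k0 + k1 * x + k2 * x\<^sup>2) + 2 * \<beta> x * (k1 + 2 * k2 * x) = 0" if "x \<in> I" for x
  proof -
    obtain u where p: "(x, u) \<in> M" using \<open>x \<in> I\<close> by force
    have "complex_of_real (beta' x * (Re k0 + k1 * x + k2 * x\<^sup>2) + 2 * \<beta> x * (k1 + 2 * k2 * x)) = 0"
      using split[OF p] k0[OF p] k1'[OF p] k0r k1r by (simp add: algebra_simps power2_eq_square)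
    then show ?thesis using of_real_eq_0_iff by blast
  qed
  have eq2: "X (x, u) = (Re k0 + k1 * x + k2 * x\<^sup>2, complex_of_real (k1 / 2 + k2 * x) * u + (c1 - k1 / 2) * u + a * f1 x + b * f2 x)"
    if p: "(x, u) \<in> M" for x :: real and u :: complex
  proof -
    have "fst (X (x, u)) = Re (\<xi> (x, u))" "snd (X (x, u)) = \<eta> (x, u)" by (simp_all add: \<xi>_def \<eta>_def)
    moreover have "\<eta> (x, u) = h (x, u) + (k2 * x + c1) * u" by (simp add: h_def)
    ultimately show ?thesis
      using k0[OF p] hab[OF p] by (simp add: prod_eq_iff algebra_simps power2_eq_square)
  qed
  show ?thesis by (rule that[OF eq1 eq2])
qed

end

end

section \<open>Curves moved by a flow\<close>

lemma interval_diffeomorphism: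
  fixes a a1 :: "real \<Rightarrow> real"
  assumes J: "open_interval J"
    and d: "\<And>x. x \<in> J \<Longrightarrow> (a has_real_derivative a1 x) (at x)" and nz: "\<And>x. x \<in> J \<Longrightarrow> a1 x \<noteq> 0"
  obtains \<sigma> where "open_interval (a ` J)" "\<And>x. x \<in> J \<Longrightarrow> \<sigma> (a x) = x"
    "\<And>x. x \<in> J \<Longrightarrow> (\<sigma> has_real_derivative inverse (a1 x)) (at (a x))"
proof -
  have op: "open J" and iv: "is_interval J" and ne: "J \<noteq> {}" using J by (auto simp: open_interval_def)
  have cont: "continuous_on J a"
    by (intro continuous_at_imp_continuous_on ballI DERIV_isCont[OF d])
  have "a x \<noteq> a y" if xy: "x \<in> J" "y \<in> J" "x < y" for x y
  proof
    assume eq: "a x = a y"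
    have sub: "{x..y} \<subseteq> J" using mem_is_interval_1_I[OF iv xy(1,2)] by auto
    have "\<exists>z. x < z \<and> z < y \<and> a y - a x = (y - x) * a1 z"
      by (rule MVT2[OF xy(3)]) (use sub d in auto)
    then obtain z where "x < z" "z < y" "a y - a x = (y - x) * a1 z" by blast
    then have "a1 z = 0" using eq xy by simp
    moreover have "z \<in> J" using sub \<open>x < z\<close> \<open>z < y\<close> by (meson atLeastAtMost_iff less_imp_le subsetD)
    ultimately show False using nz by blast
  qed
  then have inj: "inj_on a J" unfolding inj_on_def by (metis linorder_neqE)
  obtain \<sigma> where hom: "homeomorphism J (a ` J) a \<sigma>"
    using invariance_of_domain_homeomorphism[OF op cont _ inj] by auto
  have opK: "open (a ` J)" by (rule invariance_of_domain[OF cont op inj])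
  have s: "\<sigma> (a x) = x" if "x \<in> J" for x using hom that by (simp add: homeomorphism_def)
  have "connected (a ` J)" using connected_continuous_image[OF cont] iv by (simp add: is_interval_connected_1)
  then have K: "open_interval (a ` J)" using opK ne by (simp add: open_interval_def is_interval_connected_1)
  have "(\<sigma> has_real_derivative inverse (a1 x)) (at (a x))" if x: "x \<in> J" for x
    unfolding has_field_derivative_def
  proof (rule has_derivative_inverse_basic_x[where f = a and f' = "(*) (a1 x)" and T = "a ` J"])
    show "(a has_derivative (*) (a1 x)) (at x)" using d[OF x] by (simp add: has_field_derivative_def)
    show "bounded_linear ((*) (inverse (a1 x)))" by (rule bounded_linear_mult_right)
    show "(*) (inverse (a1 x)) \<circ> (*) (a1 x) = id" using nz[OF x] by (auto simp: fun_eq_iff)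
    show "continuous (at (a x)) \<sigma>"
      using hom opK x by (auto simp: homeomorphism_def continuous_on_eq_continuous_at)
    show "\<sigma> (a x) = x" by (rule s[OF x])
  qed (use x opK s in auto)
  then show ?thesis using that K s by blast
qed

text \<open>
  Inverting the first component turns a parametrised curve with slope \<open>P\<close> into a graph with derivative \<open>P\<close>.
\<close>

lemma parametric_curve_is_graph:
  fixes a a1 :: "real \<Rightarrow> real" and b P R :: "real \<Rightarrow> complex"
  assumes J: "open_interval J"
    and a: "\<And>x. x \<in> J \<Longrightarrow> (a has_real_derivative a1 x) (at x)" and pos: "\<And>x. x \<in> J \<Longrightarrow> a1 x > 0"
    and b: "\<And>x. x \<in> J \<Longrightarrow> (b has_vector_derivative a1 x *\<^sub>R P x) (at x)"
    and P: "\<And>x. x \<in> J \<Longrightarrow> (P has_vector_derivative a1 x *\<^sub>R R x) (at x)"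
  obtains K g g' where "open_interval K" "K = a ` J" "\<And>x. x \<in> J \<Longrightarrow> g (a x) = b x" "\<And>x. x \<in> J \<Longrightarrow> g' (a x) = P x"
    "\<And>x. x \<in> J \<Longrightarrow> (g has_vector_derivative P x) (at (a x))"
    "\<And>x. x \<in> J \<Longrightarrow> (g' has_vector_derivative R x) (at (a x))"
proof -
  have nz: "a1 x \<noteq> 0" if "x \<in> J" for x using pos[OF that] by simp
  obtain \<sigma> where K: "open_interval (a ` J)" and s: "\<And>x. x \<in> J \<Longrightarrow> \<sigma> (a x) = x"
    and ds: "\<And>x. x \<in> J \<Longrightarrow> (\<sigma> has_real_derivative inverse (a1 x)) (at (a x))"
    by (rule interval_diffeomorphism[OF J a nz]; (assumption)?) (rule that; assumption)
  have chain: "((\<lambda>s. c (\<sigma> s)) has_vector_derivative v) (at (a x))"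
    if x: "x \<in> J" and c: "(c has_vector_derivative a1 x *\<^sub>R v) (at x)" for c :: "real \<Rightarrow> complex" and v x
  proof -
    have 1: "(\<sigma> has_vector_derivative inverse (a1 x)) (at (a x))"
      using ds[OF x] by (simp add: has_real_derivative_iff_has_vector_derivative)
    have 2: "(c has_vector_derivative a1 x *\<^sub>R v) (at (\<sigma> (a x)))" using c s[OF x] by simp
    from vector_diff_chain_at[OF 1 2] show ?thesis using nz[OF x] by (simp add: o_def)
  qed
  show ?thesis
    by (rule that[OF K refl, of "\<lambda>s. b (\<sigma> s)" "\<lambda>s. P (\<sigma> s)"]) (simp_all add: s chain b P)
qed

context linear_equation
begin

text \<open>
  A flow moves a solution to the curve parametrised by \<open>x \<mapsto> \<phi> t (x, f x)\<close>. With \<open>a1\<close> the derivative of its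
  first component and \<open>P\<close> its slope, the curve is a solution if \<open>dP = \<i> \<beta> U dx\<close> along it. Since
  \<open>a1 = 1\<close> and the jet lies in the open set \<open>G\<close> at time zero, continuity gives uniformly small times and a common
  interval on which the moved curve is a graph with jets in \<open>G\<close>.
\<close>

lemma solutions_moved_by_flow:
  assumes flow: "flow_near M X \<epsilon> N \<phi>"
    and J: "open_interval J" and jets: "\<And>x. x \<in> J \<Longrightarrow> (x, f x, f' x) \<in> G" and f: "solves \<beta> J f f'"
    and gN: "graph J f \<subseteq> N" and x0: "x0 \<in> J"
    and a: "\<And>t x. t \<in> {-\<epsilon><..<\<epsilon>} \<Longrightarrow> x \<in> J \<Longrightarrow> ((\<lambda>x. fst (\<phi> t (x, f x))) has_real_derivative a1 t x) (at x)"
    and b: "\<And>t x. t \<in> {-\<epsilon><..<\<epsilon>} \<Longrightarrow> x \<in> J \<Longrightarrow> a1 t x > 0 \<Longrightarrow>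
        ((\<lambda>x. snd (\<phi> t (x, f x))) has_vector_derivative a1 t x *\<^sub>R P t x) (at x)"
    and P: "\<And>t x. t \<in> {-\<epsilon><..<\<epsilon>} \<Longrightarrow> x \<in> J \<Longrightarrow> a1 t x > 0 \<Longrightarrow>
        (P t has_vector_derivative a1 t x *\<^sub>R (\<i> * \<beta> (fst (\<phi> t (x, f x))) * snd (\<phi> t (x, f x)))) (at x)"
    and init: "\<And>x. x \<in> J \<Longrightarrow> a1 0 x = 1 \<and> P 0 x = f' x"
    and ca: "continuous_on ({-\<epsilon><..<\<epsilon>} \<times> J) (\<lambda>z. a1 (fst z) (snd z))"
    and cP: "continuous_on {z \<in> {-\<epsilon><..<\<epsilon>} \<times> J. a1 (fst z) (snd z) > 0} (\<lambda>z. P (fst z) (snd z))"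
  shows "moves_solution S \<epsilon> \<phi> J f x0"
proof -
  note F = flow_nearD[OF flow]
  let ?B = "{-\<epsilon><..<\<epsilon>} \<times> J"
  have opJ: "open J" using J by (simp add: open_interval_def)
  have opB: "open ?B" by (intro open_Times opJ open_greaterThanLessThan)
  have fN: "(x, f x) \<in> N" if "x \<in> J" for x using gN that by (auto simp: graph_def)
  define \<Phi> where "\<Phi> = (\<lambda>z. \<phi> (fst z) (snd z, f (snd z)))"
  have c\<Phi>: "continuous_on ?B \<Phi>"
  proof -
    have "continuous_on ({-\<epsilon><..<\<epsilon>} \<times> N) (\<lambda>z. \<phi> (fst z) (snd z))"
      using smooth_on_continuous[OF F(4)] by (simp add: case_prod_beta')
    then have "continuous_on ?B (\<lambda>z. (\<lambda>z. \<phi> (fst z) (snd z)) (fst z, (snd z, f (snd z))))"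
    proof (rule continuous_on_compose2)
      show "continuous_on ?B (\<lambda>z. (fst z, snd z, f (snd z)))"
        by (intro continuous_intros continuous_on_compose2[OF solves_continuous(1)[OF f] continuous_on_snd[OF continuous_on_id]]) auto
    qed (use fN in auto)
    then show ?thesis by (simp add: \<Phi>_def)
  qed
  define Z where "Z = ?B \<inter> (\<lambda>z. a1 (fst z) (snd z)) -` {0<..}"
  have opZ: "open Z" unfolding Z_def by (rule continuous_open_preimage[OF ca opB open_greaterThan])
  have Zeq: "{z \<in> ?B. a1 (fst z) (snd z) > 0} = Z" by (auto simp: Z_def)
  have "continuous_on Z (\<lambda>z. (fst (\<Phi> z), snd (\<Phi> z), P (fst z) (snd z)))"
    using cP unfolding Zeq
    by (intro continuous_intros continuous_on_subset[OF c\<Phi>]) (auto simp: Z_def)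
  then have op: "open (Z \<inter> (\<lambda>z. (fst (\<Phi> z), snd (\<Phi> z), P (fst z) (snd z))) -` G)"
    by (rule continuous_open_preimage[OF _ opZ open_G])
  have "(0, x0) \<in> Z \<inter> (\<lambda>z. (fst (\<Phi> z), snd (\<Phi> z), P (fst z) (snd z))) -` G"
    using x0 F(1) F(5)[OF fN[OF x0]] init[OF x0] jets[OF x0] by (auto simp: Z_def \<Phi>_def)
  from open_prod_elim[OF op this] obtain A B where AB: "open A" "open B" "(0, x0) \<in> A \<times> B"
      "A \<times> B \<subseteq> Z \<inter> (\<lambda>z. (fst (\<Phi> z), snd (\<Phi> z), P (fst z) (snd z))) -` G" .
  obtain d where d: "d > 0" "ball 0 d \<subseteq> A" using AB by (auto elim: openE)
  obtain J0 where J0: "open_interval J0" "x0 \<in> J0" "J0 \<subseteq> B" using AB by (auto elim: open_interval_around)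
  define \<delta> where "\<delta> = min d \<epsilon>"
  have del: "0 < \<delta>" "\<delta> \<le> \<epsilon>" using d F(1) by (auto simp: \<delta>_def)
  have inZ: "(t, x) \<in> Z" "(fst (\<phi> t (x, f x)), snd (\<phi> t (x, f x)), P t x) \<in> G"
    if "t \<in> {-\<delta><..<\<delta>}" "x \<in> J0" for t x
  proof -
    have "t \<in> A" using that d by (auto simp: \<delta>_def dist_real_def)
    then have "(t, x) \<in> A \<times> B" using that J0 by auto
    from subsetD[OF AB(4) this] show "(t, x) \<in> Z" "(fst (\<phi> t (x, f x)), snd (\<phi> t (x, f x)), P t x) \<in> G"
      by (auto simp: \<Phi>_def)
  qed
  have J0J: "J0 \<subseteq> J" using inZ(1)[of 0] del by (auto simp: Z_def)
  have "\<exists>K g. open_interval K \<and> S K g \<and> \<phi> t ` graph J0 f = graph K g" if t: "t \<in> {-\<delta><..<\<delta>}" for t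
  proof -
    have te: "t \<in> {-\<epsilon><..<\<epsilon>}" using t del by auto
    have J: "x \<in> J" and pos: "a1 t x > 0" if "x \<in> J0" for x using inZ(1)[OF t that] by (auto simp: Z_def)
    obtain K g g' where K: "open_interval K" "K = (\<lambda>x. fst (\<phi> t (x, f x))) ` J0"
      and g: "\<And>x. x \<in> J0 \<Longrightarrow> g (fst (\<phi> t (x, f x))) = snd (\<phi> t (x, f x))"
        "\<And>x. x \<in> J0 \<Longrightarrow> g' (fst (\<phi> t (x, f x))) = P t x"
        "\<And>x. x \<in> J0 \<Longrightarrow> (g has_vector_derivative P t x) (at (fst (\<phi> t (x, f x))))"
        "\<And>x. x \<in> J0 \<Longrightarrow> (g' has_vector_derivative (\<i> * \<beta> (fst (\<phi> t (x, f x))) * snd (\<phi> t (x, f x)))) (at (fst (\<phi> t (x, f x))))"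
      by (rule parametric_curve_is_graph[OF J0(1) a[OF te J] pos b[OF te J pos] P[OF te J pos]]; (assumption)?)
         (rule that; assumption)
    have "S K g"
      unfolding S_iff solves_def
    proof (intro exI[of _ g'] conjI ballI)
      fix y assume "y \<in> K"
      then obtain x where x: "x \<in> J0" "y = fst (\<phi> t (x, f x))" using K(2) by blast
      show "(y, g y, g' y) \<in> G" using inZ(2)[OF t x(1)] g(1,2)[OF x(1)] x(2) by simp
      show "(g has_vector_derivative g' y) (at y)" using g(2,3)[OF x(1)] x(2) by simp
      show "(g' has_vector_derivative \<i> * \<beta> y * g y) (at y)" using g(1,4)[OF x(1)] x(2) by simp
    qed
    moreover have "\<phi> t ` graph J0 f = graph K g"
      unfolding graph_def K(2) image_image by (intro image_cong refl) (simp add: g prod_eq_iff)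
    ultimately show ?thesis using K(1) by blast
  qed
  then show ?thesis
    unfolding moves_solution_def using del J0 J0J by blast
qed

text \<open>
  Explicit flow formulas make sense on an open set \<open>W\<close> of pairs of a time and a point. A local flow asks for a box.
\<close>

lemma flow_box:
  fixes W :: "(real \<times> cpoint) set"
  assumes W: "open W" and p: "(0, p) \<in> W"
    and sm: "smooth_on W (\<lambda>(t, q). \<phi> t q)"
    and inM: "\<And>t q. (t, q) \<in> W \<Longrightarrow> q \<in> M \<and> \<phi> t q \<in> M"
    and id: "\<And>q. q \<in> M \<Longrightarrow> \<phi> 0 q = q"
    and der: "\<And>t q. (t, q) \<in> W \<Longrightarrow> ((\<lambda>s. \<phi> s q) has_vector_derivative X (\<phi> t q)) (at t)"
  obtains \<epsilon> N where "p \<in> N" "flow_near M X \<epsilon> N \<phi>" "{-\<epsilon><..<\<epsilon>} \<times> N \<subseteq> W"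
proof -
  from open_prod_elim[OF W p] obtain A N where AN: "open A" "open N" "(0, p) \<in> A \<times> N" "A \<times> N \<subseteq> W" .
  obtain \<epsilon> where e: "\<epsilon> > 0" "ball 0 \<epsilon> \<subseteq> A" using AN by (auto elim: openE)
  have sub: "{-\<epsilon><..<\<epsilon>} \<times> N \<subseteq> W" using e AN by (force simp: dist_real_def)
  have inW: "(t, q) \<in> W" if "t \<in> {-\<epsilon><..<\<epsilon>}" "q \<in> N" for t q using sub that by blast
  have "flow_near M X \<epsilon> N \<phi>"
    unfolding flow_near_def
  proof (intro conjI ballI)
    show "smooth_on ({-\<epsilon><..<\<epsilon>} \<times> N) (\<lambda>(t, q). \<phi> t q)"
      by (rule smooth_on_subset[OF sm W _ sub]) (intro open_Times AN open_greaterThanLessThan)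
    show NM: "N \<subseteq> M" using inM[OF inW[of 0]] e by auto
    fix q assume q: "q \<in> N"
    show "\<phi> 0 q = q" by (rule id[OF subsetD[OF NM q]])
    fix t assume t: "t \<in> {-\<epsilon><..<\<epsilon>}"
    show "\<phi> t q \<in> M" using inM[OF inW[OF t q]] by blast
    show "((\<lambda>s. \<phi> s q) has_vector_derivative X (\<phi> t q)) (at t)" by (rule der[OF inW[OF t q]])
  qed (use e AN in auto)
  then show ?thesis using that AN sub by blast
qed

lemma curve_symmetryI:
  assumes "\<And>p. p \<in> M \<Longrightarrow> \<exists>\<epsilon> N \<phi>. p \<in> N \<and> flow_near M X \<epsilon> N \<phi> \<and>
     (\<forall>J f f' x0. open_interval J \<longrightarrow> (\<forall>x\<in>J. (x, f x, f' x) \<in> G) \<longrightarrow> solves \<beta> J f f' \<longrightarrow> graph J f \<subseteq> N \<longrightarrow> x0 \<in> J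
        \<longrightarrow> moves_solution S \<epsilon> \<phi> J f x0)"
  shows "curve_symmetry M S X"
  unfolding curve_symmetry_def
proof
  fix p assume "p \<in> M"
  from assms[OF this] obtain \<epsilon> N \<phi> where 1: "p \<in> N" "flow_near M X \<epsilon> N \<phi>"
    and 2: "\<forall>J f f' x0. open_interval J \<longrightarrow> (\<forall>x\<in>J. (x, f x, f' x) \<in> G) \<longrightarrow> solves \<beta> J f f' \<longrightarrow> graph J f \<subseteq> N \<longrightarrow> x0 \<in> J
        \<longrightarrow> moves_solution S \<epsilon> \<phi> J f x0"
    by (elim exE conjE) (rule that; assumption)
  show "\<exists>\<epsilon> N \<phi>. p \<in> N \<and> flow_near M X \<epsilon> N \<phi> \<and>
        (\<forall>J f x0. open_interval J \<and> S J f \<and> graph J f \<subseteq> N \<and> x0 \<in> J \<longrightarrow> moves_solution S \<epsilon> \<phi> J f x0)"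
  proof (intro exI conjI allI impI)
    fix J f x0 assume H: "open_interval J \<and> S J f \<and> graph J f \<subseteq> N \<and> x0 \<in> J"
    then obtain f' where "\<forall>x\<in>J. (x, f x, f' x) \<in> G" "solves \<beta> J f f'" unfolding S_iff by (elim conjE exE)
    then show "moves_solution S \<epsilon> \<phi> J f x0" by (intro 2[rule_format, of J f f' x0]) (simp_all add: H)
  qed (rule 1)+
qed

end

section \<open>Explicit flows\<close>

lemma smooth_on_blinfun_apply:
  fixes f :: "'a::real_normed_vector \<Rightarrow> real"
  assumes "open S" "smooth_on UNIV E" "smooth_on S g" "smooth_on S f"
  shows "smooth_on S (\<lambda>z. blinfun_apply (E (f z)) (g z))"
  by (intro smooth_on_bilinear[OF bounded_bilinear_blinfun_apply] assms smooth_on_compose[of S UNIV f E])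
     (use assms in auto)

lemma linear_orbit_exists:
  fixes L :: "'a::banach \<Rightarrow> 'a"
  assumes "bounded_linear L"
  shows "\<exists>E. E 0 = id_blinfun \<and> smooth_on UNIV E \<and>
    (\<forall>v t. ((\<lambda>s. blinfun_apply (E s) v) has_vector_derivative L (blinfun_apply (E t) v)) (at t))"
proof -
  obtain E where E: "E 0 = id_blinfun" "smooth_on UNIV E" "\<And>t. (E has_vector_derivative Blinfun L o\<^sub>L E t) (at t)"
    using linear_flow_exists[of "Blinfun L"] by blast
  have "((\<lambda>s. blinfun_apply (E s) v) has_vector_derivative L (blinfun_apply (E t) v)) (at t)" for v t
    using bounded_linear.has_vector_derivative[OF bounded_bilinear.bounded_linear_left[OF bounded_bilinear_blinfun_apply] E(3), of v t]
    by (simp add: bounded_linear_Blinfun_apply[OF assms])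
  then show ?thesis using E by blast
qed

lemma continuous_on_blinfun_flow:
  assumes "smooth_on UNIV E" "continuous_on Z f" "continuous_on Z g"
  shows "continuous_on Z (\<lambda>z. blinfun_apply (E (f z)) (g z))"
  by (intro bounded_bilinear.continuous_on[OF bounded_bilinear_blinfun_apply] assms
     continuous_on_compose2[OF smooth_on_continuous[OF assms(1)] assms(2)]) auto

lemma blinfun_curve_derivative:
  assumes "(g has_vector_derivative v) (at x)"
  shows "((\<lambda>x. blinfun_apply E (g x)) has_vector_derivative blinfun_apply E v) (at x)"
  by (rule bounded_linear.has_vector_derivative[OF blinfun.bounded_linear_right assms])

context linear_equation
begin

text \<open>
  The flow is the projective map induced by \<open>exp (t L)\<close>. A line is the image of a curve \<open>h\<close> in homogeneous
  coordinates with \<open>h'' = 0\<close>, and so is its image. The slope is the quotient of the \<open>2 \<times> 2\<close> minors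
  \<open>U1 T - T1 U\<close> and \<open>X1 T - X T1\<close> of \<open>h\<close> and \<open>h'\<close>, both constant in \<open>x\<close>.
\<close>

lemma projective_symmetry:
  assumes flat: "\<And>x. x \<in> I \<Longrightarrow> \<beta> x = 0"
    and X: "\<And>p. p \<in> M \<Longrightarrow> X p = projective_field (k0, k1, k2, \<mu>, \<nu>, c1, c2, d0, d1) p"
  shows "curve_symmetry M S X"
proof -
  define L :: "real \<times> complex \<times> real \<Rightarrow> real \<times> complex \<times> real" where
    "L = (\<lambda>v. (k0 * snd (snd v) + k1 * fst v + \<mu> \<bullet> fst (snd v),
       Re (fst (snd v)) *\<^sub>R c1 + Im (fst (snd v)) *\<^sub>R c2 + snd (snd v) *\<^sub>R d0 + fst v *\<^sub>R d1,
       - (k2 * fst v) - \<nu> \<bullet> fst (snd v)))"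
  have "linear L"
    by (rule linearI) (simp_all add: L_def inner_add_right algebra_simps)
  then have "bounded_linear L" by (rule linear_conv_bounded_linear[THEN iffD1])
  from linear_orbit_exists[OF this] obtain E where E0: "E 0 = id_blinfun" and smE: "smooth_on UNIV E"
    and dE: "\<And>v t. ((\<lambda>s. blinfun_apply (E s) v) has_vector_derivative L (blinfun_apply (E t) v)) (at t)" by blast
  define h where "h = (\<lambda>t q. blinfun_apply (E t) (fst q, snd q :: complex, 1))"
  define Xh Uh Th where "Xh = (\<lambda>t q. fst (h t q))" and "Uh = (\<lambda>t q. fst (snd (h t q)))" and "Th = (\<lambda>t q. snd (snd (h t q)))"
  define \<phi> :: "real \<Rightarrow> cpoint \<Rightarrow> cpoint" where
    "\<phi> = (\<lambda>t q. (Xh t q * inverse (Th t q), inverse (Th t q) *\<^sub>R Uh t q))"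
  let ?D = "UNIV \<times> M :: (real \<times> cpoint) set"
  have opD: "open ?D" by (intro open_Times open_UNIV open_M)
  have smh: "smooth_on ?D (\<lambda>z. h (fst z) (snd z))"
    unfolding h_def by (intro smooth_on_blinfun_apply smE smooth_intros opD)
  define V where "V = ?D \<inter> (\<lambda>z. Th (fst z) (snd z)) -` {0<..}"
  have smT: "smooth_on ?D (\<lambda>z. Th (fst z) (snd z))"
    unfolding Th_def by (intro smooth_on_snd smh opD)
  have opV: "open V"
    unfolding V_def by (rule continuous_open_preimage[OF smooth_on_continuous[OF smT] opD open_greaterThan])
  have VD: "V \<subseteq> ?D" by (auto simp: V_def)
  have smhV: "smooth_on V (\<lambda>z. h (fst z) (snd z))" by (rule smooth_on_subset[OF smh opD opV VD])
  have sm\<phi>V: "smooth_on V (\<lambda>z. \<phi> (fst z) (snd z))"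
    unfolding \<phi>_def Xh_def Uh_def Th_def
    by (intro smooth_on_Pair smooth_on_mult smooth_on_scaleR smooth_on_inverse smooth_on_fst smooth_on_snd smhV opV)
       (auto simp: V_def Th_def)
  define W where "W = V \<inter> (\<lambda>z. \<phi> (fst z) (snd z)) -` M"
  have opW: "open W"
    unfolding W_def by (rule continuous_open_preimage[OF smooth_on_continuous[OF sm\<phi>V] opV open_M])
  have sm\<phi>: "smooth_on W (\<lambda>(t, q). \<phi> t q)"
    unfolding case_prod_beta' by (rule smooth_on_subset[OF sm\<phi>V opV opW]) (auto simp: W_def)
  have WD: "q \<in> M \<and> \<phi> t q \<in> M" and WT: "Th t q > 0" if "(t, q) \<in> W" for t q
    using that by (auto simp: W_def V_def)
  have \<phi>0: "\<phi> 0 q = q" for q by (simp add: \<phi>_def Xh_def Uh_def Th_def h_def E0)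
  have W0: "(0, q) \<in> W" if "q \<in> M" for q
    using that by (simp add: W_def V_def \<phi>0) (simp add: Th_def h_def E0)
  have der: "((\<lambda>s. \<phi> s q) has_vector_derivative X (\<phi> t q)) (at t)" if "(t, q) \<in> W" for t q
  proof -
    define r where "r = inverse (Th t q)"
    have T: "Th t q \<noteq> 0" using WT[OF that] by simp
    have rT: "r * Th t q = 1" using T by (simp add: r_def)
    have dh: "((\<lambda>s. h s q) has_vector_derivative L (h t q)) (at t)" unfolding h_def by (rule dE)
    have dX: "((\<lambda>s. Xh s q) has_real_derivative fst (L (h t q))) (at t)"
      unfolding Xh_def has_real_derivative_iff_has_vector_derivative
      by (rule bounded_linear.has_vector_derivative[OF bounded_linear_fst dh])
    have dU: "((\<lambda>s. Uh s q) has_vector_derivative fst (snd (L (h t q)))) (at t)"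
      unfolding Uh_def
      by (rule bounded_linear.has_vector_derivative[OF bounded_linear_fst bounded_linear.has_vector_derivative[OF bounded_linear_snd dh]])
    have dT: "((\<lambda>s. Th s q) has_real_derivative snd (snd (L (h t q)))) (at t)"
      unfolding Th_def has_real_derivative_iff_has_vector_derivative
      by (rule bounded_linear.has_vector_derivative[OF bounded_linear_snd bounded_linear.has_vector_derivative[OF bounded_linear_snd dh]])
    have dr: "((\<lambda>s. inverse (Th s q)) has_real_derivative - (r * snd (snd (L (h t q))) * r)) (at t)"
      unfolding r_def by (rule DERIV_inverse'[OF dT T])
    have d1: "((\<lambda>s. Xh s q * inverse (Th s q)) has_vector_derivative
        (fst (L (h t q)) * r + - (r * snd (snd (L (h t q))) * r) * Xh t q)) (at t)"
      unfolding has_real_derivative_iff_has_vector_derivative[symmetric]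
      using DERIV_mult[OF dX dr] by (simp add: r_def)
    have d2: "((\<lambda>s. inverse (Th s q) *\<^sub>R Uh s q) has_vector_derivative
        (r *\<^sub>R fst (snd (L (h t q))) + - (r * snd (snd (L (h t q))) * r) *\<^sub>R Uh t q)) (at t)"
      using has_vector_derivative_scaleR[OF dr dU] by (simp add: r_def)
    obtain xh uh th where hh: "h t q = (xh, uh, th)" by (cases "h t q")
    have rt: "r * th = 1" using rT by (simp add: Th_def hh)
    have rt': "th * r = 1" "th * (r * y) = y" "r * (th * y) = y" for y
      using rt by (simp_all add: mult.commute)
    have v: "X (\<phi> t q) = projective_field (k0, k1, k2, \<mu>, \<nu>, c1, c2, d0, d1) (xh * r, r *\<^sub>R uh)"
      using X[of "\<phi> t q"] WD[OF that] by (simp add: \<phi>_def r_def Xh_def Uh_def Th_def hh)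
    have "(fst (L (h t q)) * r + - (r * snd (snd (L (h t q))) * r) * Xh t q,
        r *\<^sub>R fst (snd (L (h t q))) + - (r * snd (snd (L (h t q))) * r) *\<^sub>R Uh t q) = X (\<phi> t q)"
      unfolding v projective_field_def L_def hh
      by (simp add: Xh_def Uh_def hh inner_add_left inner_add_right algebra_simps rt rt' power2_eq_square)
    then show ?thesis
      using has_vector_derivative_Pair[OF d1 d2] unfolding \<phi>_def by simp
  qed
  show ?thesis
  proof (rule curve_symmetryI)
    fix p assume p: "p \<in> M"
    obtain \<epsilon> N where pN: "p \<in> N" and flow: "flow_near M X \<epsilon> N \<phi>" and box: "{-\<epsilon><..<\<epsilon>} \<times> N \<subseteq> W"
      by (rule flow_box[OF opW W0[OF p] sm\<phi> WD \<phi>0 der]; (assumption)?)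
    have "moves_solution S \<epsilon> \<phi> J f x0"
      if J: "open_interval J" and jets: "\<forall>x\<in>J. (x, f x, f' x) \<in> G" and f: "solves \<beta> J f f'"
        and gN: "graph J f \<subseteq> N" and x0: "x0 \<in> J" for J f f' x0
    proof -
      define h1 where "h1 = (\<lambda>t x. blinfun_apply (E t) (1::real, f' x, 0::real))"
      define X1 U1 T1 where "X1 = (\<lambda>t x. fst (h1 t x))" and "U1 = (\<lambda>t x. fst (snd (h1 t x)))" and "T1 = (\<lambda>t x. snd (snd (h1 t x)))"
      define c where "c = (\<lambda>x. (x, f x))"
      have cx: "(x, f x) = c x" for x by (simp add: c_def)
      define Dn where "Dn = (\<lambda>t x. X1 t x * Th t (c x) - Xh t (c x) * T1 t x)"
      define a1 where "a1 = (\<lambda>t x. (inverse (Th t (c x)))\<^sup>2 * Dn t x)"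
      define P where "P = (\<lambda>t x. inverse (Dn t x) *\<^sub>R (Th t (c x) *\<^sub>R U1 t x - T1 t x *\<^sub>R Uh t (c x)))"
      have inW: "(t, c x) \<in> W" if "t \<in> {-\<epsilon><..<\<epsilon>}" "x \<in> J" for t x
      proof -
        have "c x \<in> N" using gN that by (auto simp: c_def graph_def)
        then show ?thesis using subsetD[OF box, of "(t, c x)"] that by simp
      qed
      have T: "Th t (c x) > 0" and inM: "\<phi> t (c x) \<in> M" if "t \<in> {-\<epsilon><..<\<epsilon>}" "x \<in> J" for t x
        using WT[OF inW[OF that]] WD[OF inW[OF that]] by simp_all
      have f'': "(f' has_vector_derivative 0) (at x)" if "x \<in> J" for x
        using solvesD(2)[OF f that] flat[of x] G_I[of x "f x" "f' x"] jets that by simp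
      have dh: "((\<lambda>x. h t (c x)) has_vector_derivative h1 t x) (at x)" if "x \<in> J" for t x
        unfolding h_def h1_def c_def fst_conv snd_conv
        by (intro blinfun_curve_derivative has_vector_derivative_Pair has_vector_derivative_id
            has_vector_derivative_const solvesD(1)[OF f that])
      have dh1: "((\<lambda>x. h1 t x) has_vector_derivative 0) (at x)" if "x \<in> J" for t x
        unfolding h1_def
        using blinfun_curve_derivative[OF has_vector_derivative_Pair[OF has_vector_derivative_const[of 1]
             has_vector_derivative_Pair[OF f''[OF that] has_vector_derivative_const[of 0]]], of "E t"]
        by (simp add: zero_prod_def[symmetric] blinfun.zero_right)
      note fs = bounded_linear.has_vector_derivative[OF bounded_linear_fst]
        and sn = bounded_linear.has_vector_derivative[OF bounded_linear_snd]
      have dX: "((\<lambda>x. Xh t (c x)) has_real_derivative X1 t x) (at x)"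
        and dT: "((\<lambda>x. Th t (c x)) has_real_derivative T1 t x) (at x)"
        and dU: "((\<lambda>x. Uh t (c x)) has_vector_derivative U1 t x) (at x)"
        and dX1: "((\<lambda>x. X1 t x) has_real_derivative 0) (at x)"
        and dT1: "((\<lambda>x. T1 t x) has_real_derivative 0) (at x)"
        and dU1: "((\<lambda>x. U1 t x) has_vector_derivative 0) (at x)" if "x \<in> J" for t x
        using fs[OF dh[OF that]] fs[OF sn[OF dh[OF that]]] sn[OF sn[OF dh[OF that]]]
          fs[OF dh1[OF that]] fs[OF sn[OF dh1[OF that]]] sn[OF sn[OF dh1[OF that]]]
        by (simp_all add: Xh_def Uh_def Th_def X1_def U1_def T1_def has_real_derivative_iff_has_vector_derivative)
      show ?thesis
      proof (rule solutions_moved_by_flow[OF flow J _ f gN x0, where ?a1.0 = a1 and P = P])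
        fix t x assume t: "t \<in> {-\<epsilon><..<\<epsilon>}" and x: "x \<in> J"
        have T0: "Th t (c x) \<noteq> 0" using T[OF t x] by simp
        have dr: "((\<lambda>x. inverse (Th t (c x))) has_real_derivative - (inverse (Th t (c x)) * T1 t x * inverse (Th t (c x)))) (at x)"
          by (rule DERIV_inverse'[OF dT[OF x, of t] T0])
        show "((\<lambda>x. fst (\<phi> t (x, f x))) has_real_derivative a1 t x) (at x)"
          using DERIV_mult[OF dX[OF x, of t] dr] T0
          by (simp add: \<phi>_def cx a1_def Dn_def field_simps power2_eq_square)
        assume "a1 t x > 0"
        then have D0: "Dn t x \<noteq> 0" by (auto simp: a1_def)
        have "inverse (Th t (c x)) *\<^sub>R U1 t x + - (inverse (Th t (c x)) * T1 t x * inverse (Th t (c x))) *\<^sub>R Uh t (c x) = a1 t x *\<^sub>R P t x"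
        proof -
          have e: "a1 t x * (inverse (Dn t x) * Th t (c x)) = inverse (Th t (c x))"
            "a1 t x * (inverse (Dn t x) * T1 t x) = inverse (Th t (c x)) * T1 t x * inverse (Th t (c x))"
            using D0 T0 by (simp_all add: a1_def field_simps power2_eq_square)
          have "a1 t x *\<^sub>R P t x = (a1 t x * (inverse (Dn t x) * Th t (c x))) *\<^sub>R U1 t x
              - (a1 t x * (inverse (Dn t x) * T1 t x)) *\<^sub>R Uh t (c x)"
            by (simp add: P_def scaleR_diff_right mult.assoc)
          then show ?thesis unfolding e by simp
        qed
        then show "((\<lambda>x. snd (\<phi> t (x, f x))) has_vector_derivative a1 t x *\<^sub>R P t x) (at x)"
          using has_vector_derivative_scaleR[OF dr dU[OF x, of t]] by (simp add: \<phi>_def cx)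
        have dD: "((\<lambda>x. Dn t x) has_real_derivative 0) (at x)"
          using DERIV_diff[OF DERIV_mult[OF dX1[OF x, of t] dT[OF x, of t]] DERIV_mult[OF dX[OF x, of t] dT1[OF x, of t]]]
          by (simp add: Dn_def[abs_def] mult.commute)
        have dN: "((\<lambda>x. Th t (c x) *\<^sub>R U1 t x - T1 t x *\<^sub>R Uh t (c x)) has_vector_derivative 0) (at x)"
          using has_vector_derivative_diff[OF has_vector_derivative_scaleR[OF dT[OF x, of t] dU1[OF x, of t]]
            has_vector_derivative_scaleR[OF dT1[OF x, of t] dU[OF x, of t]]]
          by simp
        have "(P t has_vector_derivative 0) (at x)"
          using has_vector_derivative_scaleR[OF DERIV_inverse'[OF dD D0] dN] by (simp add: P_def)
        moreover have "\<beta> (fst (\<phi> t (x, f x))) = 0" using flat inM[OF t x] by (auto simp: c_def)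
        ultimately show "(P t has_vector_derivative a1 t x *\<^sub>R (\<i> * \<beta> (fst (\<phi> t (x, f x))) * snd (\<phi> t (x, f x)))) (at x)"
          by simp
      next
        fix x assume "x \<in> J"
        show "a1 0 x = 1 \<and> P 0 x = f' x"
          by (simp add: a1_def P_def Dn_def X1_def T1_def U1_def Th_def Xh_def Uh_def h_def h1_def E0 c_def)
      next
        have cf: "continuous_on Z (\<lambda>z. f (snd z))" "continuous_on Z (\<lambda>z. f' (snd z))" if "Z \<subseteq> {-\<epsilon><..<\<epsilon>} \<times> J" for Z
          by (rule continuous_on_compose2[OF solves_continuous(1)[OF f] continuous_on_snd[OF continuous_on_id]]
                continuous_on_compose2[OF solves_continuous(2)[OF f] continuous_on_snd[OF continuous_on_id]]; use that in auto)+
        have ch: "continuous_on Z (\<lambda>z. h (fst z) (c (snd z)))" "continuous_on Z (\<lambda>z. h1 (fst z) (snd z))"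
          if "Z \<subseteq> {-\<epsilon><..<\<epsilon>} \<times> J" for Z
          unfolding h_def h1_def c_def fst_conv snd_conv
          by (intro continuous_on_blinfun_flow smE continuous_intros cf that)+
        show "continuous_on ({-\<epsilon><..<\<epsilon>} \<times> J) (\<lambda>z. a1 (fst z) (snd z))"
          unfolding a1_def
        proof (intro continuous_intros)
          let ?Z = "{-\<epsilon><..<\<epsilon>} \<times> J"
          show "continuous_on ?Z (\<lambda>z. Dn (fst z) (snd z))"
            unfolding Dn_def X1_def Th_def Xh_def T1_def by (intro continuous_intros ch order_refl)
          show "continuous_on ?Z (\<lambda>z. Th (fst z) (c (snd z)))"
            unfolding Th_def by (intro continuous_intros ch order_refl)
          show "\<forall>z\<in>?Z. Th (fst z) (c (snd z)) \<noteq> 0"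
          proof
            fix z assume "z \<in> ?Z"
            then show "Th (fst z) (c (snd z)) \<noteq> 0" using T[of "fst z" "snd z"] by auto
          qed
        qed
        show "continuous_on {z \<in> {-\<epsilon><..<\<epsilon>} \<times> J. a1 (fst z) (snd z) > 0} (\<lambda>z. P (fst z) (snd z))"
          unfolding P_def
        proof (intro continuous_intros)
          let ?Z = "{z \<in> {-\<epsilon><..<\<epsilon>} \<times> J. a1 (fst z) (snd z) > 0}"
          have Z: "?Z \<subseteq> {-\<epsilon><..<\<epsilon>} \<times> J" by auto
          show "continuous_on ?Z (\<lambda>z. Dn (fst z) (snd z))"
            unfolding Dn_def X1_def Th_def Xh_def T1_def by (intro continuous_intros ch Z)
          show "continuous_on ?Z (\<lambda>z. Th (fst z) (c (snd z)))" "continuous_on ?Z (\<lambda>z. U1 (fst z) (snd z))"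
            "continuous_on ?Z (\<lambda>z. T1 (fst z) (snd z))" "continuous_on ?Z (\<lambda>z. Uh (fst z) (c (snd z)))"
            unfolding Th_def U1_def T1_def Uh_def by (intro continuous_intros ch Z)+
          show "\<forall>z\<in>?Z. Dn (fst z) (snd z) \<noteq> 0" by (auto simp: a1_def)
        qed
      qed (use jets in auto)
    qed
    then show "\<exists>\<epsilon> N \<phi>. p \<in> N \<and> flow_near M X \<epsilon> N \<phi> \<and>
       (\<forall>J f f' x0. open_interval J \<longrightarrow> (\<forall>x\<in>J. (x, f x, f' x) \<in> G) \<longrightarrow> solves \<beta> J f f' \<longrightarrow> graph J f \<subseteq> N \<longrightarrow> x0 \<in> J
          \<longrightarrow> moves_solution S \<epsilon> \<phi> J f x0)"
      using pN flow by (intro exI[of _ \<epsilon>] exI[of _ N] exI[of _ \<phi>] conjI allI impI)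
  qed
qed

text \<open>
  Commuting \<open>q \<partial>\<^sub>x + q'/2 U \<partial>\<^sub>U\<close> with the translation symmetry \<open>d \<partial>\<^sub>U\<close> gives the translation symmetry
  \<open>(q d' - q' d / 2) \<partial>\<^sub>U\<close>. This operator on solutions has a square that is a constant, namely
  \<open>\<i> \<beta> q\<^sup>2 + q'\<^sup>2 / 4 - q q'' / 2\<close>. Hence the translation part of the flow stays in the plane spanned
  by \<open>d\<close> and its image \<open>e\<close>.
\<close>

lemma flow_operator_solves:
  assumes rel: "\<And>x. x \<in> I \<Longrightarrow> beta' x * (k0 + k1 * x + k2 * x\<^sup>2) + 2 * \<beta> x * (k1 + 2 * k2 * x) = 0"
    and d: "solves \<beta> I d d'"
  defines "e \<equiv> \<lambda>x. (k0 + k1 * x + k2 * x\<^sup>2) *\<^sub>R d' x - (k1 / 2 + k2 * x) *\<^sub>R d x"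
  defines "e' \<equiv> \<lambda>x. (k0 + k1 * x + k2 * x\<^sup>2) *\<^sub>R (\<i> * \<beta> x * d x) + (k1 / 2 + k2 * x) *\<^sub>R d' x - k2 *\<^sub>R d x"
  shows "solves \<beta> I e e'"
    and "\<exists>\<kappa>. \<forall>x\<in>I. (k0 + k1 * x + k2 * x\<^sup>2) *\<^sub>R e' x - (k1 / 2 + k2 * x) *\<^sub>R e x = \<kappa> * d x"
proof -
  define q h where "q = (\<lambda>x. k0 + k1 * x + k2 * x\<^sup>2)" and "h = (\<lambda>x. k1 / 2 + k2 * x)"
  have dq: "(q has_real_derivative 2 * h x) (at x)" for x
    unfolding q_def h_def by (auto intro!: derivative_eq_intros simp: algebra_simps)
  have dh: "(h has_real_derivative k2) (at x)" for x
    unfolding h_def by (auto intro!: derivative_eq_intros)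
  have e: "e = (\<lambda>x. q x *\<^sub>R d' x - h x *\<^sub>R d x)" and e': "e' = (\<lambda>x. q x *\<^sub>R (\<i> * \<beta> x * d x) + h x *\<^sub>R d' x - k2 *\<^sub>R d x)"
    by (simp_all add: e_def e'_def q_def h_def)
  have rel': "beta' x * q x + 4 * \<beta> x * h x = 0" if "x \<in> I" for x
    using rel[OF that] by (simp add: q_def h_def algebra_simps)
  show "solves \<beta> I e e'"
    unfolding solves_def
  proof (intro ballI conjI)
    fix x assume x: "x \<in> I"
    note D = solvesD[OF d x]
    have "(e has_vector_derivative (q x *\<^sub>R (\<i> * \<beta> x * d x) + (2 * h x) *\<^sub>R d' x) - (h x *\<^sub>R d' x + k2 *\<^sub>R d x)) (at x)"
      unfolding e by (intro has_vector_derivative_diff has_vector_derivative_scaleR dq dh D)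
    moreover have "(q x *\<^sub>R (\<i> * \<beta> x * d x) + (2 * h x) *\<^sub>R d' x) - (h x *\<^sub>R d' x + k2 *\<^sub>R d x) = e' x"
      by (simp add: e' algebra_simps scaleR_conv_of_real)
    ultimately show "(e has_vector_derivative e' x) (at x)" by simp
    have "(e' has_vector_derivative (q x *\<^sub>R (\<i> * \<beta> x * d' x + \<i> * complex_of_real (beta' x) * d x) + (2 * h x) *\<^sub>R (\<i> * \<beta> x * d x))
        + (h x *\<^sub>R (\<i> * \<beta> x * d x) + k2 *\<^sub>R d' x) - k2 *\<^sub>R d' x) (at x)"
      unfolding e'
      by (intro has_vector_derivative_diff has_vector_derivative_add has_vector_derivative_scaleR dq dh D
          has_vector_derivative_mult has_vector_derivative_mult_right beta_vector_derivative x
          bounded_linear.has_vector_derivative[OF bounded_linear_scaleR_right])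
    moreover have "(q x *\<^sub>R (\<i> * \<beta> x * d' x + \<i> * complex_of_real (beta' x) * d x) + (2 * h x) *\<^sub>R (\<i> * \<beta> x * d x))
        + (h x *\<^sub>R (\<i> * \<beta> x * d x) + k2 *\<^sub>R d' x) - k2 *\<^sub>R d' x
      = \<i> * \<beta> x * e x + \<i> * complex_of_real (beta' x * q x + 4 * \<beta> x * h x) * d x"
      by (simp add: e algebra_simps scaleR_conv_of_real)
    ultimately show "(e' has_vector_derivative \<i> * \<beta> x * e x) (at x)" using rel'[OF x] by simp
  qed
  define \<kappa> where "\<kappa> = (\<lambda>x. \<i> * complex_of_real (\<beta> x * (q x)\<^sup>2) + complex_of_real ((h x)\<^sup>2 - k2 * q x))"
  have "\<exists>c. \<forall>x\<in>I. \<kappa> x = c"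
  proof -
    have cvx: "convex I" using open_interval_I by (simp add: open_interval_def is_interval_convex)
    have "(\<kappa> has_vector_derivative 0) (at x within I)" if x: "x \<in> I" for x
    proof -
      have "((\<lambda>x. \<beta> x * (q x)\<^sup>2) has_real_derivative q x * (beta' x * q x + 4 * \<beta> x * h x)) (at x)"
        by (rule DERIV_cong[OF DERIV_mult[OF beta_derivative[OF x] DERIV_power[OF dq, of 2]]])
           (simp add: algebra_simps power2_eq_square)
      then have 1: "((\<lambda>x. complex_of_real (\<beta> x * (q x)\<^sup>2)) has_vector_derivative 0) (at x)"
        using rel'[OF x] by (auto dest: has_vector_derivative_of_real)
      have "((\<lambda>x. (h x)\<^sup>2 - k2 * q x) has_real_derivative 0) (at x)"
        by (rule DERIV_cong[OF DERIV_diff[OF DERIV_power[OF dh, of 2] DERIV_cmult[OF dq, of k2]]]) simp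
      then have 2: "((\<lambda>x. complex_of_real ((h x)\<^sup>2 - k2 * q x)) has_vector_derivative 0) (at x)"
        by (auto dest: has_vector_derivative_of_real)
      show ?thesis
        unfolding \<kappa>_def
        using has_vector_derivative_add[OF has_vector_derivative_mult_right[OF 1, of \<i>] 2] has_vector_derivative_at_within by fastforce
    qed
    from has_vector_derivative_zero_constant[OF cvx this] obtain c where "\<And>x. x \<in> I \<Longrightarrow> \<kappa> x = c" by auto
    then show ?thesis by auto
  qed
  then obtain c where c: "\<And>x. x \<in> I \<Longrightarrow> \<kappa> x = c" by blast
  have "q x *\<^sub>R e' x - h x *\<^sub>R e x = \<kappa> x * d x" for x
    by (simp add: e e' \<kappa>_def scaleR_conv_of_real algebra_simps power2_eq_square)
  then show "\<exists>\<kappa>. \<forall>x\<in>I. (k0 + k1 * x + k2 * x\<^sup>2) *\<^sub>R e' x - (k1 / 2 + k2 * x) *\<^sub>R e x = \<kappa> * d x"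
    using c unfolding q_def h_def by metis
qed

text \<open>
  The flow maps \<open>x\<close> to \<open>X/T\<close>, where \<open>(X, T)\<close> is a linear flow of trace zero on the plane, and \<open>u\<close> to
  \<open>g u / T + A d + B e\<close> with the solutions \<open>d, e\<close> taken at \<open>X/T\<close>. The functions \<open>A, B\<close> of \<open>t\<close>
  satisfy \<open>A' = c A - \<kappa> B + 1\<close>, \<open>B' = c B - A\<close>, a linear equation with constant coefficients. Since the determinant of the
  \<open>(X, T)\<close>-flow is 1, \<open>x \<mapsto> X/T\<close> has derivative \<open>1/T\<^sup>2\<close>. Solutions go to solutions because \<open>\<beta> dx\<^sup>2\<close> is
  invariant under this map, which is the flow version of \<open>q \<beta>' + 2 q' \<beta> = 0\<close>.
\<close>

lemma quadratic_symmetry: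
  assumes rel: "\<And>x. x \<in> I \<Longrightarrow> beta' x * (k0 + k1 * x + k2 * x\<^sup>2) + 2 * \<beta> x * (k1 + 2 * k2 * x) = 0"
    and d: "solves \<beta> I d d'"
    and X: "\<And>x (u::complex). (x, u) \<in> M \<Longrightarrow> X (x, u) = (k0 + k1 * x + k2 * x\<^sup>2, complex_of_real (k1 / 2 + k2 * x) * u + c * u + d x)"
  shows "curve_symmetry M S X"
proof -
  define e where "e = (\<lambda>x. (k0 + k1 * x + k2 * x\<^sup>2) *\<^sub>R d' x - (k1 / 2 + k2 * x) *\<^sub>R d x)"
  define e' where "e' = (\<lambda>x. (k0 + k1 * x + k2 * x\<^sup>2) *\<^sub>R (\<i> * \<beta> x * d x) + (k1 / 2 + k2 * x) *\<^sub>R d' x - k2 *\<^sub>R d x)"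
  have se: "solves \<beta> I e e'" unfolding e_def e'_def by (rule flow_operator_solves(1)[OF rel d])
  obtain \<kappa> where \<kappa>: "\<And>x. x \<in> I \<Longrightarrow> (k0 + k1 * x + k2 * x\<^sup>2) *\<^sub>R e' x - (k1 / 2 + k2 * x) *\<^sub>R e x = \<kappa> * d x"
    using flow_operator_solves(2)[OF rel d] unfolding e_def e'_def by blast
  define q h where "q = (\<lambda>x. k0 + k1 * x + k2 * x\<^sup>2)" and "h = (\<lambda>x. k1 / 2 + k2 * x)"
  have rel': "beta' x * q x + 4 * \<beta> x * h x = 0" if "x \<in> I" for x
    using rel[OF that] by (simp add: q_def h_def algebra_simps)
  have ee: "e x = q x *\<^sub>R d' x - h x *\<^sub>R d x" for x by (simp add: e_def q_def h_def)
  have \<kappa>': "q x *\<^sub>R e' x - h x *\<^sub>R e x = \<kappa> * d x" if "x \<in> I" for x using \<kappa>[OF that] by (simp add: q_def h_def)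
  note smd = solves_smooth[OF open_I d smooth_beta] and sme = solves_smooth[OF open_I se smooth_beta]
  define L :: "real \<times> real \<Rightarrow> real \<times> real" where
    "L = (\<lambda>v. (k0 * snd v + k1 / 2 * fst v, - (k2 * fst v) - k1 / 2 * snd v))"
  have "linear L" by (rule linearI) (simp_all add: L_def algebra_simps)
  then have "bounded_linear L" by (rule linear_conv_bounded_linear[THEN iffD1])
  from linear_orbit_exists[OF this] obtain E where E0: "E 0 = id_blinfun" and smE: "smooth_on UNIV E"
    and dE: "\<And>v t. ((\<lambda>s. blinfun_apply (E s) v) has_vector_derivative L (blinfun_apply (E t) v)) (at t)" by blast
  \<comment> \<open>The component \<open>w\<close> stays equal to 1 and makes the equations for \<open>A\<close> and \<open>B\<close> homogeneous; \<open>g\<close> is \<open>exp (c t)\<close>.\<close>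
  define Q :: "complex \<times> complex \<times> complex \<times> complex \<Rightarrow> complex \<times> complex \<times> complex \<times> complex" where
    "Q = (\<lambda>(A, B, w, g). (c * A - \<kappa> * B + w, c * B - A, 0, c * g))"
  have "linear Q" by (rule linearI) (auto simp: Q_def algebra_simps scaleR_conv_of_real)
  then have "bounded_linear Q" by (rule linear_conv_bounded_linear[THEN iffD1])
  from linear_orbit_exists[OF this] obtain F where F0: "F 0 = id_blinfun" and smF: "smooth_on UNIV F"
    and dF: "\<And>v t. ((\<lambda>s. blinfun_apply (F s) v) has_vector_derivative Q (blinfun_apply (F t) v)) (at t)" by blast
  define orb where "orb = (\<lambda>t. blinfun_apply (F t) (0, 0, 1, 1))"
  define A B w g where "A = (\<lambda>t. fst (orb t))" and "B = (\<lambda>t. fst (snd (orb t)))"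
    and "w = (\<lambda>t. fst (snd (snd (orb t))))" and "g = (\<lambda>t. snd (snd (snd (orb t))))"
  note fs = bounded_linear.has_vector_derivative[OF bounded_linear_fst]
    and sn = bounded_linear.has_vector_derivative[OF bounded_linear_snd]
  have dorb: "(orb has_vector_derivative (c * A t - \<kappa> * B t + w t, c * B t - A t, 0, c * g t)) (at t)" for t
    using dF[of "(0, 0, 1, 1)" t] unfolding A_def B_def w_def g_def Q_def orb_def by (simp add: case_prod_beta')
  have "(w has_vector_derivative 0) (at t within UNIV)" for t
    using fs[OF sn[OF sn[OF dorb[of t]]]] unfolding w_def by simp
  from has_vector_derivative_zero_constant[OF convex_UNIV this] have "w t = w 0" for t by (metis UNIV_I)
  moreover have init: "A 0 = 0" "B 0 = 0" "w 0 = 1" "g 0 = 1" by (simp_all add: A_def B_def w_def g_def orb_def F0)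
  ultimately have w: "w t = 1" for t by simp
  have dA: "(A has_vector_derivative c * A t - \<kappa> * B t + 1) (at t)" and dB: "(B has_vector_derivative c * B t - A t) (at t)"
    and dg: "(g has_vector_derivative c * g t) (at t)" for t
    using fs[OF dorb[of t]] fs[OF sn[OF dorb[of t]]] sn[OF sn[OF sn[OF dorb[of t]]]] w[of t]
    unfolding A_def B_def g_def by simp_all
  have smo: "smooth_on UNIV orb"
    unfolding orb_def by (intro smooth_on_blinfun_apply[OF open_UNIV smF] smooth_intros open_UNIV)
  have smA: "smooth_on UNIV A" and smB: "smooth_on UNIV B" and smg: "smooth_on UNIV g"
    unfolding A_def B_def g_def by (intro smooth_on_fst smooth_on_snd smo open_UNIV)+
  define Xh Th where "Xh = (\<lambda>t x. fst (blinfun_apply (E t) (x, 1)))" and "Th = (\<lambda>t x. snd (blinfun_apply (E t) (x, 1)))"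
  define X1 T1 where "X1 = (\<lambda>t. fst (blinfun_apply (E t) (1, 0)))" and "T1 = (\<lambda>t. snd (blinfun_apply (E t) (1, 0)))"
  have tX: "((\<lambda>t. Xh t x) has_real_derivative k0 * Th t x + k1 / 2 * Xh t x) (at t)"
    and tT: "((\<lambda>t. Th t x) has_real_derivative - (k2 * Xh t x) - k1 / 2 * Th t x) (at t)"
    and tX1: "(X1 has_real_derivative k0 * T1 t + k1 / 2 * X1 t) (at t)"
    and tT1: "(T1 has_real_derivative - (k2 * X1 t) - k1 / 2 * T1 t) (at t)" for t x
    using fs[OF dE[of "(x, 1)" t]] sn[OF dE[of "(x, 1)" t]] fs[OF dE[of "(1, 0)" t]] sn[OF dE[of "(1, 0)" t]]
    unfolding Xh_def Th_def X1_def T1_def L_def has_real_derivative_iff_has_vector_derivative by simp_all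
  have init': "Xh 0 x = x" "Th 0 x = 1" "X1 0 = 1" "T1 0 = 0" for x
    by (simp_all add: Xh_def Th_def X1_def T1_def E0)
  have det1: "X1 t * Th t x - Xh t x * T1 t = 1" for t x
  proof -
    have "((\<lambda>t. X1 t * Th t x - Xh t x * T1 t) has_real_derivative 0) (at t)" for t
      by (rule DERIV_cong[OF DERIV_diff[OF DERIV_mult[OF tX1 tT] DERIV_mult[OF tX tT1]]]) (simp add: algebra_simps)
    then have "X1 t * Th t x - Xh t x * T1 t = X1 0 * Th 0 x - Xh 0 x * T1 0"
      by (rule DERIV_isconst_all[rule_format])
    then show ?thesis by (simp add: init')
  qed
  define m where "m = (\<lambda>t x. Xh t x * inverse (Th t x))"
  define \<phi> :: "real \<Rightarrow> cpoint \<Rightarrow> cpoint" where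
    "\<phi> = (\<lambda>t p. (m t (fst p), inverse (Th t (fst p)) *\<^sub>R (g t * snd p) + (A t * d (m t (fst p)) + B t * e (m t (fst p)))))"
  let ?D = "UNIV \<times> M :: (real \<times> cpoint) set"
  have opD: "open ?D" by (intro open_Times open_UNIV open_M)
  have smh: "smooth_on ?D (\<lambda>z. blinfun_apply (E (fst z)) (fst (snd z), 1))"
    by (intro smooth_on_blinfun_apply smE smooth_intros opD)
  have smX: "smooth_on ?D (\<lambda>z. Xh (fst z) (fst (snd z)))" and smT: "smooth_on ?D (\<lambda>z. Th (fst z) (fst (snd z)))"
    unfolding Xh_def Th_def by (intro smooth_on_fst[OF opD] smooth_on_snd[OF opD] smh)+
  define V0 where "V0 = ?D \<inter> (\<lambda>z. Th (fst z) (fst (snd z))) -` {0<..}"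
  have opV0: "open V0"
    unfolding V0_def by (rule continuous_open_preimage[OF smooth_on_continuous[OF smT] opD open_greaterThan])
  have smm: "smooth_on V0 (\<lambda>z. m (fst z) (fst (snd z)))"
    unfolding m_def
    by (intro smooth_on_mult smooth_on_inverse opV0 smooth_on_subset[OF smX opD opV0] smooth_on_subset[OF smT opD opV0])
       (auto simp: V0_def)
  define V where "V = V0 \<inter> (\<lambda>z. m (fst z) (fst (snd z))) -` I"
  have opV: "open V" unfolding V_def by (rule continuous_open_preimage[OF smooth_on_continuous[OF smm] opV0 open_I])
  have smV: "smooth_on V (\<lambda>z. k (m (fst z) (fst (snd z))))" if "smooth_on I k" for k :: "real \<Rightarrow> complex"
    by (rule smooth_on_compose[OF opV open_I _ smooth_on_subset[OF smm opV0 opV] that]) (auto simp: V_def)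
  have smt: "smooth_on V (\<lambda>z. k (fst z))" if "smooth_on UNIV k" for k :: "real \<Rightarrow> complex"
    by (rule smooth_on_compose[OF opV open_UNIV _ smooth_on_fst[OF opV smooth_on_ident[OF opV]] that]) auto
  have sm\<phi>V: "smooth_on V (\<lambda>z. \<phi> (fst z) (snd z))"
    unfolding \<phi>_def
    by (intro smooth_on_Pair smooth_on_add smooth_on_mult smooth_on_scaleR smooth_on_inverse smV smt smd sme smA smB smg opV
        smooth_on_subset[OF smm opV0 opV] smooth_on_subset[OF smT opD opV] smooth_on_snd smooth_on_ident)
       (auto simp: V_def V0_def)
  define W where "W = V \<inter> (\<lambda>z. \<phi> (fst z) (snd z)) -` M"
  have opW: "open W"
    unfolding W_def by (rule continuous_open_preimage[OF smooth_on_continuous[OF sm\<phi>V] opV open_M])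
  have sm\<phi>: "smooth_on W (\<lambda>(t, q). \<phi> t q)"
    unfolding case_prod_beta' by (rule smooth_on_subset[OF sm\<phi>V opV opW]) (auto simp: W_def)
  have WD: "q \<in> M \<and> \<phi> t q \<in> M" and WT: "Th t (fst q) > 0" and WI: "m t (fst q) \<in> I" if "(t, q) \<in> W" for t q
    using that by (auto simp: W_def V_def V0_def)
  have \<phi>0: "\<phi> 0 q = q" for q by (simp add: \<phi>_def m_def init init')
  have W0: "(0, q) \<in> W" if "q \<in> M" for q
    using that by (auto simp: W_def V_def V0_def \<phi>0 init' m_def)
  have dr: "((\<lambda>t. inverse (Th t x)) has_real_derivative h (m t x) * inverse (Th t x)) (at t)" if "Th t x > 0" for t x
  proof -
    have "Th t x \<noteq> 0" using that by simp
    then show ?thesis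
      by (intro DERIV_cong[OF DERIV_inverse'[OF tT]]) (auto simp: h_def m_def field_simps)
  qed
  have dm: "((\<lambda>t. m t x) has_real_derivative q (m t x)) (at t)" if "Th t x > 0" for t x
  proof -
    have "Th t x \<noteq> 0" using that by simp
    then show ?thesis
      unfolding m_def by (intro DERIV_cong[OF DERIV_mult[OF tX dr[OF that]]]) (auto simp: h_def m_def q_def field_simps power2_eq_square)
  qed
  have der: "((\<lambda>s. \<phi> s p) has_vector_derivative X (\<phi> t p)) (at t)" if "(t, p) \<in> W" for t p
  proof -
    obtain x u where p: "p = (x, u)" by (cases p)
    have T: "Th t x > 0" and mI: "m t x \<in> I" using WT[OF that] WI[OF that] by (simp_all add: p)
    define r where "r = inverse (Th t x)"
    define y where "y = m t x"
    have yI: "y \<in> I" using mI by (simp add: y_def)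
    have dmv: "((\<lambda>s. m s x) has_vector_derivative q y) (at t)"
      using dm[OF T] by (simp add: y_def has_real_derivative_iff_has_vector_derivative)
    have dk: "((\<lambda>s. k (m s x)) has_vector_derivative q y *\<^sub>R k' y) (at t)" if "solves \<beta> I k k'" for k k'
      using vector_diff_chain_at[OF dmv, of k "k' y"] solvesD(1)[OF that yI] by (simp add: o_def y_def)
    have dgu: "((\<lambda>s. g s * u) has_vector_derivative c * g t * u) (at t)"
      by (rule has_vector_derivative_mult_left[OF dg])
    have "((\<lambda>s. inverse (Th s x) *\<^sub>R (g s * u) + (A s * d (m s x) + B s * e (m s x))) has_vector_derivative
        (r *\<^sub>R (c * g t * u) + (h y * r) *\<^sub>R (g t * u)) +
        ((A t * (q y *\<^sub>R d' y) + (c * A t - \<kappa> * B t + 1) * d y) + (B t * (q y *\<^sub>R e' y) + (c * B t - A t) * e y))) (at t)"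
      unfolding r_def y_def
      by (intro has_vector_derivative_add has_vector_derivative_mult has_vector_derivative_scaleR dr T dgu dA dB dk[unfolded y_def] d se)
    moreover have "(r *\<^sub>R (c * g t * u) + (h y * r) *\<^sub>R (g t * u)) +
        ((A t * (q y *\<^sub>R d' y) + (c * A t - \<kappa> * B t + 1) * d y) + (B t * (q y *\<^sub>R e' y) + (c * B t - A t) * e y))
      = h y * (r *\<^sub>R (g t * u) + (A t * d y + B t * e y)) + c * (r *\<^sub>R (g t * u) + (A t * d y + B t * e y)) + d y"
    proof -
      have 1: "q y *\<^sub>R d' y = e y + h y *\<^sub>R d y" by (simp add: ee)
      have 2: "q y *\<^sub>R e' y = \<kappa> * d y + h y *\<^sub>R e y" using \<kappa>'[OF yI] by (simp add: algebra_simps)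
      show ?thesis unfolding 1 2 by (simp add: scaleR_conv_of_real algebra_simps)
    qed
    moreover have "X (\<phi> t p) = (q y, h y * (r *\<^sub>R (g t * u) + (A t * d y + B t * e y)) + c * (r *\<^sub>R (g t * u) + (A t * d y + B t * e y)) + d y)"
      using WD[OF that] unfolding \<phi>_def p fst_conv snd_conv r_def[symmetric] y_def[symmetric]
      by (subst X) (auto simp: q_def h_def)
    ultimately show ?thesis
      using has_vector_derivative_Pair[OF dmv] unfolding \<phi>_def p by simp
  qed
  show ?thesis
  proof (rule curve_symmetryI)
    fix p assume p: "p \<in> M"
    obtain \<epsilon> N where pN: "p \<in> N" and flow: "flow_near M X \<epsilon> N \<phi>" and box: "{-\<epsilon><..<\<epsilon>} \<times> N \<subseteq> W"
      by (rule flow_box[OF opW W0[OF p] sm\<phi> WD \<phi>0 der]; (assumption)?)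
    have "moves_solution S \<epsilon> \<phi> J f x0"
      if J: "open_interval J" and jets: "\<forall>x\<in>J. (x, f x, f' x) \<in> G" and f: "solves \<beta> J f f'"
        and gN: "graph J f \<subseteq> N" and x0: "x0 \<in> J" for J f f' x0
    proof -
      define a1 where "a1 = (\<lambda>t x. (inverse (Th t x))\<^sup>2)"
      define P where "P = (\<lambda>t x. Th t x *\<^sub>R (g t * f' x) - T1 t *\<^sub>R (g t * f x) + (A t * d' (m t x) + B t * e' (m t x)))"
      have inW: "(t, (x, f x)) \<in> W" if "t \<in> {-\<epsilon><..<\<epsilon>}" "x \<in> J" for t x
      proof -
        have "(x, f x) \<in> N" using gN that by (auto simp: graph_def)
        then show ?thesis using subsetD[OF box, of "(t, x, f x)"] that by simp
      qed
      have T: "Th t x > 0" and mI: "m t x \<in> I" if "t \<in> {-\<epsilon><..<\<epsilon>}" "x \<in> J" for t x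
        using WT[OF inW[OF that]] WI[OF inW[OF that]] by simp_all
      have invariant: "\<beta> (m t x) * (inverse (Th t x)) ^ 4 = \<beta> x" if t: "t \<in> {-\<epsilon><..<\<epsilon>}" and x: "x \<in> J" for t x
      proof -
        have "((\<lambda>t. \<beta> (m t x) * (inverse (Th t x)) ^ 4) has_real_derivative 0) (at s within {-\<epsilon><..<\<epsilon>})" if s: "s \<in> {-\<epsilon><..<\<epsilon>}" for s
        proof -
          let ?r = "inverse (Th s x)"
          have 1: "((\<lambda>t. \<beta> (m t x)) has_real_derivative beta' (m s x) * q (m s x)) (at s)"
            by (rule DERIV_chain2[OF beta_derivative[OF mI[OF s x]] dm[OF T[OF s x]]])
          have 2: "((\<lambda>t. (inverse (Th t x)) ^ 4) has_real_derivative 4 * ?r ^ 3 * (h (m s x) * ?r)) (at s)"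
            by (rule DERIV_cong[OF DERIV_power[OF dr[OF T[OF s x]], of 4]]) simp
          have "((\<lambda>t. \<beta> (m t x) * (inverse (Th t x)) ^ 4) has_real_derivative 
             ?r ^ 4 * (beta' (m s x) * q (m s x) + 4 * \<beta> (m s x) * h (m s x))) (at s)"
            by (rule DERIV_cong[OF DERIV_mult[OF 1 2]]) (simp add: algebra_simps power4_eq_xxxx power3_eq_cube)
          then show ?thesis using rel'[OF mI[OF s x]] by (simp add: has_field_derivative_at_within)
        qed
        moreover have "convex {-\<epsilon><..<\<epsilon>}" by (rule convex_real_interval)
        ultimately have "\<exists>k. \<forall>s\<in>{-\<epsilon><..<\<epsilon>}. \<beta> (m s x) * (inverse (Th s x)) ^ 4 = k"
          using has_field_derivative_zero_constant by blast
        then obtain k where k: "\<And>s. s \<in> {-\<epsilon><..<\<epsilon>} \<Longrightarrow> \<beta> (m s x) * (inverse (Th s x)) ^ 4 = k" by blast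
        have "0 \<in> {-\<epsilon><..<\<epsilon>}" using flow_nearD(1)[OF flow] by simp
        then show ?thesis using k[of 0] k[OF t] by (simp add: m_def init')
      qed
      have xE: "((\<lambda>x. blinfun_apply (E t) (x, 1)) has_vector_derivative blinfun_apply (E t) (1, 0)) (at x)" for t x
        by (intro blinfun_curve_derivative has_vector_derivative_Pair has_vector_derivative_id has_vector_derivative_const)
      have xX: "((\<lambda>x. Xh t x) has_real_derivative X1 t) (at x)" and xT: "((\<lambda>x. Th t x) has_real_derivative T1 t) (at x)" for t x
        using fs[OF xE[of t x]] sn[OF xE[of t x]]
        unfolding Xh_def Th_def X1_def T1_def has_real_derivative_iff_has_vector_derivative by simp_all
      show ?thesis
      proof (rule solutions_moved_by_flow[OF flow J _ f gN x0, where ?a1.0 = a1 and P = P])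
        fix t x assume t: "t \<in> {-\<epsilon><..<\<epsilon>}" and x: "x \<in> J"
        have T0: "Th t x \<noteq> 0" using T[OF t x] by simp
        define r where "r = inverse (Th t x)"
        have xr: "((\<lambda>x. inverse (Th t x)) has_real_derivative - (r * T1 t * r)) (at x)"
          unfolding r_def by (rule DERIV_inverse'[OF xT T0])
        have xm: "((\<lambda>x. m t x) has_real_derivative a1 t x) (at x)"
        proof -
          have "X1 t * r + - (r * T1 t * r) * Xh t x = r\<^sup>2 * (X1 t * Th t x - Xh t x * T1 t)"
            using T0 by (simp add: r_def field_simps power2_eq_square)
          then show ?thesis
            using DERIV_mult[OF xX[of t x] xr] unfolding det1 by (simp add: m_def a1_def r_def)
        qed
        then show "((\<lambda>x. fst (\<phi> t (x, f x))) has_real_derivative a1 t x) (at x)" by (simp add: \<phi>_def)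
        have xmv: "((\<lambda>x. m t x) has_vector_derivative a1 t x) (at x)"
          using xm by (simp add: has_real_derivative_iff_has_vector_derivative)
        have xk: "((\<lambda>x. k (m t x)) has_vector_derivative a1 t x *\<^sub>R k' (m t x)) (at x)"
          "((\<lambda>x. k' (m t x)) has_vector_derivative a1 t x *\<^sub>R (\<i> * \<beta> (m t x) * k (m t x))) (at x)" if "solves \<beta> I k k'" for k k'
          using vector_diff_chain_at[OF xmv solvesD(1)[OF that mI[OF t x]]] vector_diff_chain_at[OF xmv solvesD(2)[OF that mI[OF t x]]]
          by (simp_all add: o_def)
        note fd = solvesD[OF f x]
        have "((\<lambda>x. inverse (Th t x) *\<^sub>R (g t * f x) + (A t * d (m t x) + B t * e (m t x))) has_vector_derivative
            (r *\<^sub>R (g t * f' x) + (- (r * T1 t * r)) *\<^sub>R (g t * f x)) +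
            (A t * (a1 t x *\<^sub>R d' (m t x)) + B t * (a1 t x *\<^sub>R e' (m t x)))) (at x)"
          unfolding r_def
          by (intro has_vector_derivative_add has_vector_derivative_mult_right has_vector_derivative_scaleR xr[unfolded r_def] fd xk d se)
        moreover have "(r *\<^sub>R (g t * f' x) + (- (r * T1 t * r)) *\<^sub>R (g t * f x)) +
            (A t * (a1 t x *\<^sub>R d' (m t x)) + B t * (a1 t x *\<^sub>R e' (m t x))) = a1 t x *\<^sub>R P t x"
        proof -
          have "a1 t x * Th t x = r" using T0 by (simp add: a1_def r_def power2_eq_square)
          moreover have "a1 t x = r * r" by (simp add: a1_def r_def power2_eq_square)
          moreover have "a1 t x *\<^sub>R P t x = (a1 t x * Th t x) *\<^sub>R (g t * f' x) - (a1 t x * T1 t) *\<^sub>R (g t * f x)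
             + (A t * (a1 t x *\<^sub>R d' (m t x)) + B t * (a1 t x *\<^sub>R e' (m t x)))"
            by (simp add: P_def scaleR_diff_right scaleR_add_right)
          ultimately show ?thesis by (simp add: mult_ac)
        qed
        ultimately show "((\<lambda>x. snd (\<phi> t (x, f x))) has_vector_derivative a1 t x *\<^sub>R P t x) (at x)"
          by (simp add: \<phi>_def)
        have "(P t has_vector_derivative
            ((Th t x *\<^sub>R (g t * (\<i> * \<beta> x * f x)) + T1 t *\<^sub>R (g t * f' x)) - T1 t *\<^sub>R (g t * f' x)) +
            (A t * (a1 t x *\<^sub>R (\<i> * \<beta> (m t x) * d (m t x))) + B t * (a1 t x *\<^sub>R (\<i> * \<beta> (m t x) * e (m t x))))) (at x)"
          unfolding P_def
          by (intro has_vector_derivative_add has_vector_derivative_diff has_vector_derivative_mult_right has_vector_derivative_scaleR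
              bounded_linear.has_vector_derivative[OF bounded_linear_scaleR_right] xT fd xk d se)
        moreover have "((Th t x *\<^sub>R (g t * (\<i> * \<beta> x * f x)) + T1 t *\<^sub>R (g t * f' x)) - T1 t *\<^sub>R (g t * f' x)) +
            (A t * (a1 t x *\<^sub>R (\<i> * \<beta> (m t x) * d (m t x))) + B t * (a1 t x *\<^sub>R (\<i> * \<beta> (m t x) * e (m t x))))
           = a1 t x *\<^sub>R (\<i> * \<beta> (m t x) * (r *\<^sub>R (g t * f x) + (A t * d (m t x) + B t * e (m t x))))"
        proof -
          have "Th t x * \<beta> x = a1 t x * \<beta> (m t x) * r"
            using T0 unfolding invariant[OF t x, symmetric] a1_def r_def by (simp add: field_simps power4_eq_xxxx power2_eq_square)
          then have "complex_of_real (Th t x) * complex_of_real (\<beta> x) = complex_of_real (a1 t x) * complex_of_real (\<beta> (m t x)) * complex_of_real r"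
            by (metis of_real_mult)
          then have "Th t x *\<^sub>R (g t * (\<i> * \<beta> x * f x)) = a1 t x *\<^sub>R (\<i> * \<beta> (m t x) * (r *\<^sub>R (g t * f x)))"
            by (simp add: scaleR_conv_of_real mult_ac)
          then show ?thesis by (simp add: algebra_simps)
        qed
        ultimately show "(P t has_vector_derivative a1 t x *\<^sub>R (\<i> * \<beta> (fst (\<phi> t (x, f x))) * snd (\<phi> t (x, f x)))) (at x)"
          by (simp add: \<phi>_def r_def)
      next
        fix x assume "x \<in> J"
        show "a1 0 x = 1 \<and> P 0 x = f' x" by (simp add: a1_def P_def init init')
      next
        let ?Z = "{-\<epsilon><..<\<epsilon>} \<times> J"
        have ct: "continuous_on ?Z (\<lambda>z. k (fst z))" if "smooth_on UNIV k" for k :: "real \<Rightarrow> complex"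
          by (rule continuous_on_compose2[OF smooth_on_continuous[OF that] continuous_on_fst[OF continuous_on_id]]) auto
        have cT: "continuous_on ?Z (\<lambda>z. Th (fst z) (snd z))" and cX: "continuous_on ?Z (\<lambda>z. Xh (fst z) (snd z))"
          unfolding Th_def Xh_def by (intro continuous_intros continuous_on_blinfun_flow smE)+
        have cT1: "continuous_on ?Z (\<lambda>z. T1 (fst z))"
          unfolding T1_def by (intro continuous_intros continuous_on_blinfun_flow smE)
        have nz: "\<forall>z\<in>?Z. Th (fst z) (snd z) \<noteq> 0"
        proof
          fix z assume "z \<in> ?Z"
          then show "Th (fst z) (snd z) \<noteq> 0" using T[of "fst z" "snd z"] by auto
        qed
        have cm: "continuous_on ?Z (\<lambda>z. m (fst z) (snd z))"
          unfolding m_def by (intro continuous_intros cT cX nz)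
        have ck: "continuous_on ?Z (\<lambda>z. k (m (fst z) (snd z)))" if "continuous_on I k" for k :: "real \<Rightarrow> complex"
          by (rule continuous_on_compose2[OF that cm]) (use mI in auto)
        have cf: "continuous_on ?Z (\<lambda>z. f (snd z))" "continuous_on ?Z (\<lambda>z. f' (snd z))"
          by (rule continuous_on_compose2[OF solves_continuous(1)[OF f] continuous_on_snd[OF continuous_on_id]]
                continuous_on_compose2[OF solves_continuous(2)[OF f] continuous_on_snd[OF continuous_on_id]]; auto)+
        show "continuous_on ?Z (\<lambda>z. a1 (fst z) (snd z))"
          unfolding a1_def by (intro continuous_intros cT nz)
        have "continuous_on ?Z (\<lambda>z. P (fst z) (snd z))"
          unfolding P_def by (intro continuous_intros cT cT1 ct smA smB smg cf ck solves_continuous[OF d] solves_continuous[OF se])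
        then show "continuous_on {z \<in> ?Z. a1 (fst z) (snd z) > 0} (\<lambda>z. P (fst z) (snd z))"
          by (rule continuous_on_subset) auto
      qed (use jets in auto)
    qed
    then show "\<exists>\<epsilon> N \<phi>. p \<in> N \<and> flow_near M X \<epsilon> N \<phi> \<and>
       (\<forall>J f f' x0. open_interval J \<longrightarrow> (\<forall>x\<in>J. (x, f x, f' x) \<in> G) \<longrightarrow> solves \<beta> J f f' \<longrightarrow> graph J f \<subseteq> N \<longrightarrow> x0 \<in> J
          \<longrightarrow> moves_solution S \<epsilon> \<phi> J f x0)"
      using pN flow by (intro exI[of _ \<epsilon>] exI[of _ N] exI[of _ \<phi>] conjI allI impI)
  qed
qed

end

section \<open>The dimension of the symmetry algebra of the linear equation\<close>

definition pointwise_scale :: "real \<Rightarrow> ('q \<Rightarrow> 'v::real_vector) \<Rightarrow> 'q \<Rightarrow> 'v" where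
  "pointwise_scale c X = (\<lambda>p. c *\<^sub>R X p)"

lemma vector_space_pointwise_scale: "vector_space pointwise_scale"
  by unfold_locales (auto simp: pointwise_scale_def fun_eq_iff algebra_simps)

lemma basis_of_parametrisation:
  fixes F :: "'p::euclidean_space \<Rightarrow> 'q \<Rightarrow> 'v::real_vector"
  assumes add: "\<And>v w. F (v + w) = F v + F w" and scale: "\<And>c v. F (c *\<^sub>R v) = pointwise_scale c (F v)"
    and inj: "\<And>v. F v = 0 \<Longrightarrow> v = 0"
  shows "\<exists>B. finite B \<and> \<not> module.dependent pointwise_scale B \<and> module.span pointwise_scale B = range F \<and> card B = DIM('p)"
proof -
  interpret V: vector_space "pointwise_scale :: real \<Rightarrow> ('q \<Rightarrow> 'v) \<Rightarrow> _" by (rule vector_space_pointwise_scale)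
  have lin: "Vector_Spaces.linear scaleR pointwise_scale F"
    using add scale by unfold_locales auto
  interpret vector_space_pair "scaleR :: real \<Rightarrow> 'p \<Rightarrow> 'p" "pointwise_scale :: real \<Rightarrow> ('q \<Rightarrow> 'v) \<Rightarrow> _"
    by unfold_locales
  have "inj F"
  proof (rule injI)
    fix v w assume "F v = F w"
    then have "F (v - w) = 0"
      using add[of "v - w" w] by simp
    then show "v = w" using inj[of "v - w"] by simp
  qed
  then have inj_sub: "inj_on F U" for U by (rule inj_on_subset) simp
  have "V.independent (F ` Basis)"
    by (rule linear_independent_injective_image[OF lin _ inj_sub])
       (use independent_Basis in \<open>simp add: dependent_raw_def\<close>)
  moreover have "V.span (F ` Basis) = range F"
    using linear_span_image[OF lin, of Basis] by (simp add: span_raw_def[symmetric])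
  moreover have "card (F ` Basis) = DIM('p)" by (rule card_image[OF inj_sub])
  ultimately show ?thesis by (intro exI[of _ "F ` Basis"]) auto
qed

lemma projective_parameters:
  fixes v :: "'a \<times> 'b \<times> 'c \<times> 'd \<times> 'e \<times> 'f \<times> 'g \<times> 'h \<times> 'i"
  obtains k0 k1 k2 \<mu> \<nu> c1 c2 d0 d1 where "v = (k0, k1, k2, \<mu>, \<nu>, c1, c2, d0, d1)"
  by (metis surj_pair)

lemma symmetry_fieldsD:
  assumes "X \<in> symmetry_fields M S"
  shows "smooth_on M X" "p \<notin> M \<Longrightarrow> X p = 0" "curve_symmetry M S X"
  using assms by (simp_all add: symmetry_fields_def del: split_paired_All)

context linear_equation
begin

lemma affine_zero_on_M:
  fixes a b c d :: complex
  assumes "\<And>p. p \<in> M \<Longrightarrow> a * complex_of_real (fst p) + b * complex_of_real (Re (snd p)) + c * complex_of_real (Im (snd p)) + d = 0"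
  shows "a = 0 \<and> b = 0 \<and> c = 0 \<and> d = 0"
proof -
  obtain p0 where p0: "p0 \<in> M" using nonempty_G by (auto simp: cbase_def)
  have P: "partials_on M (\<lambda>p. a * complex_of_real (fst p) + b * complex_of_real (Re (snd p)) + c * complex_of_real (Im (snd p)) + d)
      (\<lambda>p. a) (\<lambda>p. b) (\<lambda>p. c)"
    by (rule partials_on_eq_rhs, (rule partials_intros)+) simp_all
  have "a = 0" "b = 0" "c = 0"
    using partials_on_eqD[OF open_M P partials_const[of M 0] assms p0] by simp_all
  then show ?thesis using assms[OF p0] by simp
qed

definition projective_on_M where
  "projective_on_M v = (\<lambda>p. if p \<in> M then projective_field v p else 0)"

text \<open>
  A polynomial that vanishes on the open set \<open>M\<close> has vanishing coefficients; taking first derivatives reduces this to affine functions.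
\<close>

lemma projective_on_M_injective:
  assumes "projective_on_M v = 0"
  shows "v = 0"
proof -
  obtain k0 k1 k2 \<mu> \<nu> c1 c2 d0 d1 where v: "v = (k0, k1, k2, \<mu>, \<nu>, c1, c2, d0, d1)" by (rule projective_parameters)
  let ?x = "\<lambda>p::cpoint. complex_of_real (fst p)" and ?y = "\<lambda>p::cpoint. complex_of_real (Re (snd p))"
    and ?z = "\<lambda>p::cpoint. complex_of_real (Im (snd p))"
  let ?C = complex_of_real
  have z: "projective_field v p = 0" if "p \<in> M" for p
    using fun_cong[OF assms, of p] that by (simp add: projective_on_M_def zero_fun_def)
  let ?\<xi> = "\<lambda>p. ?C k0 + ?C k1 * ?x p + ?C k2 * ?x p * ?x p + (?C (Re \<mu>) + ?x p * ?C (Re \<nu>)) * ?y p + (?C (Im \<mu>) + ?x p * ?C (Im \<nu>)) * ?z p"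
  have \<xi>: "?\<xi> p = 0" if p: "p \<in> M" for p
  proof -
    have "?\<xi> p = ?C (fst (projective_field v p))"
      by (cases p) (simp add: projective_field_def v inner_complex_def algebra_simps power2_eq_square)
    then show ?thesis using z[OF p] by simp
  qed
  have P: "partials_on M ?\<xi> (\<lambda>p. (2 * ?C k2) * ?x p + ?C (Re \<nu>) * ?y p + ?C (Im \<nu>) * ?z p + ?C k1)
      (\<lambda>p. ?C (Re \<mu>) + ?x p * ?C (Re \<nu>)) (\<lambda>p. ?C (Im \<mu>) + ?x p * ?C (Im \<nu>))"
    by (rule partials_on_eq_rhs, (rule partials_intros)+) (simp_all add: algebra_simps)
  have "2 * ?C k2 = 0 \<and> ?C (Re \<nu>) = 0 \<and> ?C (Im \<nu>) = 0 \<and> ?C k1 = 0"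
    by (rule affine_zero_on_M) (use partials_on_eqD(1)[OF open_M P partials_const[of M 0] \<xi>] in simp)
  then have k: "k2 = 0" "k1 = 0" "\<nu> = 0" by (simp_all add: complex_eq_iff)
  have "(0::complex) = 0 \<and> ?C (Re \<mu>) = 0 \<and> ?C (Im \<mu>) = 0 \<and> ?C k0 = 0"
    by (rule affine_zero_on_M[of 0]) (use \<xi> k in \<open>simp add: algebra_simps\<close>)
  then have k': "k0 = 0" "\<mu> = 0" by (simp_all add: complex_eq_iff)
  have "d1 = 0 \<and> c1 = 0 \<and> c2 = 0 \<and> d0 = 0"
  proof (rule affine_zero_on_M)
    fix p assume p: "p \<in> M"
    have "snd (projective_field v p) = d1 * ?x p + c1 * ?y p + c2 * ?z p + d0"
      by (cases p) (simp add: projective_field_def v k scaleR_conv_of_real algebra_simps)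
    then show "d1 * ?x p + c1 * ?y p + c2 * ?z p + d0 = 0" using z[OF p] by simp
  qed
  then show ?thesis by (simp add: v k k' zero_prod_def)
qed

lemma symmetry_fieldsI:
  assumes "smooth_on M Y" "curve_symmetry M S (\<lambda>p. if p \<in> M then Y p else 0)"
  shows "(\<lambda>p. if p \<in> M then Y p else 0) \<in> symmetry_fields M S"
  unfolding symmetry_fields_def using assms smooth_on_cong[OF open_M _ assms(1), of "\<lambda>p. if p \<in> M then Y p else 0"] by simp

lemma smooth_projective_field: "smooth_on M (projective_field v)"
proof -
  obtain k0 k1 k2 \<mu> \<nu> c1 c2 d0 d1 where v: "v = (k0, k1, k2, \<mu>, \<nu>, c1, c2, d0, d1)" by (rule projective_parameters)
  have "smooth_on M (\<lambda>p. (k0 + k1 * fst p + k2 * (fst p * fst p) + (\<mu> + fst p *\<^sub>R \<nu>) \<bullet> snd p,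
      (k2 * fst p + \<nu> \<bullet> snd p) *\<^sub>R snd p + Re (snd p) *\<^sub>R c1 + Im (snd p) *\<^sub>R c2 + d0 + fst p *\<^sub>R d1))"
    by (intro smooth_intros smooth_on_bilinear[OF bounded_bilinear_inner] smooth_on_linear_compose[OF bounded_linear_Re]
        smooth_on_linear_compose[OF bounded_linear_Im] open_M)
  moreover have "projective_field v = (\<lambda>p. (k0 + k1 * fst p + k2 * (fst p * fst p) + (\<mu> + fst p *\<^sub>R \<nu>) \<bullet> snd p,
      (k2 * fst p + \<nu> \<bullet> snd p) *\<^sub>R snd p + Re (snd p) *\<^sub>R c1 + Im (snd p) *\<^sub>R c2 + d0 + fst p *\<^sub>R d1))"
    by (auto simp: fun_eq_iff projective_field_def v power2_eq_square)
  ultimately show ?thesis by simp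
qed

lemma flat_symmetry_fields:
  assumes "\<And>x. x \<in> I \<Longrightarrow> \<beta> x = 0"
  shows "symmetry_fields M S = range projective_on_M"
proof (intro set_eqI iffI)
  fix X assume X: "X \<in> symmetry_fields M S"
  then have X': "curve_symmetry M S X" "smooth_on M X" "\<And>p. p \<notin> M \<Longrightarrow> X p = 0"
    by (auto dest: symmetry_fieldsD)
  obtain k0 k1 k2 \<mu> \<nu> c1 c2 d0 d1 where f: "\<And>p. p \<in> M \<Longrightarrow> X p = projective_field (k0, k1, k2, \<mu>, \<nu>, c1, c2, d0, d1) p"
    by (rule flat_symmetry_form[OF X'(1,2) assms]; (assumption)?) (rule that; assumption)
  have "X = projective_on_M (k0, k1, k2, \<mu>, \<nu>, c1, c2, d0, d1)"
    by (rule ext) (simp add: projective_on_M_def f X'(3))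
  then show "X \<in> range projective_on_M" by blast
next
  fix X assume "X \<in> range projective_on_M"
  then obtain v where "X = projective_on_M v" by blast
  moreover obtain k0 k1 k2 \<mu> \<nu> c1 c2 d0 d1 where "v = (k0, k1, k2, \<mu>, \<nu>, c1, c2, d0, d1)" by (rule projective_parameters)
  ultimately have X: "X = projective_on_M (k0, k1, k2, \<mu>, \<nu>, c1, c2, d0, d1)" by simp
  have "curve_symmetry M S (\<lambda>p. if p \<in> M then projective_field (k0, k1, k2, \<mu>, \<nu>, c1, c2, d0, d1) p else 0)"
    by (rule projective_symmetry[OF assms]) auto
  then show "X \<in> symmetry_fields M S"
    unfolding X projective_on_M_def by (rule symmetry_fieldsI[OF smooth_projective_field])
qed

text \<open>
  If \<open>\<beta>\<close> does not vanish identically, then \<open>q \<partial>\<^sub>x\<close> occurs for at most a line of quadratics \<open>q\<close>: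
  \<open>q\<^sup>2 \<beta>\<close> is constant, so a \<open>q\<close> that vanishes where \<open>\<beta>\<close> does not is zero.
\<close>

definition compatible :: "real \<times> real \<times> real \<Rightarrow> bool" where
  "compatible = (\<lambda>(k0, k1, k2). \<forall>x\<in>I. beta' x * (k0 + k1 * x + k2 * x\<^sup>2) + 2 * \<beta> x * (k1 + 2 * k2 * x) = 0)"

lemma compatibleD:
  "compatible (k0, k1, k2) \<Longrightarrow> x \<in> I \<Longrightarrow> beta' x * (k0 + k1 * x + k2 * x\<^sup>2) + 2 * \<beta> x * (k1 + 2 * k2 * x) = 0"
  unfolding compatible_def split_conv by blast

lemma compatible_zero:
  assumes "compatible (k0, k1, k2)" "x1 \<in> I" "\<beta> x1 \<noteq> 0" "k0 + k1 * x1 + k2 * x1\<^sup>2 = 0"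
  shows "k0 = 0 \<and> k1 = 0 \<and> k2 = 0"
proof -
  define q where "q = (\<lambda>x. k0 + k1 * x + k2 * x\<^sup>2)"
  have dq: "(q has_real_derivative k1 + 2 * k2 * x) (at x)" for x
    unfolding q_def by (auto intro!: derivative_eq_intros)
  have cvx: "convex I" using open_interval_I by (simp add: open_interval_def is_interval_convex)
  have "((\<lambda>x. \<beta> x * (q x)\<^sup>2) has_real_derivative 0) (at x within I)" if x: "x \<in> I" for x
  proof -
    have "((\<lambda>x. \<beta> x * (q x)\<^sup>2) has_real_derivative q x * (beta' x * q x + 2 * \<beta> x * (k1 + 2 * k2 * x))) (at x)"
      by (rule DERIV_cong[OF DERIV_mult[OF beta_derivative[OF x] DERIV_power[OF dq, of 2]]])
         (simp add: algebra_simps power2_eq_square)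
    moreover have "beta' x * q x + 2 * \<beta> x * (k1 + 2 * k2 * x) = 0"
      using compatibleD[OF assms(1) x] by (simp add: q_def)
    ultimately show ?thesis by (simp add: has_field_derivative_at_within)
  qed
  from has_field_derivative_zero_constant[OF cvx this] obtain c where c: "\<And>x. x \<in> I \<Longrightarrow> \<beta> x * (q x)\<^sup>2 = c" by auto
  have c0: "\<beta> x * (q x)\<^sup>2 = 0" if "x \<in> I" for x
    using c[OF that] c[OF assms(2)] assms(4) by (simp add: q_def)
  have "open (I \<inter> \<beta> -` (- {0}))"
    by (rule continuous_open_preimage[OF continuous_beta open_I]) auto
  moreover have "x1 \<in> I \<inter> \<beta> -` (- {0})" using assms by simp
  ultimately obtain r where r: "r > 0" "ball x1 r \<subseteq> I \<inter> \<beta> -` (- {0})" by (rule openE)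
  have "complex_of_real k0 + complex_of_real k1 * p + complex_of_real k2 * p ^ 2 + (0::complex) * p ^ 3 = 0" if "\<bar>p - x1\<bar> < r" for p :: real
  proof -
    have "p \<in> ball x1 r" using that by (simp add: dist_real_def abs_minus_commute)
    then have "p \<in> I" "\<beta> p \<noteq> 0" using r(2) by auto
    then have "q p = 0" using c0[of p] by simp
    then have "complex_of_real (q p) = 0" by simp
    then show ?thesis by (simp add: q_def)
  qed
  from cubic_vanishing_real[OF r(1) this] show ?thesis by simp
qed

lemma compatible_line:
  assumes "x1 \<in> I" "\<beta> x1 \<noteq> 0" "compatible K" "K \<noteq> 0" "compatible k"
  shows "\<exists>r. k = r *\<^sub>R K"
proof -
  obtain K0 K1 K2 k0 k1 k2 where Kk: "K = (K0, K1, K2)" "k = (k0, k1, k2)" by (cases K, cases k)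
  define A where "A = K0 + K1 * x1 + K2 * x1\<^sup>2"
  have "A \<noteq> 0"
    using compatible_zero[OF assms(3)[unfolded Kk] assms(1,2)] assms(4) unfolding A_def Kk by (auto simp: zero_prod_def)
  define r where "r = (k0 + k1 * x1 + k2 * x1\<^sup>2) / A"
  have "compatible (k0 - r * K0, k1 - r * K1, k2 - r * K2)"
    unfolding compatible_def split_conv
  proof
    fix x assume x: "x \<in> I"
    have "beta' x * (k0 - r * K0 + (k1 - r * K1) * x + (k2 - r * K2) * x\<^sup>2) + 2 * \<beta> x * (k1 - r * K1 + 2 * (k2 - r * K2) * x)
      = (beta' x * (k0 + k1 * x + k2 * x\<^sup>2) + 2 * \<beta> x * (k1 + 2 * k2 * x))
       - r * (beta' x * (K0 + K1 * x + K2 * x\<^sup>2) + 2 * \<beta> x * (K1 + 2 * K2 * x))"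
      by (simp add: algebra_simps)
    also have "\<dots> = 0" using compatibleD[OF assms(3)[unfolded Kk] x] compatibleD[OF assms(5)[unfolded Kk] x] by simp
    finally show "beta' x * (k0 - r * K0 + (k1 - r * K1) * x + (k2 - r * K2) * x\<^sup>2) + 2 * \<beta> x * (k1 - r * K1 + 2 * (k2 - r * K2) * x) = 0" .
  qed
  moreover have "(k0 - r * K0) + (k1 - r * K1) * x1 + (k2 - r * K2) * x1\<^sup>2 = 0"
  proof -
    have "(k0 - r * K0) + (k1 - r * K1) * x1 + (k2 - r * K2) * x1\<^sup>2 = (k0 + k1 * x1 + k2 * x1\<^sup>2) - r * A"
      by (simp add: A_def algebra_simps)
    then show ?thesis using \<open>A \<noteq> 0\<close> by (simp add: r_def)
  qed
  ultimately have "k0 - r * K0 = 0 \<and> k1 - r * K1 = 0 \<and> k2 - r * K2 = 0"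
    using compatible_zero assms(1,2) by blast
  then show ?thesis unfolding Kk by (intro exI[of _ r]) simp
qed

definition quadratic_on_M ::
  "(real \<Rightarrow> complex) \<Rightarrow> (real \<Rightarrow> complex) \<Rightarrow> real \<times> real \<times> real \<Rightarrow> complex \<times> complex \<times> complex \<Rightarrow> cpoint \<Rightarrow> cpoint" where
  "quadratic_on_M f1 f2 = (\<lambda>(k0, k1, k2) (c, a, b) p. if p \<in> M then
     (k0 + k1 * fst p + k2 * (fst p)\<^sup>2,
      complex_of_real (k1 / 2 + k2 * fst p) * snd p + c * snd p + a * f1 (fst p) + b * f2 (fst p)) else 0)"

lemma quadratic_on_M_symmetry:
  assumes "compatible k" "solves \<beta> I f1 f1'" "solves \<beta> I f2 f2'"
  shows "quadratic_on_M f1 f2 k v \<in> symmetry_fields M S"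
proof -
  obtain k0 k1 k2 c a b where kv: "k = (k0, k1, k2)" "v = (c, a, b)" by (cases k, cases v)
  have sm: "smooth_on M (\<lambda>p. f (fst p))" if "solves \<beta> I f f'" for f f'
    by (rule smooth_on_compose[OF open_M open_I _ _ solves_smooth(1)[OF open_I that smooth_beta]])
       (auto intro: smooth_on_linear[OF bounded_linear_fst open_M])
  have "smooth_on M (\<lambda>p. (k0 + k1 * fst p + k2 * (fst p * fst p),
      complex_of_real (k1 / 2 + k2 * fst p) * snd p + c * snd p + a * f1 (fst p) + b * f2 (fst p)))"
    by (intro smooth_intros open_M sm[OF assms(2)] sm[OF assms(3)]) auto
  moreover have "curve_symmetry M S (quadratic_on_M f1 f2 k v)"
    by (rule quadratic_symmetry[OF _ solves_combination[OF assms(2,3)], of k0 k1 k2 _ c a b])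
       (use compatibleD[OF assms(1)[unfolded kv]] in \<open>auto simp: kv quadratic_on_M_def\<close>)
  ultimately show ?thesis
    using symmetry_fieldsI unfolding kv quadratic_on_M_def split_conv power2_eq_square by blast
qed

lemma curved_symmetry_field_form:
  assumes "x1 \<in> I" "\<beta> x1 \<noteq> 0" "solves \<beta> I f1 f1'" "solves \<beta> I f2 f2'"
    "\<And>x. x \<in> I \<Longrightarrow> f1 x * f2' x - f1' x * f2 x = 1" and X: "X \<in> symmetry_fields M S"
  shows "\<exists>k v. compatible k \<and> X = quadratic_on_M f1 f2 k v"
proof -
  have X': "curve_symmetry M S X" "smooth_on M X" "\<And>p. p \<notin> M \<Longrightarrow> X p = 0"
    using X by (auto dest: symmetry_fieldsD)
  obtain k0 k1 k2 :: real and c a b :: complex where 1: "\<And>x. x \<in> I \<Longrightarrow> beta' x * (k0 + k1 * x + k2 * x\<^sup>2) + 2 * \<beta> x * (k1 + 2 * k2 * x) = 0"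
    and 2: "\<And>x (u::complex). (x, u) \<in> M \<Longrightarrow> X (x, u) = (k0 + k1 * x + k2 * x\<^sup>2, complex_of_real (k1 / 2 + k2 * x) * u + c * u + a * f1 x + b * f2 x)"
    by (rule curved_symmetry_form[OF X'(1,2) assms(1-5)]; (assumption)?) (rule that; assumption)
  have "X = quadratic_on_M f1 f2 (k0, k1, k2) (c, a, b)"
    by (rule ext) (auto simp: quadratic_on_M_def 2 X'(3))
  moreover have "compatible (k0, k1, k2)" using 1 by (simp add: compatible_def)
  ultimately show ?thesis by blast
qed

lemma quadratic_on_M_linear:
  "quadratic_on_M f1 f2 (k + k') (v + v') = quadratic_on_M f1 f2 k v + quadratic_on_M f1 f2 k' v'"
  "quadratic_on_M f1 f2 (r *\<^sub>R k) (r *\<^sub>R v) = pointwise_scale r (quadratic_on_M f1 f2 k v)"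
  by (cases k; cases k'; cases v; cases v'; auto simp: quadratic_on_M_def fun_eq_iff pointwise_scale_def algebra_simps scaleR_conv_of_real add_divide_distrib)+

lemma quadratic_on_M_zero:
  assumes x1: "x1 \<in> I" "\<beta> x1 \<noteq> 0" and f1: "solves \<beta> I f1 f1'" and f2: "solves \<beta> I f2 f2'"
    and W: "\<And>x. x \<in> I \<Longrightarrow> f1 x * f2' x - f1' x * f2 x = 1"
    and k: "compatible k" and z: "quadratic_on_M f1 f2 k v = 0"
  shows "k = 0 \<and> v = 0"
proof -
  obtain k0 k1 k2 c a b where kv: "k = (k0, k1, k2)" "v = (c, a, b)" by (cases k, cases v)
  have z1: "k0 + k1 * fst p + k2 * (fst p)\<^sup>2 = 0"
    and z2: "complex_of_real (k1 / 2 + k2 * fst p) * snd p + c * snd p + a * f1 (fst p) + b * f2 (fst p) = 0" if "p \<in> M" for p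
    using fun_cong[OF z, of p] that by (simp_all add: quadratic_on_M_def kv zero_prod_def)
  have "k0 + k1 * x1 + k2 * x1\<^sup>2 = 0" using z1 x1(1) by auto
  then have k0: "k0 = 0" "k1 = 0" "k2 = 0" using compatible_zero[OF k[unfolded kv] x1] by auto
  have P: "partials_on M (\<lambda>p. f (fst p)) (\<lambda>p. f' (fst p)) (\<lambda>p. 0) (\<lambda>p. 0)" if "solves \<beta> I f f'" for f f'
    by (rule partials_of_x) (rule solvesD(1)[OF that])
  have Q: "partials_on M (\<lambda>p. c * snd p + a * f1 (fst p) + b * f2 (fst p)) (\<lambda>p. a * f1' (fst p) + b * f2' (fst p)) (\<lambda>p. c) (\<lambda>p. c * \<i>)"
    by (rule partials_on_eq_rhs, (rule partials_intros P[OF f1] P[OF f2])+) simp_all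
  have z3: "c * snd p + a * f1 (fst p) + b * f2 (fst p) = 0" if "p \<in> M" for p using z2[OF that] k0 by simp
  obtain p where p: "p \<in> M" using nonempty_G by (auto simp: cbase_def)
  have c: "c = 0" and d: "a * f1' (fst p) + b * f2' (fst p) = 0"
    using partials_on_eqD[OF open_M Q partials_const[of M 0] z3 p] by simp_all
  have v: "a * f1 (fst p) + b * f2 (fst p) = 0" using z3[OF p] c by simp
  have w: "f1 (fst p) * f2' (fst p) - f1' (fst p) * f2 (fst p) = 1" using W p by blast
  have "a = a * (f1 (fst p) * f2' (fst p) - f1' (fst p) * f2 (fst p))" using w by simp
  also have "\<dots> = f2' (fst p) * (a * f1 (fst p) + b * f2 (fst p)) - f2 (fst p) * (a * f1' (fst p) + b * f2' (fst p))"
    by (simp add: algebra_simps)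
  finally have a: "a = 0" unfolding v d by simp
  have "b = b * (f1 (fst p) * f2' (fst p) - f1' (fst p) * f2 (fst p))" using w by simp
  also have "\<dots> = f1 (fst p) * (a * f1' (fst p) + b * f2' (fst p)) - f1' (fst p) * (a * f1 (fst p) + b * f2 (fst p))"
    by (simp add: algebra_simps)
  finally have "b = 0" unfolding v d by simp
  then show ?thesis using k0 c a by (simp add: kv zero_prod_def)
qed

text \<open>
  The 15 parameters of the projective fields if \<open>\<beta> = 0\<close>. Otherwise six real parameters for \<open>c\<close> and the solution \<open>d\<close>, and
  a seventh if a nonzero compatible quadratic exists.
\<close>

theorem symmetry_basis:
  "\<exists>B. finite B \<and> \<not> module.dependent pointwise_scale B \<and> module.span pointwise_scale B = symmetry_fields M S
     \<and> card B \<in> {6, 7, 15}"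
proof (cases "\<forall>x\<in>I. \<beta> x = 0")
  case True
  obtain B where "finite B \<and> \<not> module.dependent pointwise_scale B \<and> module.span pointwise_scale B = range projective_on_M
     \<and> card B = DIM(real \<times> real \<times> real \<times> complex \<times> complex \<times> complex \<times> complex \<times> complex \<times> complex)"
  proof (atomize_elim, rule basis_of_parametrisation)
    show "projective_on_M (v + w) = projective_on_M v + projective_on_M w" for v w
      by (cases v; cases w) (auto simp: projective_on_M_def projective_field_def fun_eq_iff algebra_simps inner_add_left)
    show "projective_on_M (c *\<^sub>R v) = pointwise_scale c (projective_on_M v)" for c v
      by (cases v) (auto simp: projective_on_M_def projective_field_def fun_eq_iff pointwise_scale_def algebra_simps inner_add_left)
  qed (rule projective_on_M_injective)
  moreover have "symmetry_fields M S = range projective_on_M" by (rule flat_symmetry_fields) (use True in blast)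
  ultimately show ?thesis by (intro exI[of _ B]) simp
next
  case False
  then obtain x1 where x1: "x1 \<in> I" "\<beta> x1 \<noteq> 0" by blast
  obtain f1 f1' f2 f2' where f: "solves \<beta> I f1 f1'" "solves \<beta> I f2 f2'"
    and W: "\<And>x. x \<in> I \<Longrightarrow> f1 x * f2' x - f1' x * f2 x = 1"
    by (rule fundamental_pair_exists[OF open_interval_I x1(1) continuous_beta]) (rule that; assumption)
  note form = curved_symmetry_field_form[OF x1 f W] and sym = quadratic_on_M_symmetry[OF _ f]
    and zero = quadratic_on_M_zero[OF x1 f W]
  show ?thesis
  proof (cases "\<exists>K. compatible K \<and> K \<noteq> 0")
    case False
    let ?F = "quadratic_on_M f1 f2 0"
    have c0: "compatible 0" by (simp add: compatible_def zero_prod_def)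
    obtain B where "finite B \<and> \<not> module.dependent pointwise_scale B \<and> module.span pointwise_scale B = range ?F
     \<and> card B = DIM(complex \<times> complex \<times> complex)"
    proof (atomize_elim, rule basis_of_parametrisation)
      show "?F (v + w) = ?F v + ?F w" for v w using quadratic_on_M_linear(1)[of f1 f2 0 0 v w] by simp
      show "?F (c *\<^sub>R v) = pointwise_scale c (?F v)" for c v using quadratic_on_M_linear(2)[of f1 f2 c 0 v] by simp
      show "v = 0" if "?F v = 0" for v using zero[OF _ c0 that] by blast
    qed
    moreover have "symmetry_fields M S = range ?F"
    proof (intro set_eqI iffI)
      fix X assume "X \<in> symmetry_fields M S"
      from form[OF _ this] obtain k v where "compatible k" "X = quadratic_on_M f1 f2 k v" by blast
      moreover from this have "k = 0" using False by blast
      ultimately show "X \<in> range ?F" by simp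
    next
      fix X assume "X \<in> range ?F"
      then show "X \<in> symmetry_fields M S" using sym[OF c0] by auto
    qed
    ultimately show ?thesis by (intro exI[of _ B]) simp
  next
    case True
    then obtain K where K: "compatible K" "K \<noteq> 0" by blast
    let ?F = "\<lambda>rv. quadratic_on_M f1 f2 (fst rv *\<^sub>R K) (snd rv)"
    have cK: "compatible (r *\<^sub>R K)" for r
    proof -
      obtain K0 K1 K2 where [simp]: "K = (K0, K1, K2)" by (cases K)
      have "beta' x * (r * K0 + r * K1 * x + r * K2 * x\<^sup>2) + 2 * \<beta> x * (r * K1 + 2 * (r * K2) * x) = 0" if "x \<in> I" for x
      proof -
        have "beta' x * (r * K0 + r * K1 * x + r * K2 * x\<^sup>2) + 2 * \<beta> x * (r * K1 + 2 * (r * K2) * x) =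
          r * (beta' x * (K0 + K1 * x + K2 * x\<^sup>2) + 2 * \<beta> x * (K1 + 2 * K2 * x))" by (simp add: algebra_simps)
        then show ?thesis using compatibleD[OF K(1)[simplified] that] by simp
      qed
      then show ?thesis by (simp add: compatible_def)
    qed
    obtain B where "finite B \<and> \<not> module.dependent pointwise_scale B \<and> module.span pointwise_scale B = range ?F
     \<and> card B = DIM(real \<times> complex \<times> complex \<times> complex)"
    proof (atomize_elim, rule basis_of_parametrisation)
      show "?F (v + w) = ?F v + ?F w" for v w
        using quadratic_on_M_linear(1)[of f1 f2 "fst v *\<^sub>R K" "fst w *\<^sub>R K" "snd v" "snd w"] by (simp add: scaleR_add_left)
      show "?F (c *\<^sub>R v) = pointwise_scale c (?F v)" for c v
        using quadratic_on_M_linear(2)[of f1 f2 c "fst v *\<^sub>R K" "snd v"] by simp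
      show "v = 0" if "?F v = 0" for v 
      proof -
        have "fst v *\<^sub>R K = 0" "snd v = 0" using zero[OF _ cK that] by blast+
        then show ?thesis using K(2) by (intro prod_eqI) (simp_all only: scaleR_eq_0_iff fst_zero snd_zero simp_thms)
      qed
    qed
    moreover have "symmetry_fields M S = range ?F"
    proof (intro set_eqI iffI)
      fix X assume "X \<in> symmetry_fields M S"
      from form[OF _ this] obtain k v where k: "compatible k" "X = quadratic_on_M f1 f2 k v" by blast
      from compatible_line[OF x1 K k(1)] obtain r where "k = r *\<^sub>R K" by blast
      then have "X = ?F (r, v)" using k(2) by simp
      then show "X \<in> range ?F" by blast
    next
      fix X assume "X \<in> range ?F"
      then show "X \<in> symmetry_fields M S" using sym[OF cK] by auto
    qed
    ultimately show ?thesis by (intro exI[of _ B]) simp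
  qed
qed

end

section \<open>Transport of symmetries by diffeomorphisms\<close>

text \<open>
  A derivative applied to a moving vector is smooth: expand the vector in a basis, as for compositions.
\<close>

lemma smooth_on_pushforward:
  fixes \<Phi> :: "'a::euclidean_space \<Rightarrow> 'b::euclidean_space" and \<Psi> :: "'b \<Rightarrow> 'a"
  assumes "open M" "open M'" "smooth_on M \<Phi>" "smooth_on M' \<Psi>" "\<Psi> ` M' \<subseteq> M" "smooth_on M X"
  shows "smooth_on M' (\<lambda>q. frechet_derivative \<Phi> (at (\<Psi> q)) (X (\<Psi> q)))"
proof -
  have "smooth_on M (\<lambda>p. \<Sum>b\<in>Basis. (X p \<bullet> b) *\<^sub>R frechet_derivative \<Phi> (at p) b)"
    unfolding smooth_on_def
  proof (intro allI C_k_on_sum[OF assms(1)])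
    fix k and b :: 'a
    show "C_k_on k M (\<lambda>p. (X p \<bullet> b) *\<^sub>R frechet_derivative \<Phi> (at p) b)"
      using smooth_on_scaleR[OF assms(1) smooth_on_linear_compose[OF bounded_linear_inner_left assms(1,6)]
          smooth_on_frechet_derivative[OF assms(3)], of b b]
      unfolding smooth_on_def by blast
  qed
  moreover have "(\<Sum>b\<in>Basis. (X p \<bullet> b) *\<^sub>R frechet_derivative \<Phi> (at p) b) = frechet_derivative \<Phi> (at p) (X p)" if "p \<in> M" for p
  proof -
    have lin: "linear (frechet_derivative \<Phi> (at p))"
      by (rule has_derivative_linear[OF smooth_on_has_derivative[OF assms(1,3) that]])
    have "frechet_derivative \<Phi> (at p) (X p) = frechet_derivative \<Phi> (at p) (\<Sum>b\<in>Basis. (X p \<bullet> b) *\<^sub>R b)"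
      by (simp add: euclidean_representation)
    then show ?thesis by (simp add: linear_sum[OF lin] linear_cmul[OF lin])
  qed
  ultimately have "smooth_on M (\<lambda>p. frechet_derivative \<Phi> (at p) (X p))"
    by (rule smooth_on_cong[OF assms(1), rotated])
  from smooth_on_compose[OF assms(2,1,5,4) this] show ?thesis .
qed

lemma derivatives_of_inverse:
  assumes "open M" "open M'" "smooth_on M \<Phi>" "smooth_on M' \<Psi>"
    and "\<And>p. p \<in> M \<Longrightarrow> \<Phi> p \<in> M' \<and> \<Psi> (\<Phi> p) = p" "p \<in> M"
  shows "frechet_derivative \<Psi> (at (\<Phi> p)) (frechet_derivative \<Phi> (at p) v) = v"
proof -
  have "((\<lambda>p. \<Psi> (\<Phi> p)) has_derivative (\<lambda>v. frechet_derivative \<Psi> (at (\<Phi> p)) (frechet_derivative \<Phi> (at p) v))) (at p)"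
    by (rule has_derivative_compose[OF smooth_on_has_derivative[OF assms(1,3,6)] smooth_on_has_derivative[OF assms(2,4)]])
       (use assms(5,6) in blast)
  moreover have "((\<lambda>p. \<Psi> (\<Phi> p)) has_derivative (\<lambda>v. v)) (at p)"
    by (rule has_derivative_transform_within_open[OF has_derivative_ident assms(1,6)]) (use assms(5) in simp)
  ultimately show ?thesis using has_derivative_unique by metis
qed

text \<open>
  The assumptions are symmetric under exchanging the two sides, so each statement about one direction yields the other.
\<close>

locale curve_isomorphism =
  fixes M :: "(real \<times> 'e::euclidean_space) set" and M' :: "(real \<times> 'f::euclidean_space) set"
    and \<Phi> \<Psi> \<tau> \<sigma> S S'
  assumes M: "open M" and M': "open M'" and \<Phi>: "smooth_on M \<Phi>" and \<Psi>: "smooth_on M' \<Psi>"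
    and to: "\<And>p. p \<in> M \<Longrightarrow> \<Phi> p \<in> M' \<and> \<Psi> (\<Phi> p) = p \<and> fst (\<Phi> p) = \<tau> (fst p)"
    and fro: "\<And>q. q \<in> M' \<Longrightarrow> \<Psi> q \<in> M \<and> \<Phi> (\<Psi> q) = q \<and> fst (\<Psi> q) = \<sigma> (fst q)"
    and iv: "\<And>J. open_interval J \<Longrightarrow> J \<subseteq> fst ` M \<Longrightarrow> open_interval (\<tau> ` J)"
      "\<And>K. open_interval K \<Longrightarrow> K \<subseteq> fst ` M' \<Longrightarrow> open_interval (\<sigma> ` K)"
    and SM: "\<And>J f. S J f \<Longrightarrow> graph J f \<subseteq> M" "\<And>K g. S' K g \<Longrightarrow> graph K g \<subseteq> M'"
    and maps: "\<And>J f. open_interval J \<Longrightarrow> S J f \<Longrightarrow> \<exists>g. S' (\<tau> ` J) g \<and> \<Phi> ` graph J f = graph (\<tau> ` J) g"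
      "\<And>K g. open_interval K \<Longrightarrow> S' K g \<Longrightarrow> \<exists>f. S (\<sigma> ` K) f \<and> \<Psi> ` graph K g = graph (\<sigma> ` K) f"
begin

text \<open>
  The transported field has the conjugated flow \<open>\<Phi> \<circ> \<phi> t \<circ> \<Psi>\<close>. As the diffeomorphisms respect the first
  coordinate, they map graphs over an interval to graphs over an interval.
\<close>

lemma curve_symmetry_transport:
  assumes X: "curve_symmetry M S X"
    and X': "\<And>q. q \<in> M' \<Longrightarrow> X' q = frechet_derivative \<Phi> (at (\<Psi> q)) (X (\<Psi> q))"
  shows "curve_symmetry M' S' X'"
  unfolding curve_symmetry_def
proof
  have fst_graph: "J \<subseteq> fst ` A" if "graph J f \<subseteq> A" for J and f :: "real \<Rightarrow> 'c" and A
    using that by (force simp: graph_def)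
  fix q0 assume q0: "q0 \<in> M'"
  then have "\<Psi> q0 \<in> M" using fro by blast
  from bspec[OF X[unfolded curve_symmetry_def] this] obtain \<epsilon> N \<phi> where N: "\<Psi> q0 \<in> N" and flow: "flow_near M X \<epsilon> N \<phi>"
    and mv: "\<forall>J f x0. open_interval J \<and> S J f \<and> graph J f \<subseteq> N \<and> x0 \<in> J \<longrightarrow> moves_solution S \<epsilon> \<phi> J f x0"
    by (elim exE conjE) (rule that; assumption)
  note F = flow_nearD[OF flow]
  define N' where "N' = M' \<inter> \<Psi> -` N"
  define \<phi>' where "\<phi>' = (\<lambda>t q. \<Phi> (\<phi> t (\<Psi> q)))"
  have opN': "open N'" unfolding N'_def by (rule continuous_open_preimage[OF smooth_on_continuous[OF \<Psi>] M' F(2)])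
  have N'D: "q \<in> M'" "\<Psi> q \<in> N" if "q \<in> N'" for q using that by (simp_all add: N'_def)
  have flow': "flow_near M' X' \<epsilon> N' \<phi>'"
    unfolding flow_near_def
  proof (intro conjI ballI)
    let ?T = "{-\<epsilon><..<\<epsilon>}"
    have opT': "open (?T \<times> N')" and opT: "open (?T \<times> N)" by (intro open_Times open_greaterThanLessThan opN' F(2))+
    have s1: "smooth_on (?T \<times> N') (\<lambda>z. (fst z, \<Psi> (snd z)))"
      by (intro smooth_on_Pair smooth_on_fst smooth_on_ident opT'
          smooth_on_compose[OF opT' opN' _ smooth_on_snd[OF opT' smooth_on_ident[OF opT']] smooth_on_subset[OF \<Psi> M' opN']])
         (auto simp: N'_def)
    have s2: "smooth_on (?T \<times> N') (\<lambda>z. (\<lambda>(t, q). \<phi> t q) (fst z, \<Psi> (snd z)))"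
      by (rule smooth_on_compose[OF opT' opT _ s1 F(4)]) (auto simp: N'_def)
    have "smooth_on (?T \<times> N') (\<lambda>z. \<Phi> ((\<lambda>(t, q). \<phi> t q) (fst z, \<Psi> (snd z))))"
    proof (rule smooth_on_compose[OF opT' M _ s2 \<Phi>])
      show "(\<lambda>z. (\<lambda>(t, q). \<phi> t q) (fst z, \<Psi> (snd z))) ` (?T \<times> N') \<subseteq> M"
        using F(6)[OF N'D(2)] by auto
    qed
    then show "smooth_on (?T \<times> N') (\<lambda>(t, q). \<phi>' t q)" by (simp add: \<phi>'_def case_prod_beta')
    show "0 < \<epsilon>" by (rule F(1))
    show "open N'" by (rule opN')
    show "N' \<subseteq> M'" by (auto simp: N'_def)
    fix q assume q: "q \<in> N'"
    show "\<phi>' 0 q = q" using F(5)[OF N'D(2)[OF q]] fro[OF N'D(1)[OF q]] by (simp add: \<phi>'_def)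
    fix t assume t: "t \<in> ?T"
    have pM: "\<phi> t (\<Psi> q) \<in> M" by (rule F(6)[OF N'D(2)[OF q] t])
    then show qM: "\<phi>' t q \<in> M'" using to by (simp add: \<phi>'_def)
    have D: "(\<Phi> has_derivative frechet_derivative \<Phi> (at (\<phi> t (\<Psi> q)))) (at (\<phi> t (\<Psi> q)))"
      by (rule smooth_on_has_derivative[OF M \<Phi> pM])
    have "((\<lambda>s. \<phi> s (\<Psi> q)) has_derivative (\<lambda>h. h *\<^sub>R X (\<phi> t (\<Psi> q)))) (at t)"
      using F(7)[OF N'D(2)[OF q] t] by (simp add: has_vector_derivative_def)
    from has_derivative_compose[OF this D]
    have "((\<lambda>s. \<phi>' s q) has_vector_derivative frechet_derivative \<Phi> (at (\<phi> t (\<Psi> q))) (X (\<phi> t (\<Psi> q)))) (at t)"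
      unfolding \<phi>'_def has_vector_derivative_def by (simp only: linear_cmul[OF has_derivative_linear[OF D]])
    moreover have "\<Psi> (\<phi>' t q) = \<phi> t (\<Psi> q)" using to[OF pM] by (simp add: \<phi>'_def)
    ultimately show "((\<lambda>s. \<phi>' s q) has_vector_derivative X' (\<phi>' t q)) (at t)" using X'[OF qM] by simp
  qed
  have "moves_solution S' \<epsilon> \<phi>' K g y0"
    if K: "open_interval K" and g: "S' K g" and gN: "graph K g \<subseteq> N'" and y0: "y0 \<in> K" for K g y0
  proof -
    have KM: "K \<subseteq> fst ` M'" by (rule fst_graph[OF SM(2)[OF g]])
    have \<tau>\<sigma>: "\<tau> (\<sigma> y) = y" if "y \<in> K" for y
    proof -
      have "(y, g y) \<in> M'" using SM(2)[OF g] that by (auto simp: graph_def)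
      from fro[OF this] to[of "\<Psi> (y, g y)"] show ?thesis by simp
    qed
    obtain f where f: "S (\<sigma> ` K) f" "\<Psi> ` graph K g = graph (\<sigma> ` K) f" using maps(2)[OF K g] by blast
    have \<Psi>g: "\<Psi> (y, g y) = (\<sigma> y, f (\<sigma> y))" if "y \<in> K" for y
    proof -
      have "\<Psi> (y, g y) \<in> graph (\<sigma> ` K) f" using f(2) that by (auto simp: graph_def)
      then obtain x where x: "\<Psi> (y, g y) = (x, f x)" by (auto simp: graph_def)
      have "(y, g y) \<in> M'" using SM(2)[OF g] that by (auto simp: graph_def)
      from fro[OF this] x have "x = \<sigma> y" by simp
      then show ?thesis using x by simp
    qed
    have fN: "graph (\<sigma> ` K) f \<subseteq> N"
      unfolding f(2)[symmetric] using gN by (auto simp: N'_def)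
    have "moves_solution S \<epsilon> \<phi> (\<sigma> ` K) f (\<sigma> y0)"
      by (rule mv[rule_format]) (use iv(2)[OF K KM] f(1) fN y0 in auto)
    then obtain \<delta> J0 where del: "0 < \<delta>" "\<delta> \<le> \<epsilon>" and J0: "open_interval J0" "\<sigma> y0 \<in> J0" "J0 \<subseteq> \<sigma> ` K"
      and mv0: "\<And>t. t \<in> {-\<delta><..<\<delta>} \<Longrightarrow> \<exists>K1 h. open_interval K1 \<and> S K1 h \<and> \<phi> t ` graph J0 f = graph K1 h"
      by (rule moves_solutionE) (rule that; assumption)
    have J0M: "J0 \<subseteq> fst ` M" using fst_graph[OF SM(1)[OF f(1)]] J0(3) by blast
    have sub: "\<tau> ` J0 \<subseteq> K" using J0(3) \<tau>\<sigma> by auto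
    have y0': "y0 \<in> \<tau> ` J0" using \<tau>\<sigma>[OF y0] J0(2) by (metis imageI)
    have \<Psi>0: "\<Psi> ` graph (\<tau> ` J0) g = graph J0 f"
    proof -
      have "\<Psi> (\<tau> x, g (\<tau> x)) = (x, f x)" if "x \<in> J0" for x
      proof -
        obtain y where "y \<in> K" "x = \<sigma> y" using J0(3) \<open>x \<in> J0\<close> by blast
        then show ?thesis using \<Psi>g \<tau>\<sigma> by simp
      qed
      then show ?thesis unfolding graph_def image_image by (intro image_cong refl)
    qed
    have "\<exists>K1 h. open_interval K1 \<and> S' K1 h \<and> \<phi>' t ` graph (\<tau> ` J0) g = graph K1 h" if t: "t \<in> {-\<delta><..<\<delta>}" for t
    proof -
      obtain K1 h where K1: "open_interval K1" "S K1 h" "\<phi> t ` graph J0 f = graph K1 h" using mv0[OF t] by blast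
      obtain h' where h': "S' (\<tau> ` K1) h'" "\<Phi> ` graph K1 h = graph (\<tau> ` K1) h'" using maps(1)[OF K1(1,2)] by blast
      have "\<phi>' t ` graph (\<tau> ` J0) g = \<Phi> ` \<phi> t ` \<Psi> ` graph (\<tau> ` J0) g" unfolding \<phi>'_def image_image ..
      also have "\<dots> = graph (\<tau> ` K1) h'" unfolding \<Psi>0 K1(3) h'(2) ..
      finally show ?thesis using iv(1)[OF K1(1) fst_graph[OF SM(1)[OF K1(2)]]] h'(1) by blast
    qed
    then show ?thesis unfolding moves_solution_def using del iv(1)[OF J0(1) J0M] y0' sub by blast
  qed
  then show "\<exists>\<epsilon> N \<phi>. q0 \<in> N \<and> flow_near M' X' \<epsilon> N \<phi> \<and>
      (\<forall>J f x0. open_interval J \<and> S' J f \<and> graph J f \<subseteq> N \<and> x0 \<in> J \<longrightarrow> moves_solution S' \<epsilon> \<phi> J f x0)"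
    using flow' N q0 by (intro exI[of _ \<epsilon>] exI[of _ N'] exI[of _ \<phi>']) (simp add: N'_def)
qed

lemma reversed: "curve_isomorphism M' M \<Psi> \<Phi> \<sigma> \<tau> S' S"
  by unfold_locales (rule M M' \<Phi> \<Psi> to fro iv SM maps; assumption)+

definition pull_back :: "(real \<times> 'f \<Rightarrow> real \<times> 'f) \<Rightarrow> real \<times> 'e \<Rightarrow> real \<times> 'e" where
  "pull_back X = (\<lambda>p. if p \<in> M then frechet_derivative \<Psi> (at (\<Phi> p)) (X (\<Phi> p)) else 0)"

lemma symmetry_fields_pull_back: "symmetry_fields M S = pull_back ` symmetry_fields M' S'"
proof (intro set_eqI iffI)
  fix Y assume "Y \<in> pull_back ` symmetry_fields M' S'"
  then obtain X where X: "X \<in> symmetry_fields M' S'" "Y = pull_back X" by blast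
  have "smooth_on M (\<lambda>p. frechet_derivative \<Psi> (at (\<Phi> p)) (X (\<Phi> p)))"
    by (rule smooth_on_pushforward[OF M' M \<Psi> \<Phi> _ symmetry_fieldsD(1)[OF X(1)]]) (use to in blast)
  then have "smooth_on M Y"
    by (rule smooth_on_cong[OF M, rotated]) (simp add: X(2) pull_back_def)
  moreover have "curve_symmetry M S Y"
    by (rule curve_isomorphism.curve_symmetry_transport[OF reversed symmetry_fieldsD(3)[OF X(1)]])
       (simp_all add: X(2) pull_back_def)
  ultimately show "Y \<in> symmetry_fields M S" by (simp add: symmetry_fields_def X(2) pull_back_def)
next
  fix Y assume Y: "Y \<in> symmetry_fields M S"
  define X where "X = (\<lambda>q. if q \<in> M' then frechet_derivative \<Phi> (at (\<Psi> q)) (Y (\<Psi> q)) else 0)"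
  have "smooth_on M' (\<lambda>q. frechet_derivative \<Phi> (at (\<Psi> q)) (Y (\<Psi> q)))"
    by (rule smooth_on_pushforward[OF M M' \<Phi> \<Psi> _ symmetry_fieldsD(1)[OF Y]]) (use fro in blast)
  then have "smooth_on M' X"
    by (rule smooth_on_cong[OF M', rotated]) (simp add: X_def)
  moreover have "curve_symmetry M' S' X"
    by (rule curve_symmetry_transport[OF symmetry_fieldsD(3)[OF Y]])
       (simp_all add: X_def)
  ultimately have "X \<in> symmetry_fields M' S'" by (simp add: symmetry_fields_def X_def)
  moreover have "Y = pull_back X"
  proof
    fix p
    show "Y p = pull_back X p"
    proof (cases "p \<in> M")
      case True
      then show ?thesis
        using to[OF True] derivatives_of_inverse[OF M M' \<Phi> \<Psi> _ True, of "Y p"] to by (simp add: pull_back_def X_def)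
    next
      case False
      then show ?thesis using symmetry_fieldsD(2)[OF Y] by (simp add: pull_back_def)
    qed
  qed
  ultimately show "Y \<in> pull_back ` symmetry_fields M' S'" by blast
qed

lemma linear_frechet_inverse: "p \<in> M \<Longrightarrow> linear (frechet_derivative \<Psi> (at (\<Phi> p)))"
  by (rule has_derivative_linear[OF smooth_on_has_derivative[OF M' \<Psi>]]) (use to in blast)

lemma linear_pull_back: "Vector_Spaces.linear pointwise_scale pointwise_scale pull_back"
proof -
  interpret V: vector_space "pointwise_scale :: real \<Rightarrow> (real \<times> 'f \<Rightarrow> real \<times> 'f) \<Rightarrow> _" by (rule vector_space_pointwise_scale)
  interpret V': vector_space "pointwise_scale :: real \<Rightarrow> (real \<times> 'e \<Rightarrow> real \<times> 'e) \<Rightarrow> _" by (rule vector_space_pointwise_scale)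
  show ?thesis
    by unfold_locales
       (auto simp: pull_back_def pointwise_scale_def fun_eq_iff linear_add[OF linear_frechet_inverse] linear_cmul[OF linear_frechet_inverse])
qed

lemma pull_back_injective: "inj_on pull_back (symmetry_fields M' S')"
proof (rule inj_onI)
  fix X Y assume X: "X \<in> symmetry_fields M' S'" and Y: "Y \<in> symmetry_fields M' S'" and eq: "pull_back X = pull_back Y"
  show "X = Y"
  proof
    fix q
    show "X q = Y q"
    proof (cases "q \<in> M'")
      case True
      have inv: "frechet_derivative \<Phi> (at (\<Psi> q)) (frechet_derivative \<Psi> (at q) v) = v" for v
        by (rule derivatives_of_inverse[OF M' M \<Psi> \<Phi> _ True]) (use fro in blast)
      have "frechet_derivative \<Psi> (at q) (X q) = frechet_derivative \<Psi> (at q) (Y q)"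
        using fun_cong[OF eq, of "\<Psi> q"] fro[OF True] by (simp add: pull_back_def)
      then show ?thesis using inv by metis
    next
      case False
      then show ?thesis using symmetry_fieldsD(2)[OF X] symmetry_fieldsD(2)[OF Y] by simp
    qed
  qed
qed

text \<open>
  The dimension is transferred through a basis, since the ambient space of all vector fields is infinite-dimensional.
\<close>

lemma dim_symmetry_fields:
  assumes B: "finite B" "\<not> module.dependent pointwise_scale B" "module.span pointwise_scale B = symmetry_fields M' S'"
  shows "module.subspace pointwise_scale (symmetry_fields M S)"
    "vector_space.dim pointwise_scale (symmetry_fields M S) = card B"
proof -
  interpret V: vector_space "pointwise_scale :: real \<Rightarrow> (real \<times> 'f \<Rightarrow> real \<times> 'f) \<Rightarrow> _" by (rule vector_space_pointwise_scale)
  interpret V': vector_space "pointwise_scale :: real \<Rightarrow> (real \<times> 'e \<Rightarrow> real \<times> 'e) \<Rightarrow> _" by (rule vector_space_pointwise_scale)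
  interpret vector_space_pair "pointwise_scale :: real \<Rightarrow> (real \<times> 'f \<Rightarrow> real \<times> 'f) \<Rightarrow> _" "pointwise_scale :: real \<Rightarrow> (real \<times> 'e \<Rightarrow> real \<times> 'e) \<Rightarrow> _"
    by unfold_locales
  \<comment> \<open>\<open>pull_back\<close> forgets the values of a field outside \<open>M'\<close>, so it is injective only on fields that vanish there.\<close>
  have inj: "inj_on pull_back (V.span B)" using pull_back_injective B(3) by simp
  have span: "V'.span (pull_back ` B) = symmetry_fields M S"
    using linear_span_image[OF linear_pull_back, of B] B(3) symmetry_fields_pull_back by simp
  have ind: "V'.independent (pull_back ` B)"
    by (rule linear_independent_injective_image[OF linear_pull_back B(2) inj])
  show "V'.subspace (symmetry_fields M S)" unfolding span[symmetric] by (rule V'.subspace_span)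
  have "V'.dim (symmetry_fields M S) = card (pull_back ` B)"
    unfolding span[symmetric] by (rule V'.dim_span_eq_card_independent[OF ind])
  also have "\<dots> = card B"
    by (rule card_image[OF inj_on_subset[OF inj V.span_superset]])
  finally show "V'.dim (symmetry_fields M S) = card B" .
qed

end

section \<open>The linearizing transformation as a diffeomorphism\<close>

lemma has_vector_derivative_Complex:
  "((\<lambda>x. Complex (y x) (z x)) has_vector_derivative Complex a b) (at t) \<longleftrightarrow>
     (y has_real_derivative a) (at t) \<and> (z has_real_derivative b) (at t)"
proof
  assume H: "((\<lambda>x. Complex (y x) (z x)) has_vector_derivative Complex a b) (at t)"
  show "(y has_real_derivative a) (at t) \<and> (z has_real_derivative b) (at t)"
    using bounded_linear.has_vector_derivative[OF bounded_linear_Re H] bounded_linear.has_vector_derivative[OF bounded_linear_Im H]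
    by (simp add: has_real_derivative_iff_has_vector_derivative)
next
  assume H: "(y has_real_derivative a) (at t) \<and> (z has_real_derivative b) (at t)"
  have "((\<lambda>x. complex_of_real (y x) + \<i> * complex_of_real (z x)) has_vector_derivative complex_of_real a + \<i> * complex_of_real b) (at t)"
    by (intro has_vector_derivative_add has_vector_derivative_mult_right has_vector_derivative_of_real) (use H in auto)
  then show "((\<lambda>x. Complex (y x) (z x)) has_vector_derivative Complex a b) (at t)" by (simp add: Complex_eq)
qed

text \<open>
  The data of a system that is reducible to the linear form, with the transformation \<open>(x, u) \<mapsto> (\<tau> x, U (x, u))\<close> fixed.
\<close>

locale complex_transformation =
  fixes D :: "jet set" and w1 w2 :: "jet \<Rightarrow> real" and \<beta> :: "real \<Rightarrow> real" and \<tau> :: "real \<Rightarrow> real" and U :: "cpoint \<Rightarrow> complex"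
  assumes open_D: "open D" and connected_D: "connected D" and nonempty_D: "D \<noteq> {}"
    and transformation: "invertible_complex_point_transformation (cbase (real_jet -` D)) \<tau> U"
    and smooth_target: "smooth_on (\<tau> ` fst ` cbase (real_jet -` D)) \<beta>"
    and maps_equation: "maps_scalar_equation (real_jet -` D) (scalar_rhs w1 w2) \<tau> U (scalar_rhs (linear_form_1 \<beta>) (linear_form_2 \<beta>))"
begin

abbreviation "Dc \<equiv> real_jet -` D"
abbreviation "Mc \<equiv> cbase Dc"
abbreviation "Ic \<equiv> fst ` Mc"
abbreviation "\<Omega> \<equiv> (\<lambda>(x, u, v). \<i> * complex_of_real (\<beta> x) * u) :: cjet \<Rightarrow> complex"

lemma linear_rhs: "scalar_rhs (linear_form_1 \<beta>) (linear_form_2 \<beta>) = \<Omega>"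
  by (auto simp: fun_eq_iff scalar_rhs_def linear_form_1_def linear_form_2_def real_jet_def complex_eq_iff)

lemma real_jet_linear: "bounded_linear real_jet"
  unfolding real_jet_def case_prod_beta'
  by (intro bounded_linear_Pair bounded_linear_compose[OF bounded_linear_Re] bounded_linear_compose[OF bounded_linear_Im]
      bounded_linear_fst bounded_linear_snd_comp bounded_linear_fst_comp bounded_linear_snd)

lemma open_Dc: "open Dc"
  by (intro open_vimage open_D linear_continuous_on real_jet_linear)

lemma Mc_eq: "Mc = (\<lambda>(x, y, z, p, q). (x, Complex y z)) ` D"
proof
  show "Mc \<subseteq> (\<lambda>(x, y, z, p, q). (x, Complex y z)) ` D"
    unfolding cbase_def real_jet_def by force
  show "(\<lambda>(x, y, z, p, q). (x, Complex y z)) ` D \<subseteq> Mc"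
  proof
    fix P assume "P \<in> (\<lambda>(x, y, z, p, q). (x, Complex y z)) ` D"
    then obtain x y z p q where "(x, y, z, p, q) \<in> D" "P = (x, Complex y z)" by auto
    then show "P \<in> Mc" by (auto simp: cbase_def real_jet_def intro!: exI[of _ "Complex p q"])
  qed
qed

lemma open_Mc: "open Mc" by (rule open_cbase[OF open_Dc])

lemma connected_Mc: "connected Mc"
  unfolding Mc_eq case_prod_beta' Complex_eq
  by (intro connected_continuous_image connected_D continuous_intros)

lemma nonempty_Mc: "Mc \<noteq> {}" unfolding Mc_eq using nonempty_D by blast

lemma open_interval_Ic: "open_interval Ic"
proof -
  have "connected Ic" by (intro connected_continuous_image continuous_intros connected_Mc)
  then show ?thesis
    using open_image_fst[OF open_Mc] nonempty_Mc by (simp add: open_interval_def is_interval_connected_1)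
qed

lemma open_Ic: "open Ic" using open_interval_Ic by (simp add: open_interval_def)

lemma base_eq: "(x, y, z) \<in> base D \<longleftrightarrow> (x, Complex y z) \<in> Mc"
proof
  assume "(x, y, z) \<in> base D"
  then obtain p q where "(x, y, z, p, q) \<in> D" by (auto simp: base_def)
  then show "(x, Complex y z) \<in> Mc" unfolding Mc_eq by force
qed (auto simp: Mc_eq base_def)

lemma smooth_\<tau>: "smooth_on Ic \<tau>" and smooth_U: "smooth_on Mc U"
  and hol_U: "(\<lambda>u. U (x, u)) holomorphic_on {u. (x, u) \<in> Mc}"
  and deriv_\<tau>: "x \<in> Ic \<Longrightarrow> deriv \<tau> x \<noteq> 0"
  and inj_\<Phi>: "inj_on (point_map \<tau> U) Mc"
  using transformation unfolding invertible_complex_point_transformation_def by blast+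

lemma deriv_U: "(x, u) \<in> Mc \<Longrightarrow> deriv (\<lambda>w. U (x, w)) u \<noteq> 0"
  using transformation unfolding invertible_complex_point_transformation_def by blast

definition \<tau>' :: "real \<Rightarrow> real" where "\<tau>' x = frechet_derivative \<tau> (at x) 1"
definition Ux :: "cpoint \<Rightarrow> complex" where "Ux p = frechet_derivative U (at p) (1, 0)"
definition Uu :: "cpoint \<Rightarrow> complex" where "Uu p = frechet_derivative U (at p) (0, 1)"

lemma \<tau>_derivative: "(\<tau> has_real_derivative \<tau>' x) (at x)" and \<tau>'_nonzero: "\<tau>' x \<noteq> 0" if x: "x \<in> Ic"
proof -
  have D: "(\<tau> has_derivative frechet_derivative \<tau> (at x)) (at x)"
    by (rule smooth_on_has_derivative[OF open_Ic smooth_\<tau> x])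
  have "frechet_derivative \<tau> (at x) h = \<tau>' x * h" for h
    using linear_cmul[OF has_derivative_linear[OF D], of h 1] by (simp add: \<tau>'_def mult.commute)
  then have "frechet_derivative \<tau> (at x) = (*) (\<tau>' x)" by (rule ext)
  with D show 1: "(\<tau> has_real_derivative \<tau>' x) (at x)" by (simp add: has_field_derivative_def)
  then have "deriv \<tau> x = \<tau>' x" by (rule DERIV_imp_deriv)
  then show "\<tau>' x \<noteq> 0" using deriv_\<tau>[OF x] by simp
qed

lemma U_derivative: "(U has_derivative (\<lambda>h. fst h *\<^sub>R Ux p + Uu p * snd h)) (at p)" and Uu_nonzero: "Uu p \<noteq> 0" if p: "p \<in> Mc"
proof -
  obtain x u where xu: "p = (x, u)" by (cases p)
  have D: "(U has_derivative frechet_derivative U (at p)) (at p)"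
    by (rule smooth_on_has_derivative[OF open_Mc smooth_U p])
  have lin: "linear (frechet_derivative U (at p))" by (rule has_derivative_linear[OF D])
  let ?S = "{u. (x, u) \<in> Mc}"
  have opS: "open ?S"
  proof -
    have "?S = (\<lambda>u. (x, u)) -` Mc" by auto
    then show ?thesis by (simp add: open_vimage open_Mc continuous_on_Pair)
  qed
  have "((\<lambda>w. U (x, w)) has_field_derivative deriv (\<lambda>w. U (x, w)) u) (at u)"
    by (rule holomorphic_derivI[OF hol_U opS]) (use p xu in simp)
  \<comment> \<open>Holomorphy in \<open>u\<close> makes the \<open>u\<close>-part of the real derivative a complex multiplication.\<close>
  then have h1: "((\<lambda>w. U (x, w)) has_derivative (*) (deriv (\<lambda>w. U (x, w)) u)) (at u)"
    by (simp add: has_field_derivative_def)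
  have "((\<lambda>w. (x, w)) has_derivative (\<lambda>h. (0, h))) (at u)" by (auto intro!: derivative_eq_intros)
  from has_derivative_compose[OF this D[unfolded xu]]
  have h2: "((\<lambda>w. U (x, w)) has_derivative (\<lambda>h. frechet_derivative U (at p) (0, h))) (at u)" unfolding xu .
  have eq: "frechet_derivative U (at p) (0, h) = deriv (\<lambda>w. U (x, w)) u * h" for h
    using fun_cong[OF has_derivative_unique[OF h2 h1]] .
  then have Uu: "Uu p = deriv (\<lambda>w. U (x, w)) u" by (simp add: Uu_def)
  show "Uu p \<noteq> 0" unfolding Uu using deriv_U p xu by simp
  have "frechet_derivative U (at p) h = fst h *\<^sub>R Ux p + Uu p * snd h" for h
  proof -
    have "h = fst h *\<^sub>R (1, 0) + (0, snd h)" by (simp add: prod_eq_iff)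
    then have "frechet_derivative U (at p) h = frechet_derivative U (at p) (fst h *\<^sub>R (1, 0) + (0, snd h))" by (rule arg_cong)
    then show ?thesis by (simp only: linear_add[OF lin] linear_cmul[OF lin] eq Uu Ux_def)
  qed
  then have "frechet_derivative U (at p) = (\<lambda>h. fst h *\<^sub>R Ux p + Uu p * snd h)" by (rule ext)
  with D show "(U has_derivative (\<lambda>h. fst h *\<^sub>R Ux p + Uu p * snd h)) (at p)" by simp
qed

lemma smooth_coefficients: "smooth_on Mc (\<lambda>p. \<tau>' (fst p))" "smooth_on Mc Ux" "smooth_on Mc Uu"
proof -
  have "smooth_on Ic \<tau>'" unfolding \<tau>'_def[abs_def] by (rule smooth_on_frechet_derivative[OF smooth_\<tau>])
  then show "smooth_on Mc (\<lambda>p. \<tau>' (fst p))"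
    by (rule smooth_on_compose[OF open_Mc open_Ic _ smooth_on_linear[OF bounded_linear_fst open_Mc], rotated]) simp
  show "smooth_on Mc Ux" "smooth_on Mc Uu"
    unfolding Ux_def[abs_def] Uu_def[abs_def] by (rule smooth_on_frechet_derivative[OF smooth_U])+
qed

abbreviation "\<Phi> \<equiv> point_map \<tau> U"

lemma \<Phi>_eq: "\<Phi> p = (\<tau> (fst p), U p)" by (cases p) (simp add: point_map_def)

lemma smooth_\<Phi>: "smooth_on Mc \<Phi>"
proof -
  have "smooth_on Mc (\<lambda>p. (\<tau> (fst p), U p))"
    by (intro smooth_on_Pair open_Mc smooth_U smooth_on_compose[OF open_Mc open_Ic _ smooth_on_linear[OF bounded_linear_fst open_Mc] smooth_\<tau>]) simp
  then show ?thesis by (simp add: \<Phi>_eq[abs_def])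
qed

lemma \<Phi>_derivative:
  assumes "p \<in> Mc"
  shows "(\<Phi> has_derivative (\<lambda>h. (\<tau>' (fst p) * fst h, fst h *\<^sub>R Ux p + Uu p * snd h))) (at p)"
proof -
  have "((\<lambda>p. \<tau> (fst p)) has_derivative (\<lambda>h. \<tau>' (fst p) * fst h)) (at p)"
  proof -
    have x: "fst p \<in> Ic" using assms by blast
    show ?thesis
      by (rule has_derivative_compose[OF has_derivative_fst[OF has_derivative_ident] \<tau>_derivative[OF x, unfolded has_field_derivative_def]])
  qed
  from has_derivative_Pair[OF this U_derivative[OF assms]] show ?thesis by (simp add: \<Phi>_eq[abs_def])
qed

definition M' :: "cpoint set" where "M' = \<Phi> ` Mc"
definition \<Psi> :: "cpoint \<Rightarrow> cpoint" where "\<Psi> = inv_into Mc \<Phi>"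
definition \<sigma> :: "real \<Rightarrow> real" where "\<sigma> = inv_into Ic \<tau>"

lemma \<Psi>\<Phi>: "p \<in> Mc \<Longrightarrow> \<Psi> (\<Phi> p) = p" by (simp add: \<Psi>_def inj_\<Phi>)
lemma \<Psi>_in: "q \<in> M' \<Longrightarrow> \<Psi> q \<in> Mc" by (auto simp: M'_def \<Psi>\<Phi>)
lemma \<Phi>\<Psi>: "q \<in> M' \<Longrightarrow> \<Phi> (\<Psi> q) = q" by (auto simp: M'_def \<Psi>\<Phi>)
lemma \<Phi>_in: "p \<in> Mc \<Longrightarrow> \<Phi> p \<in> M'" by (auto simp: M'_def)

lemma \<tau>_interval: "open_interval (\<tau> ` J)" if J: "open_interval J" "J \<subseteq> Ic"
proof -
  have d: "(\<tau> has_real_derivative \<tau>' x) (at x)" and nz: "\<tau>' x \<noteq> 0" if "x \<in> J" for x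
    using \<tau>_derivative[OF subsetD[OF J(2) that]] \<tau>'_nonzero[OF subsetD[OF J(2) that]] by simp_all
  show ?thesis by (rule interval_diffeomorphism[OF J(1) d nz]; (assumption)?)
qed

lemma inj_\<tau>: "inj_on \<tau> Ic"
proof -
  obtain s where "\<And>x. x \<in> Ic \<Longrightarrow> s (\<tau> x) = x"
    by (rule interval_diffeomorphism[OF open_interval_Ic \<tau>_derivative \<tau>'_nonzero]; (assumption)?) (rule that; assumption)
  then show ?thesis by (rule inj_on_inverseI)
qed

lemma \<sigma>\<tau>: "x \<in> Ic \<Longrightarrow> \<sigma> (\<tau> x) = x" by (simp add: \<sigma>_def inj_\<tau>)

lemma fst_M': "fst ` M' = \<tau> ` Ic" by (simp add: M'_def image_image \<Phi>_eq)

lemma fst_\<Psi>: "q \<in> M' \<Longrightarrow> fst (\<Psi> q) = \<sigma> (fst q)"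
proof -
  assume "q \<in> M'"
  then obtain p where "p \<in> Mc" "q = \<Phi> p" by (auto simp: M'_def)
  then show ?thesis using \<sigma>\<tau>[of "fst p"] by (simp add: \<Psi>\<Phi>) (simp add: \<Phi>_eq)
qed

lemma \<sigma>_interval: "open_interval (\<sigma> ` K)" if K: "open_interval K" "K \<subseteq> fst ` M'"
proof -
  obtain s where s: "\<And>x. x \<in> Ic \<Longrightarrow> s (\<tau> x) = x" "\<And>x. x \<in> Ic \<Longrightarrow> (s has_real_derivative inverse (\<tau>' x)) (at (\<tau> x))"
    by (rule interval_diffeomorphism[OF open_interval_Ic \<tau>_derivative \<tau>'_nonzero]; (assumption)?) (rule that; assumption)
  have K': "\<exists>x\<in>Ic. y = \<tau> x" if "y \<in> K" for y using K(2) that unfolding fst_M' by blast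
  have s': "s y = \<sigma> y" if y: "y \<in> K" for y
  proof -
    obtain x where "x \<in> Ic" "y = \<tau> x" using K'[OF y] by blast
    then show ?thesis using s(1)[of x] \<sigma>\<tau>[of x] by simp
  qed
  have d: "(s has_real_derivative inverse (\<tau>' (s y))) (at y)" and nz: "inverse (\<tau>' (s y)) \<noteq> 0" if y: "y \<in> K" for y
  proof -
    obtain x where x: "x \<in> Ic" "y = \<tau> x" using K'[OF y] by blast
    show "(s has_real_derivative inverse (\<tau>' (s y))) (at y)" using s(2)[OF x(1)] s(1)[OF x(1)] x(2) by simp
    show "inverse (\<tau>' (s y)) \<noteq> 0" using \<tau>'_nonzero[OF x(1)] s(1)[OF x(1)] x(2) by simp
  qed
  have "open_interval (s ` K)" by (rule interval_diffeomorphism[OF K(1) d nz]; (assumption)?)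
  moreover have "s ` K = \<sigma> ` K" using s' by (rule image_cong[OF refl])
  ultimately show ?thesis by simp
qed

text \<open>
  Injectivity is given, so invariance of domain makes the transformation a homeomorphism onto an open set. Its derivative is triangular and
  invertible, which makes the inverse differentiable and, by the bootstrap principle, smooth.
\<close>

lemma open_M': "open M'" and continuous_\<Psi>: "continuous_on M' \<Psi>"
proof -
  have c: "continuous_on Mc \<Phi>" by (rule smooth_on_continuous[OF smooth_\<Phi>])
  show "open M'" unfolding M'_def by (rule invariance_of_domain[OF c open_Mc inj_\<Phi>])
  show "continuous_on M' \<Psi>"
    unfolding M'_def \<Psi>_def by (rule continuous_on_inverse_open[OF open_Mc c order_refl]) (simp add: inj_\<Phi>)
qed

lemma \<Psi>_derivative:
  assumes q: "q \<in> M'"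
  shows "(\<Psi> has_derivative (\<lambda>h. (inverse (\<tau>' (fst (\<Psi> q))) * fst h,
     inverse (Uu (\<Psi> q)) * (snd h - (inverse (\<tau>' (fst (\<Psi> q))) * fst h) *\<^sub>R Ux (\<Psi> q))))) (at q)" (is "(\<Psi> has_derivative ?g) _")
proof (rule has_derivative_inverse_basic[where f = \<Phi> and g = \<Psi> and y = q and T = M', OF \<Phi>_derivative[OF \<Psi>_in[OF q]]])
  have nz: "\<tau>' (fst (\<Psi> q)) \<noteq> 0" "Uu (\<Psi> q) \<noteq> 0" using \<Psi>_in[OF q] \<tau>'_nonzero Uu_nonzero by auto
  have "linear ?g" by (rule linearI) (simp_all add: algebra_simps)
  then show "bounded_linear ?g" by (rule linear_conv_bounded_linear[THEN iffD1])
  show "?g \<circ> (\<lambda>h. (\<tau>' (fst (\<Psi> q)) * fst h, fst h *\<^sub>R Ux (\<Psi> q) + Uu (\<Psi> q) * snd h)) = id"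
    using nz by (auto simp: fun_eq_iff mult.assoc[symmetric])
  show "continuous (at q) \<Psi>" using continuous_\<Psi> open_M' q by (simp add: continuous_on_eq_continuous_at)
qed (use q open_M' \<Phi>\<Psi> in auto)

lemma smooth_\<Psi>: "smooth_on M' \<Psi>"
proof (rule smooth_on_bootstrap[OF open_M' continuous_\<Psi> \<Psi>_derivative])
  fix k and v :: cpoint assume K: "C_k_on k M' \<Psi>"
  have comp: "C_k_on k M' (\<lambda>q. g (\<Psi> q))" if "smooth_on Mc g" for g :: "cpoint \<Rightarrow> 'b::real_normed_vector"
  proof (rule C_k_on_compose[OF open_M' open_Mc _ K])
    show "\<Psi> ` M' \<subseteq> Mc" using \<Psi>_in by blast
    show "C_k_on k Mc g" using that unfolding smooth_on_def by blast
  qed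
  have sm: "smooth_on Mc (\<lambda>p. (inverse (\<tau>' (fst p)) * fst v,
      inverse (Uu p) * (snd v - (inverse (\<tau>' (fst p)) * fst v) *\<^sub>R Ux p)))"
    by (intro smooth_on_Pair smooth_on_mult smooth_on_scaleR smooth_on_inverse smooth_on_diff smooth_on_const open_Mc smooth_coefficients)
       (use \<tau>'_nonzero Uu_nonzero in auto)
  show "C_k_on k M' (\<lambda>q. (inverse (\<tau>' (fst (\<Psi> q))) * fst v,
     inverse (Uu (\<Psi> q)) * (snd v - (inverse (\<tau>' (fst (\<Psi> q))) * fst v) *\<^sub>R Ux (\<Psi> q))))"
    by (rule comp[OF sm])
qed

text \<open>The jets of the linear equation that correspond to jets in \<open>D\<close>, by the prolongation of the inverse transformation.\<close>

definition slope :: "cpoint \<Rightarrow> complex \<Rightarrow> complex" where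
  "slope p Q = (of_real (\<tau>' (fst p)) * Q - Ux p) / Uu p"

definition G :: "cjet set" where
  "G = {j. (fst j, fst (snd j)) \<in> M' \<and>
     (let p = \<Psi> (fst j, fst (snd j)) in (fst p, snd p, slope p (snd (snd j))) \<in> Dc)}"

lemma G_iff: "(s, W, Q) \<in> G \<longleftrightarrow> (s, W) \<in> M' \<and> (fst (\<Psi> (s, W)), snd (\<Psi> (s, W)), slope (\<Psi> (s, W)) Q) \<in> Dc"
  by (simp add: G_def Let_def)

lemma cbase_G: "cbase G = M'"
proof
  show "cbase G \<subseteq> M'" by (auto simp: cbase_def G_iff)
  show "M' \<subseteq> cbase G"
  proof
    fix q assume q: "q \<in> M'"
    define p where "p = \<Psi> q"
    have p: "p \<in> Mc" using \<Psi>_in[OF q] by (simp add: p_def)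
    then obtain v where v: "(fst p, snd p, v) \<in> Dc" by (auto simp: cbase_def)
    have "slope p ((Ux p + Uu p * v) / of_real (\<tau>' (fst p))) = v"
      using \<tau>'_nonzero[of "fst p"] Uu_nonzero[OF p] p by (simp add: slope_def)
    then have "(fst q, snd q, (Ux p + Uu p * v) / of_real (\<tau>' (fst p))) \<in> G"
      using q v by (simp add: G_iff p_def)
    then show "q \<in> cbase G" unfolding cbase_def by (cases q) auto
  qed
qed

lemma open_G: "open G"
proof -
  let ?B = "(\<lambda>j::cjet. (fst j, fst (snd j))) -` M'"
  have opB: "open ?B" by (intro open_vimage open_M' continuous_intros)
  have c1: "continuous_on ?B (\<lambda>j. \<Psi> (fst j, fst (snd j)))"
    by (rule continuous_on_compose2[OF continuous_\<Psi>]) (auto intro!: continuous_intros)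
  have c2: "continuous_on ?B (\<lambda>j. g (\<Psi> (fst j, fst (snd j))))" if "smooth_on Mc g" for g :: "cpoint \<Rightarrow> 'b::real_normed_vector"
    by (rule continuous_on_compose2[OF smooth_on_continuous[OF that] c1]) (use \<Psi>_in in auto)
  have "continuous_on ?B (\<lambda>j. (fst (\<Psi> (fst j, fst (snd j))), snd (\<Psi> (fst j, fst (snd j))), slope (\<Psi> (fst j, fst (snd j))) (snd (snd j))))"
    unfolding slope_def
    by (intro continuous_intros c1 c2[OF smooth_coefficients(2)] c2[OF smooth_coefficients(3)] c2[OF smooth_coefficients(1)])
       (use \<Psi>_in Uu_nonzero in auto)
  from continuous_open_preimage[OF this opB open_Dc]
  have "open (?B \<inter> (\<lambda>j. (fst (\<Psi> (fst j, fst (snd j))), snd (\<Psi> (fst j, fst (snd j))), slope (\<Psi> (fst j, fst (snd j))) (snd (snd j)))) -` Dc)" .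
  moreover have "?B \<inter> (\<lambda>j. (fst (\<Psi> (fst j, fst (snd j))), snd (\<Psi> (fst j, fst (snd j))), slope (\<Psi> (fst j, fst (snd j))) (snd (snd j)))) -` Dc = G"
    by (auto simp: G_iff)
  ultimately show ?thesis by simp
qed

sublocale linear: linear_equation G \<beta>
proof
  show "open G" by (rule open_G)
  have "M' \<noteq> {}" using nonempty_Mc by (simp add: M'_def)
  then show "G \<noteq> {}" unfolding cbase_G[symmetric] by (auto simp: cbase_def)
  show "connected (cbase G)"
    unfolding cbase_G M'_def by (rule connected_continuous_image[OF smooth_on_continuous[OF smooth_\<Phi>] connected_Mc])
  show "smooth_on (fst ` cbase G) \<beta>" unfolding cbase_G fst_M' by (rule smooth_target)
qed

text \<open>
  The image curve solves the linear equation by assumption. It remains to see that its jets lie in \<open>G\<close>: the chain rule for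
  \<open>V (\<tau> x) = U (x, u x)\<close>, solved for the derivative of \<open>u\<close>, is the formula defining \<open>slope\<close>.
\<close>

lemma scalar_solution_forward:
  assumes J: "open_interval J" and u: "scalar_solution_on Dc (scalar_rhs w1 w2) J u"
  shows "\<exists>V. scalar_solution_on G \<Omega> (\<tau> ` J) V \<and> \<Phi> ` graph J u = graph (\<tau> ` J) V"
proof -
  obtain u' where u': "\<And>x. x \<in> J \<Longrightarrow> (x, u x, u' x) \<in> Dc" "\<And>x. x \<in> J \<Longrightarrow> (u has_vector_derivative u' x) (at x)"
    using u by (auto simp: scalar_solution_on_def)
  have "scalar_admissible_on Dc J u" using u' by (auto simp: scalar_admissible_on_def)
  with maps_equation J u obtain V where V: "\<Phi> ` graph J u = graph (\<tau> ` J) V" "scalar_solution_on UNIV \<Omega> (\<tau> ` J) V"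
    unfolding maps_scalar_equation_def linear_rhs by blast
  then obtain Q where Q: "\<And>s. s \<in> \<tau> ` J \<Longrightarrow> (V has_vector_derivative Q s) (at s)"
    "\<And>s. s \<in> \<tau> ` J \<Longrightarrow> (Q has_vector_derivative \<Omega> (s, V s, Q s)) (at s)"
    by (auto simp: scalar_solution_on_def)
  have inM: "(x, u x) \<in> Mc" if "x \<in> J" for x using u'(1)[OF that] by (auto simp: cbase_def)
  have JI: "x \<in> Ic" if "x \<in> J" for x using inM[OF that] by force
  have VU: "U (x, u x) = V (\<tau> x)" if x: "x \<in> J" for x
  proof -
    have "\<Phi> (x, u x) \<in> graph (\<tau> ` J) V" using V(1) x by (auto simp: graph_def)
    then show ?thesis by (auto simp: graph_def \<Phi>_eq)
  qed
  have "(\<tau> x, V (\<tau> x), Q (\<tau> x)) \<in> G" if x: "x \<in> J" for x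
  proof -
    have q: "(\<tau> x, V (\<tau> x)) = \<Phi> (x, u x)" using VU[OF x] by (simp add: \<Phi>_eq)
    have "((\<lambda>x. U (x, u x)) has_vector_derivative (Ux (x, u x) + Uu (x, u x) * u' x)) (at x)"
      using curve_chain[OF U_derivative[OF inM[OF x]] u'(2)[OF x]] by simp
    moreover have "((\<lambda>x. U (x, u x)) has_vector_derivative \<tau>' x *\<^sub>R Q (\<tau> x)) (at x)"
    proof (rule has_vector_derivative_transform_within_open[of _ _ _ J])
      have 1: "(\<tau> has_vector_derivative \<tau>' x) (at x)"
        using \<tau>_derivative[OF JI[OF x]] by (simp add: has_real_derivative_iff_has_vector_derivative)
      show "((\<lambda>x. V (\<tau> x)) has_vector_derivative \<tau>' x *\<^sub>R Q (\<tau> x)) (at x)"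
        using vector_diff_chain_at[OF 1 Q(1)] x by (simp add: o_def)
    qed (use J x VU in \<open>auto simp: open_interval_def\<close>)
    ultimately have "Ux (x, u x) + Uu (x, u x) * u' x = \<tau>' x *\<^sub>R Q (\<tau> x)" by (rule vector_derivative_unique_at)
    then have "slope (x, u x) (Q (\<tau> x)) = u' x"
      using Uu_nonzero[OF inM[OF x]] by (simp add: slope_def scaleR_conv_of_real field_simps)
    then show ?thesis
      unfolding G_iff q \<Psi>\<Phi>[OF inM[OF x]] using \<Phi>_in[OF inM[OF x]] u'(1)[OF x] by simp
  qed
  then have "scalar_solution_on G \<Omega> (\<tau> ` J) V"
    unfolding scalar_solution_on_def using Q by (intro exI[of _ Q]) auto
  then show ?thesis using V(1) by blast
qed

text \<open>
  Membership of the jets of \<open>V\<close> in \<open>G\<close> says that the preimage curve is admissible, and admissible curves are the ones to which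
  the assumption on the transformation applies.
\<close>

lemma scalar_solution_backward:
  assumes K: "open_interval K" and V: "scalar_solution_on G \<Omega> K V"
  shows "\<exists>u. scalar_solution_on Dc (scalar_rhs w1 w2) (\<sigma> ` K) u \<and> \<Psi> ` graph K V = graph (\<sigma> ` K) u"
proof -
  obtain Q where Q: "\<And>s. s \<in> K \<Longrightarrow> (s, V s, Q s) \<in> G" "\<And>s. s \<in> K \<Longrightarrow> (V has_vector_derivative Q s) (at s)"
    "\<And>s. s \<in> K \<Longrightarrow> (Q has_vector_derivative \<Omega> (s, V s, Q s)) (at s)"
    using V by (auto simp: scalar_solution_on_def)
  have inM': "(s, V s) \<in> M'" if "s \<in> K" for s using Q(1)[OF that] by (simp add: G_iff)
  have KM: "K \<subseteq> fst ` M'" using inM' by force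
  define u where "u = (\<lambda>x. snd (\<Psi> (\<tau> x, V (\<tau> x))))"
  have \<tau>\<sigma>: "\<tau> (\<sigma> s) = s" "\<sigma> s \<in> Ic" if s: "s \<in> K" for s
  proof -
    obtain x where "x \<in> Ic" "s = \<tau> x" using subsetD[OF KM s] unfolding fst_M' by blast
    then show "\<tau> (\<sigma> s) = s" "\<sigma> s \<in> Ic" using \<sigma>\<tau>[of x] by simp_all
  qed
  have \<Psi>V: "\<Psi> (s, V s) = (\<sigma> s, u (\<sigma> s))" if "s \<in> K" for s
    using fst_\<Psi>[OF inM'[OF that]] \<tau>\<sigma>[OF that] by (simp add: u_def prod_eq_iff)
  have gr: "\<Psi> ` graph K V = graph (\<sigma> ` K) u"
    unfolding graph_def image_image by (intro image_cong refl) (simp add: \<Psi>V)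
  have \<tau>K: "\<tau> ` \<sigma> ` K = K" using \<tau>\<sigma> by (force simp: image_image)
  have adm: "scalar_admissible_on Dc (\<sigma> ` K) u"
    unfolding scalar_admissible_on_def
  proof (intro exI[of _ "\<lambda>x. slope (x, u x) (Q (\<tau> x))"] ballI conjI)
    fix x assume "x \<in> \<sigma> ` K"
    then obtain s where s: "s \<in> K" "x = \<sigma> s" by blast
    have x: "x \<in> Ic" "\<tau> x = s" using \<tau>\<sigma>[OF s(1)] s(2) by auto
    have p: "\<Psi> (s, V s) = (x, u x)" using \<Psi>V[OF s(1)] s(2) by simp
    have pM: "(x, u x) \<in> Mc" using \<Psi>_in[OF inM'[OF s(1)]] p by simp
    show "(x, u x, slope (x, u x) (Q (\<tau> x))) \<in> Dc"
      using Q(1)[OF s(1)] unfolding G_iff p x(2) by simp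
    have 1: "((\<lambda>s. \<Psi> (s, V s)) has_vector_derivative
        (inverse (\<tau>' x), inverse (Uu (x, u x)) * (Q s - inverse (\<tau>' x) *\<^sub>R Ux (x, u x)))) (at s)"
      using curve_chain[OF \<Psi>_derivative[OF inM'[OF s(1)]] Q(2)[OF s(1)]] p by simp
    have 2: "(\<tau> has_vector_derivative \<tau>' x) (at x)"
      using \<tau>_derivative[OF x(1)] by (simp add: has_real_derivative_iff_has_vector_derivative)
    have "(u has_vector_derivative \<tau>' x *\<^sub>R (inverse (Uu (x, u x)) * (Q s - inverse (\<tau>' x) *\<^sub>R Ux (x, u x)))) (at x)"
      using vector_diff_chain_at[OF 2, unfolded x(2), OF bounded_linear.has_vector_derivative[OF bounded_linear_snd 1]]
      by (simp add: u_def o_def)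
    moreover have "\<tau>' x *\<^sub>R (inverse (Uu (x, u x)) * (Q s - inverse (\<tau>' x) *\<^sub>R Ux (x, u x))) = slope (x, u x) (Q (\<tau> x))"
      using \<tau>'_nonzero[OF x(1)] Uu_nonzero[OF pM] by (simp add: slope_def x(2) scaleR_conv_of_real field_simps)
    ultimately show "(u has_vector_derivative slope (x, u x) (Q (\<tau> x))) (at x)" by simp
  qed
  have "\<Phi> ` graph (\<sigma> ` K) u = graph (\<tau> ` \<sigma> ` K) V"
  proof -
    have "\<Phi> ` graph (\<sigma> ` K) u = \<Phi> ` \<Psi> ` graph K V" unfolding gr ..
    also have "\<dots> = (\<lambda>s. \<Phi> (\<Psi> (s, V s))) ` K" unfolding graph_def image_image ..
    also have "\<dots> = graph K V" unfolding graph_def by (rule image_cong[OF refl \<Phi>\<Psi>[OF inM']])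
    finally show ?thesis unfolding \<tau>K .
  qed
  moreover have "scalar_solution_on UNIV \<Omega> (\<tau> ` \<sigma> ` K) V"
    unfolding \<tau>K scalar_solution_on_def using Q(2,3) by (intro exI[of _ Q]) auto
  ultimately have "scalar_solution_on Dc (scalar_rhs w1 w2) (\<sigma> ` K) u"
    using maps_equation \<sigma>_interval[OF K KM] adm unfolding maps_scalar_equation_def linear_rhs by blast
  then show ?thesis using gr by blast
qed

text \<open>
  Real coordinates: \<open>cx\<close> and \<open>rl\<close> identify \<open>\<real>\<^sup>3\<close> with \<open>\<real> \<times> \<complex>\<close>.
\<close>

definition real_curve :: "real set \<Rightarrow> (real \<Rightarrow> real \<times> real) \<Rightarrow> bool" where
  "real_curve J f = solution_on D w1 w2 J (\<lambda>x. fst (f x)) (\<lambda>x. snd (f x))"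

definition cx :: "point \<Rightarrow> cpoint" where "cx p = (fst p, Complex (fst (snd p)) (snd (snd p)))"
definition rl :: "cpoint \<Rightarrow> point" where "rl p = (fst p, Re (snd p), Im (snd p))"

lemma cx_rl: "cx (rl p) = p" "rl (cx q) = q" by (simp_all add: cx_def rl_def)

lemma bounded_linear_cx: "bounded_linear cx" and bounded_linear_rl: "bounded_linear rl"
proof -
  have "linear cx" by (rule linearI) (simp_all add: cx_def complex_eq_iff)
  then show "bounded_linear cx" by (rule linear_conv_bounded_linear[THEN iffD1])
  have "linear rl" by (rule linearI) (simp_all add: rl_def)
  then show "bounded_linear rl" by (rule linear_conv_bounded_linear[THEN iffD1])
qed

lemma base_iff: "p \<in> base D \<longleftrightarrow> cx p \<in> Mc" by (cases p) (simp add: base_eq cx_def)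

lemma open_base: "open (base D)"
proof -
  have "base D = cx -` Mc" using base_iff by auto
  then show ?thesis by (simp add: open_vimage open_Mc linear_continuous_on bounded_linear_cx)
qed

lemma real_curve_iff:
  "real_curve J f \<longleftrightarrow> scalar_solution_on Dc (scalar_rhs w1 w2) J (\<lambda>x. Complex (fst (f x)) (snd (f x)))"
proof
  assume "real_curve J f"
  then obtain y' z' where H: "\<forall>x\<in>J. (x, fst (f x), snd (f x), y' x, z' x) \<in> D \<and>
        ((\<lambda>x. fst (f x)) has_real_derivative y' x) (at x) \<and> ((\<lambda>x. snd (f x)) has_real_derivative z' x) (at x) \<and>
        (y' has_real_derivative w1 (x, fst (f x), snd (f x), y' x, z' x)) (at x) \<and>
        (z' has_real_derivative w2 (x, fst (f x), snd (f x), y' x, z' x)) (at x)"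
    unfolding real_curve_def solution_on_def by (elim exE)
  show "scalar_solution_on Dc (scalar_rhs w1 w2) J (\<lambda>x. Complex (fst (f x)) (snd (f x)))"
    unfolding scalar_solution_on_def
  proof (intro exI[of _ "\<lambda>x. Complex (y' x) (z' x)"] ballI)
    fix x assume "x \<in> J"
    from bspec[OF H this]
    show "(x, Complex (fst (f x)) (snd (f x)), Complex (y' x) (z' x)) \<in> Dc \<and>
      ((\<lambda>x. Complex (fst (f x)) (snd (f x))) has_vector_derivative Complex (y' x) (z' x)) (at x) \<and>
      ((\<lambda>x. Complex (y' x) (z' x)) has_vector_derivative scalar_rhs w1 w2 (x, Complex (fst (f x)) (snd (f x)), Complex (y' x) (z' x))) (at x)"
      by (simp add: real_jet_def scalar_rhs_def has_vector_derivative_Complex)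
  qed
next
  assume "scalar_solution_on Dc (scalar_rhs w1 w2) J (\<lambda>x. Complex (fst (f x)) (snd (f x)))"
  then obtain u' where H: "\<forall>x\<in>J. (x, Complex (fst (f x)) (snd (f x)), u' x) \<in> Dc \<and>
      ((\<lambda>x. Complex (fst (f x)) (snd (f x))) has_vector_derivative u' x) (at x) \<and>
      (u' has_vector_derivative scalar_rhs w1 w2 (x, Complex (fst (f x)) (snd (f x)), u' x)) (at x)"
    unfolding scalar_solution_on_def by (elim exE)
  obtain y' z' where u': "u' = (\<lambda>x. Complex (y' x) (z' x))"
    by (rule that[of "\<lambda>x. Re (u' x)" "\<lambda>x. Im (u' x)"]) simp
  show "real_curve J f"
    unfolding real_curve_def solution_on_def
  proof (rule exI[of _ y'], rule exI[of _ z'], rule ballI)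
    fix x assume "x \<in> J"
    from bspec[OF H this]
    show "(x, fst (f x), snd (f x), y' x, z' x) \<in> D \<and>
        ((\<lambda>x. fst (f x)) has_real_derivative y' x) (at x) \<and> ((\<lambda>x. snd (f x)) has_real_derivative z' x) (at x) \<and>
        (y' has_real_derivative w1 (x, fst (f x), snd (f x), y' x, z' x)) (at x) \<and>
        (z' has_real_derivative w2 (x, fst (f x), snd (f x), y' x, z' x)) (at x)"
      unfolding u' by (simp add: real_jet_def scalar_rhs_def has_vector_derivative_Complex)
  qed
qed

sublocale iso: curve_isomorphism "base D" M' "\<lambda>p. \<Phi> (cx p)" "\<lambda>q. rl (\<Psi> q)" \<tau> \<sigma> real_curve "scalar_solution_on G \<Omega>"
proof
  show "open (base D)" by (rule open_base)
  show "open M'" by (rule open_M')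
  show "smooth_on (base D) (\<lambda>p. \<Phi> (cx p))"
    by (rule smooth_on_compose[OF open_base open_Mc _ smooth_on_linear[OF bounded_linear_cx open_base] smooth_\<Phi>])
       (simp add: image_subset_iff base_iff)
  show "smooth_on M' (\<lambda>q. rl (\<Psi> q))"
    by (rule smooth_on_linear_compose[OF bounded_linear_rl open_M' smooth_\<Psi>])
  show "\<Phi> (cx p) \<in> M' \<and> rl (\<Psi> (\<Phi> (cx p))) = p \<and> fst (\<Phi> (cx p)) = \<tau> (fst p)" if "p \<in> base D" for p
  proof -
    have "cx p \<in> Mc" using that unfolding base_iff .
    moreover have "fst (\<Phi> (cx p)) = \<tau> (fst p)" unfolding \<Phi>_eq cx_def by simp
    ultimately show ?thesis using \<Phi>_in[of "cx p"] \<Psi>\<Phi>[of "cx p"] by (simp only: cx_rl simp_thms)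
  qed
  show "rl (\<Psi> q) \<in> base D \<and> \<Phi> (cx (rl (\<Psi> q))) = q \<and> fst (rl (\<Psi> q)) = \<sigma> (fst q)" if "q \<in> M'" for q
    unfolding base_iff cx_rl using \<Psi>_in[OF that] \<Phi>\<Psi>[OF that] fst_\<Psi>[OF that] by (simp add: rl_def)
  have "fst ` base D = Ic"
  proof (intro equalityI subsetI)
    fix x assume "x \<in> fst ` base D"
    then obtain p where "p \<in> base D" "x = fst p" by blast
    then have "cx p \<in> Mc" "x = fst (cx p)" unfolding base_iff by (simp_all add: cx_def)
    then show "x \<in> Ic" by blast
  next
    fix x assume "x \<in> Ic"
    then obtain q where "q \<in> Mc" "x = fst q" by blast
    then have "rl q \<in> base D" "x = fst (rl q)" unfolding base_iff cx_rl by (simp_all add: rl_def)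
    then show "x \<in> fst ` base D" by blast
  qed
  then show "open_interval (\<tau> ` J)" if "open_interval J" "J \<subseteq> fst ` base D" for J
    using that by (intro \<tau>_interval) simp_all
  show "open_interval (\<sigma> ` K)" if "open_interval K" "K \<subseteq> fst ` M'" for K by (rule \<sigma>_interval[OF that])
  show "graph J f \<subseteq> base D" if rc: "real_curve J f" for J f
  proof
    fix p assume "p \<in> graph J f"
    then obtain x where x: "x \<in> J" "p = (x, fst (f x), snd (f x))" by (auto simp: graph_def)
    then obtain y' z' where "(x, fst (f x), snd (f x), y', z') \<in> D"
      using rc unfolding real_curve_def solution_on_def by blast
    then show "p \<in> base D" unfolding base_def x(2) by blast
  qed
  show "graph K g \<subseteq> M'" if "scalar_solution_on G \<Omega> K g" for K g
    using that unfolding scalar_solution_on_def graph_def G_iff by blast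
  have cx_graph: "cx ` graph J f = graph J (\<lambda>x. Complex (fst (f x)) (snd (f x)))" for J f
    unfolding graph_def image_image by (simp add: cx_def)
  show "\<exists>g. scalar_solution_on G \<Omega> (\<tau> ` J) g \<and> (\<lambda>p. \<Phi> (cx p)) ` graph J f = graph (\<tau> ` J) g"
    if "open_interval J" "real_curve J f" for J f
    using scalar_solution_forward[OF that(1) that(2)[unfolded real_curve_iff]]
    unfolding image_image[of \<Phi> cx, symmetric] cx_graph .
  show "\<exists>f. real_curve (\<sigma> ` K) f \<and> (\<lambda>q. rl (\<Psi> q)) ` graph K g = graph (\<sigma> ` K) f"
    if K: "open_interval K" "scalar_solution_on G \<Omega> K g" for K g
  proof -
    obtain u where u: "scalar_solution_on Dc (scalar_rhs w1 w2) (\<sigma> ` K) u" "\<Psi> ` graph K g = graph (\<sigma> ` K) u"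
      using scalar_solution_backward[OF K] by blast
    have "real_curve (\<sigma> ` K) (\<lambda>x. (Re (u x), Im (u x)))" unfolding real_curve_iff using u(1) by simp
    moreover have "(\<lambda>q. rl (\<Psi> q)) ` graph K g = graph (\<sigma> ` K) (\<lambda>x. (Re (u x), Im (u x)))"
      unfolding image_image[of rl \<Psi>, symmetric] u(2) unfolding graph_def image_image by (simp add: rl_def)
    ultimately show ?thesis by blast
  qed
qed

text \<open>
  Only a regrouping of quantifiers: a pair of real functions against one function with values in \<open>\<real>\<^sup>2\<close>.
\<close>

lemma generates_iff: "generates_point_symmetries D w1 w2 X \<longleftrightarrow> curve_symmetry (base D) real_curve X"
proof -
  have ex: "(\<exists>K yt zt. open_interval K \<and> solution_on D w1 w2 K yt zt \<and> E = graph K (\<lambda>x. (yt x, zt x))) \<longleftrightarrow>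
      (\<exists>K g. open_interval K \<and> real_curve K g \<and> E = graph K g)" for E
  proof (intro iffI; elim exE)
    fix K yt zt assume "open_interval K \<and> solution_on D w1 w2 K yt zt \<and> E = graph K (\<lambda>x. (yt x, zt x))"
    then show "\<exists>K g. open_interval K \<and> real_curve K g \<and> E = graph K g"
      by (intro exI[of _ K] exI[of _ "\<lambda>x. (yt x, zt x)"]) (simp add: real_curve_def)
  next
    fix K g assume "open_interval K \<and> real_curve K g \<and> E = graph K g"
    then show "\<exists>K yt zt. open_interval K \<and> solution_on D w1 w2 K yt zt \<and> E = graph K (\<lambda>x. (yt x, zt x))"
      by (rule_tac exI[of _ K], rule_tac exI[of _ "\<lambda>x. fst (g x)"], rule_tac exI[of _ "\<lambda>x. snd (g x)"]) (simp add: real_curve_def)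
  qed
  have all: "(\<forall>J y z x0. open_interval J \<and> solution_on D w1 w2 J y z \<and> graph J (\<lambda>x. (y x, z x)) \<subseteq> N \<and> x0 \<in> J
        \<longrightarrow> moves_solution real_curve \<epsilon> \<phi> J (\<lambda>x. (y x, z x)) x0) \<longleftrightarrow>
      (\<forall>J f x0. open_interval J \<and> real_curve J f \<and> graph J f \<subseteq> N \<and> x0 \<in> J \<longrightarrow> moves_solution real_curve \<epsilon> \<phi> J f x0)" for N \<epsilon> \<phi>
  proof (intro iffI allI)
    fix J x0 and f :: "real \<Rightarrow> real \<times> real"
    assume H: "\<forall>J y z x0. open_interval J \<and> solution_on D w1 w2 J y z \<and> graph J (\<lambda>x. (y x, z x)) \<subseteq> N \<and> x0 \<in> J
        \<longrightarrow> moves_solution real_curve \<epsilon> \<phi> J (\<lambda>x. (y x, z x)) x0"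
    show "open_interval J \<and> real_curve J f \<and> graph J f \<subseteq> N \<and> x0 \<in> J \<longrightarrow> moves_solution real_curve \<epsilon> \<phi> J f x0"
      using spec[OF spec[OF spec[OF spec[OF H, of J], of "\<lambda>x. fst (f x)"], of "\<lambda>x. snd (f x)"], of x0] by (simp add: real_curve_def)
  next
    fix J y z x0
    assume H: "\<forall>J f x0. open_interval J \<and> real_curve J f \<and> graph J f \<subseteq> N \<and> x0 \<in> J \<longrightarrow> moves_solution real_curve \<epsilon> \<phi> J f x0"
    show "open_interval J \<and> solution_on D w1 w2 J y z \<and> graph J (\<lambda>x. (y x, z x)) \<subseteq> N \<and> x0 \<in> J
        \<longrightarrow> moves_solution real_curve \<epsilon> \<phi> J (\<lambda>x. (y x, z x)) x0"
      using spec[OF spec[OF spec[OF H, of J], of "\<lambda>x. (y x, z x)"], of x0] by (simp add: real_curve_def)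
  qed
  have lf: "local_flow M X \<epsilon> N \<phi> = flow_near M X \<epsilon> N \<phi>" for M X \<epsilon> N \<phi>
    unfolding local_flow_def flow_near_def ..
  show ?thesis
    unfolding generates_point_symmetries_def curve_symmetry_def lf ex moves_solution_def[symmetric] all ..
qed

lemma lie_point_symmetries_eq: "lie_point_symmetries D w1 w2 = symmetry_fields (base D) real_curve"
  unfolding lie_point_symmetries_def symmetry_fields_def generates_iff ..

end

theorem theorem6:
  fixes D :: "jet set" and w1 w2 :: "jet \<Rightarrow> real" and \<beta> :: "real \<Rightarrow> real"
  assumes "open D" and "connected D" and "D \<noteq> {}"
    and "reducible_to_linear_form D w1 w2 \<beta>"
  shows "module.subspace vf_scale (lie_point_symmetries D w1 w2) \<and>
    vector_space.dim vf_scale (lie_point_symmetries D w1 w2) \<in> {6, 7, 15}"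
  proof -
  obtain \<tau> U where "invertible_complex_point_transformation (cbase (real_jet -` D)) \<tau> U"
    "smooth_on (\<tau> ` fst ` cbase (real_jet -` D)) \<beta>"
    "maps_scalar_equation (real_jet -` D) (scalar_rhs w1 w2) \<tau> U (scalar_rhs (linear_form_1 \<beta>) (linear_form_2 \<beta>))"
    using assms(4) unfolding reducible_to_linear_form_def Let_def by blast
  then interpret complex_transformation D w1 w2 \<beta> \<tau> U
    using assms(1-3) by unfold_locales
  obtain B where B: "finite B" "\<not> module.dependent pointwise_scale B"
      "module.span pointwise_scale B = symmetry_fields M' (scalar_solution_on G \<Omega>)" "card B \<in> {6, 7, 15}"
    using linear.symmetry_basis unfolding cbase_G by blast
  have scale: "vf_scale = pointwise_scale"
    by (simp add: fun_eq_iff vf_scale_def pointwise_scale_def)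
  show ?thesis
    unfolding scale lie_point_symmetries_eq
    using iso.dim_symmetry_fields[OF B(1-3)] B(4) by simp
qed

end
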